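(* Let $\alpha\in[0,\tfrac12)$ and $\zeta=\zeta(\alpha)=1-2(2^\alpha-1)$. There exist $\theta_0=\theta_0(\alpha)>0$, $\beta_0=\beta_0(\alpha)$ and constants $c_0(\alpha),c_1(\alpha),c_2(\alpha)>0$ such that for all $0<\theta\le\theta_0$ and all $\beta>\beta_0$ with $$\beta\ge \frac{\zeta}{2^8\theta^2},$$ the following holds. (i) If $0<\alpha<\tfrac12$, set $g(\theta)=\left(\log\frac1\theta\right)\left(\log\log\frac1\theta\right)$ and let $V\subset\mathbb Z$ be an interval centered at the origin with $$\mathrm{diam}(V)=c_0(\alpha)\,e^{g(\theta)}\left(\frac1\theta\right)^{\frac{2}{1-2\alpha}}.$$ Then there is an event of $\mathbb P$-probability at least $1-e^{-g(\theta)}$ on which the $\mu$-probability of the set of configurations $\sigma$ whose runs $(\mathcal L_j)_{b_V\le j\le e_V}$ all satisfy $$c_1(\alpha)\left(\log\frac1\theta\right)^{-\frac{2}{1-2\alpha}}\left(\log\log\frac1\theta\right)^{-\frac{1}{1-2\alpha}}\le \theta^{\frac{2}{1-2\alpha}}\,|\mathcal L_j|\le c_2(\alpha)\left(\log\frac1\theta\right)\left(\log\log\frac1\theta\right)$$ is at least $1-e^{-g(\theta)}$. (ii) If $\alpha=0$, set $\hat g(\theta)=\log\left(\frac{\log(1/\theta)}{\theta}\right)$ and let $\hat V\subset\mathbb Z$ be an interval centered at the origin with $\mathrm{diam}(\hat V)=c_0(0)\,e^{\hat g(\theta)}\theta^{-2}$. Then there is an event of $\mathbb P$-probability at least $1-e^{-\hat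 g(\theta)}$ on which the $\mu$-probability of the set of configurations whose runs $(\mathcal L_j)_{b_{\hat V}\le j\le e_{\hat V}}$ all satisfy $$c_1(0)\le \theta^2|\mathcal L_j|\le c_2(0)\left(\log\frac1\theta\right)^3$$ is at least $1-e^{-\hat g(\theta)}$.
   Context: Random field Ising chain. $(\Omega,\mathcal A,\mathbb P)$ is a probability space carrying i.i.d. random variables $h=(h_i)_{i\in\mathbb Z}$ with $\mathbb P[h_i=1]=\mathbb P[h_i=-1]=\tfrac12$. Spin configurations are $\sigma\in\mathcal S=\{-1,+1\}^{\mathbb Z}$. The pair interaction is $J(1)$, a fixed constant assumed large ($J(1)\gg1$), and $J(n)=n^{-2+\alpha}$ for $n>1$. For finite $\Lambda\subset\mathbb Z$, $\theta>0$, and $\eta\in\mathcal S$, $$H^\eta(\sigma_\Lambda)=\tfrac12\sum_{(i,j)\in\Lambda\times\Lambda}J(|i-j|)(1-\sigma_i\sigma_j)-\theta\sum_{i\in\Lambda}h_i\sigma_i+\sum_{i\in\Lambda}\sum_{j\notin\Lambda}J(|i-j|)(1-\sigma_i\eta_j),$$ and $\mu^\eta_\Lambda(\sigma_\Lambda)=e^{-\beta H^\eta(\sigma_\Lambda)}/Z^\eta_\Lambda$ at inverse temperature $\beta>0$. For $\alpha\in[0,\tfrac12]$, for $\mathbb P$-a.e. realization of $h$, the infinite-volume limits of $\mu^{+}_\Lambda$ and $\mu^-_\Lambda$ (boundary conditions all $+1$, all $-1$) coincide; this unique infinite-volume Gibbs measure is denoted $\mu$ (a random measure depending on $h$). Runs: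 a run is a maximal set of consecutive sites on which $\sigma$ is constant. Given $\sigma$, let $\mathcal L_1$ be the run containing the origin, $\mathcal L_2$ the run immediately to its right, $\mathcal L_0$ the one immediately to its left, and so on, giving the sequence $(\mathcal L_j)_{j\in\mathbb Z}$. For an interval $V\subset\mathbb Z$, $e_V=\sup\{j:\mathcal L_j\subset V\}$ and $b_V=\inf\{j:\mathcal L_j\subset V\}$. *)

theory Defs
  imports "HOL-Probability.Probability"
begin

text \<open>Pair interaction: J(0) is irrelevant (multiplied by 0), J(1) = J1, J(n) = n^(alpha-2) for n > 1.\<close>
definition Jint :: "real \<Rightarrow> real \<Rightarrow> nat \<Rightarrow> real" where
  "Jint J1 \<alpha> n = (if n = 0 then 0 else if n = 1 then J1 else real n powr (\<alpha> - 2))"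

text \<open>Hamiltonian H^eta(sigma_Lambda); sigma is a full configuration, only its values on Lambda matter.\<close>
definition hamiltonian ::
  "real \<Rightarrow> real \<Rightarrow> real \<Rightarrow> (int \<Rightarrow> real) \<Rightarrow> int set \<Rightarrow> (int \<Rightarrow> real) \<Rightarrow> (int \<Rightarrow> real) \<Rightarrow> real" where
  "hamiltonian J1 \<alpha> \<theta> h \<Lambda> \<eta> \<sigma> =
     (1/2) * (\<Sum>i\<in>\<Lambda>. \<Sum>j\<in>\<Lambda>. Jint J1 \<alpha> (nat \<bar>i - j\<bar>) * (1 - \<sigma> i * \<sigma> j))
     - \<theta> * (\<Sum>i\<in>\<Lambda>. h i * \<sigma> i)
     + (\<Sum>i\<in>\<Lambda>. infsum (\<lambda>j. Jint J1 \<alpha> (nat \<bar>i - j\<bar>) * (1 - \<sigma> i * \<eta> j)) (UNIV - \<Lambda>))"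

definition configs :: "int set \<Rightarrow> (int \<Rightarrow> real) \<Rightarrow> (int \<Rightarrow> real) set" where
  "configs \<Lambda> \<eta> = {\<sigma>. (\<forall>i\<in>\<Lambda>. \<sigma> i \<in> {-1, 1}) \<and> (\<forall>i. i \<notin> \<Lambda> \<longrightarrow> \<sigma> i = \<eta> i)}"

definition gibbs_prob ::
  "real \<Rightarrow> real \<Rightarrow> real \<Rightarrow> real \<Rightarrow> (int \<Rightarrow> real) \<Rightarrow> int set \<Rightarrow> (int \<Rightarrow> real) \<Rightarrow> (int \<Rightarrow> real) set \<Rightarrow> real" where
  "gibbs_prob J1 \<alpha> \<theta> \<beta> h \<Lambda> \<eta> A =
     (\<Sum>\<sigma>\<in>configs \<Lambda> \<eta> \<inter> A. exp (- \<beta> * hamiltonian J1 \<alpha> \<theta> h \<Lambda> \<eta> \<sigma>)) /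
     (\<Sum>\<sigma>\<in>configs \<Lambda> \<eta>. exp (- \<beta> * hamiltonian J1 \<alpha> \<theta> h \<Lambda> \<eta> \<sigma>))"

text \<open>Infinite-volume Gibbs measure mu (for the random field h), evaluated on an event A, as the
  limit of the plus-boundary finite-volume measures on the intervals [-n, n].
  (Used only on local events, where this is the infinite-volume limit.)\<close>
definition gibbs_mu ::
  "real \<Rightarrow> real \<Rightarrow> real \<Rightarrow> real \<Rightarrow> (int \<Rightarrow> real) \<Rightarrow> (int \<Rightarrow> real) set \<Rightarrow> real" where
  "gibbs_mu J1 \<alpha> \<theta> \<beta> h A =
     lim (\<lambda>n::nat. gibbs_prob J1 \<alpha> \<theta> \<beta> h {- int n .. int n} (\<lambda>_. 1) A)"

definition field_dist :: "(int \<Rightarrow> real) measure" where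
  "field_dist = PiM UNIV (\<lambda>_::int. measure_pmf (pmf_of_set {-1, 1::real}))"

text \<open>Index of the run containing site x: run containing 0 has index 1, indices increase
  to the right by one at each sign change.\<close>
definition run_index :: "(int \<Rightarrow> real) \<Rightarrow> int \<Rightarrow> int" where
  "run_index \<sigma> x =
     (if 0 \<le> x then 1 + int (card {k \<in> {0..<x}. \<sigma> k \<noteq> \<sigma> (k + 1)})
      else 1 - int (card {k \<in> {x..<0}. \<sigma> k \<noteq> \<sigma> (k + 1)}))"

definition run :: "(int \<Rightarrow> real) \<Rightarrow> int \<Rightarrow> int set" where
  "run \<sigma> j = {x. run_index \<sigma> x = j}"

definition runs_inside :: "(int \<Rightarrow> real) \<Rightarrow> int set \<Rightarrow> int set" where
  "runs_inside \<sigma> V = {j. run \<sigma> j \<noteq> {} \<and> run \<sigma> j \<subseteq> V}"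

text \<open>Indices j with b_V \<le> j \<le> e_V (empty if no run is contained in V).\<close>
definition runs_window :: "(int \<Rightarrow> real) \<Rightarrow> int set \<Rightarrow> int set" where
  "runs_window \<sigma> V = {j. runs_inside \<sigma> V \<noteq> {} \<and>
      Min (runs_inside \<sigma> V) \<le> j \<and> j \<le> Max (runs_inside \<sigma> V)}"

definition centered_interval :: "real \<Rightarrow> int set" where
  "centered_interval D = {i. 2 * \<bar>real_of_int i\<bar> \<le> D}"

definition zeta :: "real \<Rightarrow> real" where
  "zeta \<alpha> = 1 - 2 * (2 powr \<alpha> - 1)"

end

theory Submission
  imports Defs "HOL-Real_Asymp.Real_Asymp"
begin

text \<open>
  Everything reduces to Peierls estimates for flipping a single interval, applied to finite-volume
  measures with plus boundary condition and passed to the limit. The limit exists on local events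
  because the FKG inequality makes the probability that a finite set carries only plus spins
  monotone in the volume.

  Runs are not short: next to a short run there is one that is no longer than either of its
  neighbours. Flipping it gains an interaction energy of order \<open>l\<^sup>\<alpha>\<close> (or \<open>ln l\<close> if
  \<open>\<alpha> = 0\<close>), since \<open>zeta \<alpha> > 0\<close> says that the two adjacent intervals of length \<open>l\<close> outweigh the
  rest of the chain, and by Hoeffding's inequality the random field cannot compensate this gain.

  Runs are not long: among the many disjoint blocks of length comparable to \<open>\<theta> powr (- 2 / (1 - 2 * \<alpha>))\<close>
  in a long interval, each carries with probability bounded below a field sum of a prescribed sign
  that exceeds the surface energy, so that a constant spin on the interval could be flipped
  profitably on one of them.
\<close>

section \<open>The four functions theorem\<close>

text \<open>Two energies compete on an interval of length l: the interaction, of order l^\<alpha>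
  (logarithmic if \<alpha> = 0), and the fluctuation \<theta> sqrt l of the field. For \<alpha> > 0
  they balance at l = \<theta>^(-2/(1-2\<alpha>)), the length scale y of the statement. No entropy
  of contours enters. A bad configuration is assigned to one of finitely many patterns, each given
  by a position, a length and a sign, on which one flip gains energy at least 1 whatever the other
  spins are. So each pattern has probability at most \<open>exp (- \<beta>)\<close> in every large
  volume, and the field has to be controlled only on blocks of the same kind. Both union bounds are
  governed by the count \<open>16 * exp g * y ^ 3\<close>. One exponent \<open>R\<close> that beats
  this count is imposed on Hoeffding's inequality, on the number \<open>K\<close> of blocks (through
  K/24) and on \<beta>. For \<alpha> > 0 the factor g in the upper bound on runs is the price of
  this exponent; for small \<theta> the assumed lower bound on \<beta>, of order \<theta>^-2,
  exceeds it.\<close>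

lemma four_functions_one_point:
  fixes a0 a1 b0 b1 c0 c1 d0 d1 :: real
  assumes nn: "0 \<le> a0" "0 \<le> a1" "0 \<le> b0" "0 \<le> b1" "0 \<le> c0" "0 \<le> c1" "0 \<le> d0" "0 \<le> d1"
    and 00: "a0 * b0 \<le> c0 * d0" and 01: "a0 * b1 \<le> c1 * d0"
    and 10: "a1 * b0 \<le> c1 * d0" and 11: "a1 * b1 \<le> c1 * d1"
  shows "(a0 + a1) * (b0 + b1) \<le> (c0 + c1) * (d0 + d1)"
proof -
  define p q s r where "p = a0 * b1" and "q = a1 * b0" and "s = c1 * d0" and "r = c0 * d1"
  have ps: "p \<le> s" "q \<le> s" and nn': "0 \<le> p" "0 \<le> q" "0 \<le> s" "0 \<le> r"
    using nn 01 10 by (auto simp: p_def q_def s_def r_def)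
  have "p * q = (a0 * b0) * (a1 * b1)" by (simp add: p_def q_def)
  also have "\<dots> \<le> (c0 * d0) * (c1 * d1)" using 00 11 nn by (intro mult_mono[OF 00 11]) auto
  also have "\<dots> = s * r" by (simp add: s_def r_def)
  finally have pq: "p * q \<le> s * r" .
  have "p + q \<le> s + r"
  proof (cases "s = 0")
    case True then show ?thesis using ps nn' by auto
  next
    case False
    \<comment> \<open>Expanded, this is s (p + q) \<le> s^2 + p q; inserting p q \<le> s r allows s
      to be cancelled.\<close>
    have "0 \<le> (s - p) * (s - q)" using ps by simp
    then have "s * (p + q) \<le> s * (s + r)" using pq by (simp add: algebra_simps)
    then show ?thesis using False nn' by (simp add: mult_le_cancel_left)
  qed
  then show ?thesis using 00 11 by (simp add: p_def q_def s_def r_def algebra_simps)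
qed

lemma sum_Pow_insert:
  fixes f :: "'a set \<Rightarrow> real"
  assumes "finite X" "x \<notin> X"
  shows "sum f (Pow (insert x X)) = (\<Sum>A\<in>Pow X. f A + f (insert x A))"
proof -
  have "inj_on (insert x) (Pow X)" using assms by (auto simp: inj_on_def)
  moreover have "Pow X \<inter> insert x ` Pow X = {}" using assms by auto
  ultimately show ?thesis
    using assms by (simp add: Pow_insert sum.union_disjoint sum.reindex sum.distrib)
qed

text \<open>The theorem of Ahlswede and Daykin. Summing each function over whether \<open>x\<close>
  belongs to the set reduces \<open>insert x X\<close> to \<open>X\<close>, and the hypothesis
  survives this summation by the one-point inequality.\<close>

theorem four_functions:
  fixes f1 f2 f3 f4 :: "'a set \<Rightarrow> real"
  assumes "finite X"
    and "\<And>A. 0 \<le> f1 A" "\<And>A. 0 \<le> f2 A" "\<And>A. 0 \<le> f3 A" "\<And>A. 0 \<le> f4 A"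
    and "\<And>A B. A \<subseteq> X \<Longrightarrow> B \<subseteq> X \<Longrightarrow> f1 A * f2 B \<le> f3 (A \<union> B) * f4 (A \<inter> B)"
  shows "sum f1 (Pow X) * sum f2 (Pow X) \<le> sum f3 (Pow X) * sum f4 (Pow X)"
  using assms
proof (induction X arbitrary: f1 f2 f3 f4 rule: finite_induct)
  case empty
  then show ?case using empty(5)[of "{}" "{}"] by simp
next
  case (insert x X)
  have "(\<Sum>A\<in>Pow X. f1 A + f1 (insert x A)) * (\<Sum>A\<in>Pow X. f2 A + f2 (insert x A))
     \<le> (\<Sum>A\<in>Pow X. f3 A + f3 (insert x A)) * (\<Sum>A\<in>Pow X. f4 A + f4 (insert x A))"
  proof (rule insert.IH)
    fix A B assume AB: "A \<subseteq> X" "B \<subseteq> X"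
    have x: "x \<notin> A" "x \<notin> B" using AB insert by auto
    have "f1 A * f2 B \<le> f3 (A \<union> B) * f4 (A \<inter> B)"
      by (rule insert.prems(5)) (use AB in auto)
    moreover have "f1 A * f2 (insert x B) \<le> f3 (insert x (A \<union> B)) * f4 (A \<inter> B)"
      using insert.prems(5)[of A "insert x B"] AB x by auto
    moreover have "f1 (insert x A) * f2 B \<le> f3 (insert x (A \<union> B)) * f4 (A \<inter> B)"
      using insert.prems(5)[of "insert x A" B] AB x by auto
    moreover have "f1 (insert x A) * f2 (insert x B) \<le> f3 (insert x (A \<union> B)) * f4 (insert x (A \<inter> B))"
      using insert.prems(5)[of "insert x A" "insert x B"] AB x by auto
    ultimately show "(f1 A + f1 (insert x A)) * (f2 B + f2 (insert x B))
       \<le> (f3 (A \<union> B) + f3 (insert x (A \<union> B))) * (f4 (A \<inter> B) + f4 (insert x (A \<inter> B)))"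
      by (intro four_functions_one_point insert.prems(1-4))
  qed (use insert.prems in auto)
  then show ?case using insert by (simp add: sum_Pow_insert)
qed

text \<open>Comparison with the integral of t^(\<alpha>-2) from m to infinity, unit step by unit
  step. All distances are at least 2, so the exceptional value \<open>J1\<close> does not
  occur.\<close>

lemma sum_Jint_right_tail:
  fixes F :: "int set"
  assumes "\<alpha> < 1" "0 < m" "finite F" "F \<subseteq> {i + int m + 1..}"
  shows "(\<Sum>j\<in>F. Jint J1 \<alpha> (nat \<bar>i - j\<bar>)) \<le> real m powr (\<alpha> - 1) / (1 - \<alpha>)"
proof -
  have step: "real (Suc d) powr (\<alpha> - 2) \<le> (real d powr (\<alpha> - 1) - real (Suc d) powr (\<alpha> - 1)) / (1 - \<alpha>)"
    if "d > 0" for d :: nat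
  proof -
    have "\<exists>z. real d < z \<and> z < real (Suc d) \<and>
        real (Suc d) powr (\<alpha> - 1) - real d powr (\<alpha> - 1)
          = (real (Suc d) - real d) * ((\<alpha> - 1) * z powr (\<alpha> - 1 - 1))"
      using that by (intro MVT2) (auto intro!: derivative_eq_intros)
    then obtain z where z: "real d < z" "z < real (Suc d)"
      "real (Suc d) powr (\<alpha> - 1) - real d powr (\<alpha> - 1) = (\<alpha> - 1) * z powr (\<alpha> - 2)"
      by auto
    have "real (Suc d) powr (\<alpha> - 2) \<le> z powr (\<alpha> - 2)"
      using z assms by (intro powr_mono2') auto
    also have "\<dots> = (real d powr (\<alpha> - 1) - real (Suc d) powr (\<alpha> - 1)) / (1 - \<alpha>)"
      using z(3) assms by (simp add: field_simps)
    finally show ?thesis .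
  qed
  have tele: "(\<Sum>d=m..<m+k. real (Suc d) powr (\<alpha> - 2))
      \<le> (real m powr (\<alpha> - 1) - real (m + k) powr (\<alpha> - 1)) / (1 - \<alpha>)" for k
  proof (induction k)
    case (Suc k)
    then show ?case using step[of "m + k"] assms by (simp add: diff_divide_distrib)
  qed simp
  \<comment> \<open>The maximum is taken over \<open>F\<close> together with i + m, so that an empty
    \<open>F\<close> gives k = 0.\<close>
  obtain k where k: "F \<subseteq> {i + int m + 1..i + int m + int k}"
  proof -
    have "F \<subseteq> {i + int m + 1..i + int m + int (nat (Max (insert (i + int m) F) - i - int m))}"
    proof
      fix j assume "j \<in> F"
      moreover from this have "j \<le> Max (insert (i + int m) F)" using assms by simp
      ultimately show "j \<in> {i + int m + 1..i + int m + int (nat (Max (insert (i + int m) F) - i - int m))}"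
        using assms by (smt (verit) atLeastAtMost_iff atLeast_iff int_nat_eq subsetD)
    qed
    then show thesis by (rule that)
  qed
  have Jn: "0 \<le> Jint J1 \<alpha> (nat \<bar>i - j\<bar>)" if "j \<in> {i + int m + 1..i + int m + int k}" for j
    using that assms by (auto simp: Jint_def)
  have "(\<Sum>j\<in>F. Jint J1 \<alpha> (nat \<bar>i - j\<bar>)) \<le> (\<Sum>j\<in>{i + int m + 1..i + int m + int k}. Jint J1 \<alpha> (nat \<bar>i - j\<bar>))"
    using k Jn by (intro sum_mono2) auto
  also have "\<dots> = (\<Sum>d=m..<m+k. real (Suc d) powr (\<alpha> - 2))"
    using assms
    by (intro sum.reindex_bij_witness[of _ "\<lambda>d. i + int d + 1" "\<lambda>j. nat (j - i - 1)"])
       (auto simp: Jint_def nat_diff_distrib intro!: arg_cong2[where f = "(powr)"])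
  also have "\<dots> \<le> (real m powr (\<alpha> - 1) - real (m + k) powr (\<alpha> - 1)) / (1 - \<alpha>)" by (rule tele)
  also have "\<dots> \<le> real m powr (\<alpha> - 1) / (1 - \<alpha>)"
    using assms by (intro divide_right_mono) auto
  finally show ?thesis .
qed

lemma sum_Jint_left_tail:
  fixes F :: "int set"
  assumes "\<alpha> < 1" "0 < m" "finite F" "F \<subseteq> {..i - int m - 1}"
  shows "(\<Sum>j\<in>F. Jint J1 \<alpha> (nat \<bar>i - j\<bar>)) \<le> real m powr (\<alpha> - 1) / (1 - \<alpha>)"
proof -
  have "(\<Sum>j\<in>F. Jint J1 \<alpha> (nat \<bar>i - j\<bar>)) = (\<Sum>j\<in>uminus ` F. Jint J1 \<alpha> (nat \<bar>- i - j\<bar>))"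
    by (subst sum.reindex) (auto simp: abs_minus_commute add.commute intro!: sum.cong arg_cong[where f = nat]
        arg_cong[where f = "Jint J1 \<alpha>"])
  also have "\<dots> \<le> real m powr (\<alpha> - 1) / (1 - \<alpha>)"
    by (rule sum_Jint_right_tail) (use assms in auto)
  finally show ?thesis .
qed

section \<open>Finite-volume measures and the infinite-volume limit\<close>

definition flip :: "int set \<Rightarrow> (int \<Rightarrow> real) \<Rightarrow> int \<Rightarrow> real" where
  "flip I \<sigma> = (\<lambda>i. if i \<in> I then - \<sigma> i else \<sigma> i)"

lemma flip_flip [simp]: "flip I (flip I \<sigma>) = \<sigma>"
  by (auto simp: flip_def)

lemma flip_configs:
  assumes "\<sigma> \<in> configs \<Lambda> \<eta>" "I \<subseteq> \<Lambda>"
  shows "flip I \<sigma> \<in> configs \<Lambda> \<eta>"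
  using assms by (auto simp: configs_def flip_def)

text \<open>A plus-boundary configuration is encoded by its set of minus spins, so that the encoding
  does not depend on the volume.\<close>
definition minus_on :: "int set \<Rightarrow> int \<Rightarrow> real" where
  "minus_on S = (\<lambda>i. if i \<in> S then -1 else 1)"

lemma inj_minus_on: "inj minus_on"
proof (rule injI)
  fix S T assume "minus_on S = minus_on T"
  moreover have "S = {i. minus_on S i = -1}" for S by (simp add: minus_on_def)
  ultimately show "S = T" by metis
qed

lemma configs_plus: "configs \<Lambda> (\<lambda>_. 1) = minus_on ` Pow \<Lambda>"
proof -
  have "\<sigma> \<in> minus_on ` Pow \<Lambda>" if "\<sigma> \<in> configs \<Lambda> (\<lambda>_. 1)" for \<sigma>
  proof -
    have "\<sigma> i = minus_on {i\<in>\<Lambda>. \<sigma> i = -1} i" for i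
      using that by (cases "i \<in> \<Lambda>") (auto simp: configs_def minus_on_def)
    then have "\<sigma> = minus_on {i\<in>\<Lambda>. \<sigma> i = -1}" by (rule ext)
    then show ?thesis by blast
  qed
  moreover have "minus_on S \<in> configs \<Lambda> (\<lambda>_. 1)" if "S \<subseteq> \<Lambda>" for S
    using that by (auto simp: configs_def minus_on_def)
  ultimately show ?thesis by blast
qed

lemma finite_configs_plus: "finite \<Lambda> \<Longrightarrow> finite (configs \<Lambda> (\<lambda>_. 1))"
  by (simp add: configs_plus)

lemma sum_configs_plus:
  "(\<Sum>\<sigma>\<in>configs \<Lambda> (\<lambda>_. 1) \<inter> A. f \<sigma>) = (\<Sum>S\<in>{S. S \<subseteq> \<Lambda> \<and> minus_on S \<in> A}. f (minus_on S))"
  by (rule sum.reindex_cong[OF inj_on_subset[OF inj_minus_on]]) (auto simp: configs_plus)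

lemma sum_configs_plus_all:
  "(\<Sum>\<sigma>\<in>configs \<Lambda> (\<lambda>_. 1). f \<sigma>) = (\<Sum>S\<in>Pow \<Lambda>. f (minus_on S))"
  by (rule sum.reindex_cong[OF inj_on_subset[OF inj_minus_on]]) (auto simp: configs_plus)

section \<open>The chain with plus boundary condition: couplings and energy differences\<close>

locale ising_chain =
  fixes J1 \<alpha> \<theta> \<beta> :: real and h :: "int \<Rightarrow> real"
  assumes J1_ge: "1 \<le> J1" and \<alpha>_nonneg: "0 \<le> \<alpha>" and \<alpha>_less: "\<alpha> < 1/2" and \<beta>_pos: "0 < \<beta>"
begin

abbreviation J :: "int \<Rightarrow> int \<Rightarrow> real" where
  "J i j \<equiv> Jint J1 \<alpha> (nat \<bar>i - j\<bar>)"

abbreviation H :: "int set \<Rightarrow> (int \<Rightarrow> real) \<Rightarrow> real" where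
  "H \<Lambda> \<sigma> \<equiv> hamiltonian J1 \<alpha> \<theta> h \<Lambda> (\<lambda>_. 1) \<sigma>"

abbreviation P :: "int set \<Rightarrow> (int \<Rightarrow> real) set \<Rightarrow> real" where
  "P \<Lambda> A \<equiv> gibbs_prob J1 \<alpha> \<theta> \<beta> h \<Lambda> (\<lambda>_. 1) A"

text \<open>As all exterior spins are 1, the boundary term of the Hamiltonian at site
  \<open>i\<close> is this number times 1 - \<sigma> i.\<close>

definition boundary_J :: "int set \<Rightarrow> int \<Rightarrow> real" where
  "boundary_J \<Lambda> i = (\<Sum>\<^sub>\<infinity>j\<in>UNIV - \<Lambda>. J i j)"

lemma J_nonneg: "0 \<le> J i j"
  using J1_ge by (simp add: Jint_def)

lemma J_commute: "J i j = J j i"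
  by (simp add: abs_minus_commute)

lemma J_le: "J i j \<le> J1"
proof -
  have "real n powr (\<alpha> - 2) \<le> 1" if "n > 1" for n
    using that \<alpha>_less by (simp add: powr_less_one less_imp_le)
  then have "real n powr (\<alpha> - 2) \<le> J1" if "n > 1" for n
    using J1_ge order_trans that by blast
  then have "Jint J1 \<alpha> n \<le> J1" for n
    using J1_ge by (simp add: Jint_def)
  then show ?thesis .
qed

text \<open>\<open>infsum\<close> is 0 for a family that is not summable, so this gives the exterior
  couplings their meaning and allows splitting them. The sites within distance 1 are bounded by
  \<open>J1\<close>, the others by the two tails with m = 1.\<close>

lemma J_summable: "J i summable_on A"
proof -
  have "(\<Sum>j\<in>F. J i j) \<le> 3 * J1 + (real 1 powr (\<alpha> - 1) / (1 - \<alpha>) + real 1 powr (\<alpha> - 1) / (1 - \<alpha>))"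
    if "finite F" for F
  proof -
    have "(\<Sum>j\<in>F. J i j) \<le> (\<Sum>j\<in>{i-1,i,i+1} \<union> ({i + int 1 + 1..} \<inter> F \<union> {..i - int 1 - 1} \<inter> F). J i j)"
      using that by (intro sum_mono2) (auto simp: J_nonneg)
    also have "\<dots> = (\<Sum>j\<in>{i-1,i,i+1}. J i j) + ((\<Sum>j\<in>{i + int 1 + 1..} \<inter> F. J i j) + (\<Sum>j\<in>{..i - int 1 - 1} \<inter> F. J i j))"
    proof -
      have "sum (J i) ({i + int 1 + 1..} \<inter> F \<union> {..i - int 1 - 1} \<inter> F)
          = (\<Sum>j\<in>{i + int 1 + 1..} \<inter> F. J i j) + (\<Sum>j\<in>{..i - int 1 - 1} \<inter> F. J i j)"
        using that by (intro sum.union_disjoint) auto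
      then show ?thesis using that by (subst sum.union_disjoint) auto
    qed
    also have "\<dots> \<le> 3 * J1 + (real 1 powr (\<alpha> - 1) / (1 - \<alpha>) + real 1 powr (\<alpha> - 1) / (1 - \<alpha>))"
    proof (intro add_mono)
      show "(\<Sum>j\<in>{i-1,i,i+1}. J i j) \<le> 3 * J1"
        using sum_bounded_above[of "{i-1,i,i+1}" "J i" J1] J_le by simp
      show "(\<Sum>j\<in>{i + int 1 + 1..} \<inter> F. J i j) \<le> real 1 powr (\<alpha> - 1) / (1 - \<alpha>)"
        by (rule sum_Jint_right_tail) (use that \<alpha>_less in auto)
      show "(\<Sum>j\<in>{..i - int 1 - 1} \<inter> F. J i j) \<le> real 1 powr (\<alpha> - 1) / (1 - \<alpha>)"
        by (rule sum_Jint_left_tail) (use that \<alpha>_less in auto)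
    qed
    finally show ?thesis .
  qed
  then have "J i summable_on UNIV"
    by (intro nonneg_bdd_above_summable_on) (auto simp: J_nonneg bdd_above_def)
  then show ?thesis by (rule summable_on_subset_banach) auto
qed

lemma boundary_J_split:
  assumes "finite R" "R \<inter> \<Lambda> = {}"
  shows "boundary_J \<Lambda> i = (\<Sum>j\<in>R. J i j) + boundary_J (\<Lambda> \<union> R) i"
proof -
  have "boundary_J \<Lambda> i = (\<Sum>\<^sub>\<infinity>j\<in>R \<union> (UNIV - (\<Lambda> \<union> R)). J i j)"
    unfolding boundary_J_def using assms by (intro arg_cong[where f = "infsum (J i)"]) auto
  also have "\<dots> = (\<Sum>\<^sub>\<infinity>j\<in>R. J i j) + boundary_J (\<Lambda> \<union> R) i"
    unfolding boundary_J_def by (rule infsum_Un_disjoint) (auto intro: J_summable)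
  finally show ?thesis using assms by simp
qed

lemma H_eq:
  "H \<Lambda> \<sigma> = (1/2) * (\<Sum>i\<in>\<Lambda>. \<Sum>j\<in>\<Lambda>. J i j * (1 - \<sigma> i * \<sigma> j)) - \<theta> * (\<Sum>i\<in>\<Lambda>. h i * \<sigma> i)
     + (\<Sum>i\<in>\<Lambda>. boundary_J \<Lambda> i * (1 - \<sigma> i))"
  unfolding hamiltonian_def boundary_J_def by (simp add: infsum_cmult_left')

text \<open>Cross pairs occur in both orders, which cancels the factor 1/2 for them.\<close>

lemma H_pair_split:
  fixes f :: "int \<Rightarrow> int \<Rightarrow> real"
  assumes "finite I" "finite R" "I \<inter> R = {}" "\<And>i j. f i j = f j i"
  shows "(1/2) * (\<Sum>i\<in>I \<union> R. \<Sum>j\<in>I \<union> R. f i j)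
    = (1/2) * (\<Sum>i\<in>I. \<Sum>j\<in>I. f i j) + (1/2) * (\<Sum>i\<in>R. \<Sum>j\<in>R. f i j) + (\<Sum>i\<in>I. \<Sum>j\<in>R. f i j)"
proof -
  have "(\<Sum>i\<in>R. \<Sum>j\<in>I. f i j) = (\<Sum>i\<in>I. \<Sum>j\<in>R. f i j)"
    by (subst sum.swap) (simp add: assms(4))
  then show ?thesis using assms by (simp add: sum.union_disjoint sum.distrib)
qed

lemma pair_commute: "J i j * (1 - \<sigma> i * \<sigma> j) = J j i * (1 - \<sigma> j * \<sigma> i)"
  using J_commute[of i j] by (simp only: mult.commute)

text \<open>Pairs inside \<open>I\<close> and pairs outside \<open>I\<close> keep their energy; only
  the couplings between \<open>I\<close> and its complement and the field on \<open>I\<close> change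
  sign.\<close>

lemma H_flip:
  assumes "finite \<Lambda>" "I \<subseteq> \<Lambda>"
  shows "H \<Lambda> \<sigma> - H \<Lambda> (flip I \<sigma>)
    = - 2 * (\<Sum>i\<in>I. \<sigma> i * ((\<Sum>j\<in>\<Lambda> - I. J i j * \<sigma> j) + boundary_J \<Lambda> i)) - 2 * \<theta> * (\<Sum>i\<in>I. h i * \<sigma> i)"
proof -
  define R where "R = \<Lambda> - I"
  have fin: "finite I" "finite R" and dis: "I \<inter> R = {}" and un: "\<Lambda> = I \<union> R"
    using assms by (auto simp: R_def intro: finite_subset)
  have sp: "H \<Lambda> \<tau> = (1/2) * (\<Sum>i\<in>I. \<Sum>j\<in>I. J i j * (1 - \<tau> i * \<tau> j))
      + (1/2) * (\<Sum>i\<in>R. \<Sum>j\<in>R. J i j * (1 - \<tau> i * \<tau> j)) + (\<Sum>i\<in>I. \<Sum>j\<in>R. J i j * (1 - \<tau> i * \<tau> j))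
      - \<theta> * ((\<Sum>i\<in>I. h i * \<tau> i) + (\<Sum>i\<in>R. h i * \<tau> i))
      + ((\<Sum>i\<in>I. boundary_J \<Lambda> i * (1 - \<tau> i)) + (\<Sum>i\<in>R. boundary_J \<Lambda> i * (1 - \<tau> i)))" for \<tau>
  proof -
    have "(1/2) * (\<Sum>i\<in>\<Lambda>. \<Sum>j\<in>\<Lambda>. J i j * (1 - \<tau> i * \<tau> j)) = (1/2) * (\<Sum>i\<in>I. \<Sum>j\<in>I. J i j * (1 - \<tau> i * \<tau> j))
      + (1/2) * (\<Sum>i\<in>R. \<Sum>j\<in>R. J i j * (1 - \<tau> i * \<tau> j)) + (\<Sum>i\<in>I. \<Sum>j\<in>R. J i j * (1 - \<tau> i * \<tau> j))"
      unfolding un by (rule H_pair_split) (fact fin dis pair_commute)+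
    moreover have "(\<Sum>i\<in>\<Lambda>. f i) = (\<Sum>i\<in>I. f i) + (\<Sum>i\<in>R. f i)" for f :: "int \<Rightarrow> real"
      unfolding un using fin dis by (simp add: sum.union_disjoint)
    ultimately show ?thesis unfolding H_eq by simp
  qed
  have fI: "flip I \<sigma> i = - \<sigma> i" if "i \<in> I" for i using that by (simp add: flip_def)
  have fR: "flip I \<sigma> i = \<sigma> i" if "i \<in> R" for i using that dis by (auto simp: flip_def)
  have 1: "(\<Sum>i\<in>I. \<Sum>j\<in>I. J i j * (1 - flip I \<sigma> i * flip I \<sigma> j)) = (\<Sum>i\<in>I. \<Sum>j\<in>I. J i j * (1 - \<sigma> i * \<sigma> j))"
    by (intro sum.cong refl) (simp add: fI)
  have 2: "(\<Sum>i\<in>R. \<Sum>j\<in>R. J i j * (1 - flip I \<sigma> i * flip I \<sigma> j)) = (\<Sum>i\<in>R. \<Sum>j\<in>R. J i j * (1 - \<sigma> i * \<sigma> j))"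
    by (intro sum.cong refl) (simp add: fR)
  have 3: "(\<Sum>i\<in>I. \<Sum>j\<in>R. J i j * (1 - flip I \<sigma> i * flip I \<sigma> j)) = (\<Sum>i\<in>I. \<Sum>j\<in>R. J i j * (1 + \<sigma> i * \<sigma> j))"
    by (intro sum.cong refl) (simp add: fI fR)
  have 4: "(\<Sum>i\<in>I. h i * flip I \<sigma> i) = - (\<Sum>i\<in>I. h i * \<sigma> i)" "(\<Sum>i\<in>R. h i * flip I \<sigma> i) = (\<Sum>i\<in>R. h i * \<sigma> i)"
    by (auto simp: fI fR simp flip: sum_negf)
  have 5: "(\<Sum>i\<in>I. boundary_J \<Lambda> i * (1 - flip I \<sigma> i)) = (\<Sum>i\<in>I. boundary_J \<Lambda> i * (1 + \<sigma> i))"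
    "(\<Sum>i\<in>R. boundary_J \<Lambda> i * (1 - flip I \<sigma> i)) = (\<Sum>i\<in>R. boundary_J \<Lambda> i * (1 - \<sigma> i))"
    by (auto simp: fI fR)
  have 6: "(\<Sum>i\<in>I. \<Sum>j\<in>R. J i j * (1 - \<sigma> i * \<sigma> j)) - (\<Sum>i\<in>I. \<Sum>j\<in>R. J i j * (1 + \<sigma> i * \<sigma> j))
     = - 2 * (\<Sum>i\<in>I. \<sigma> i * (\<Sum>j\<in>R. J i j * \<sigma> j))"
    unfolding sum_subtractf[symmetric] sum_distrib_left
    by (intro sum.cong refl) (simp add: algebra_simps)
  have 7: "(\<Sum>i\<in>I. boundary_J \<Lambda> i * (1 - \<sigma> i)) - (\<Sum>i\<in>I. boundary_J \<Lambda> i * (1 + \<sigma> i))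
     = - 2 * (\<Sum>i\<in>I. \<sigma> i * boundary_J \<Lambda> i)"
    unfolding sum_subtractf[symmetric] sum_distrib_left
    by (intro sum.cong refl) (simp add: algebra_simps)
  have "H \<Lambda> \<sigma> - H \<Lambda> (flip I \<sigma>) = - 2 * (\<Sum>i\<in>I. \<sigma> i * (\<Sum>j\<in>R. J i j * \<sigma> j))
     - 2 * (\<Sum>i\<in>I. \<sigma> i * boundary_J \<Lambda> i) - 2 * \<theta> * (\<Sum>i\<in>I. h i * \<sigma> i)"
  proof -
    have *: "(a + b + c - \<theta> * (x + y) + (d + e)) - (a + b + c' - \<theta> * (- x + y) + (d' + e))
        = (c - c') + (d - d') - 2 * \<theta> * x" for a b c d e c' d' x y :: real
      by (simp add: algebra_simps)
    show ?thesis unfolding sp 1 2 3 4 5 * 6 7 by simp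
  qed
  then show ?thesis unfolding R_def[symmetric] by (simp add: distrib_left sum.distrib)
qed

section \<open>Peierls bound and rules for finite-volume probabilities\<close>

lemma partition_pos: "finite \<Lambda> \<Longrightarrow> 0 < (\<Sum>\<sigma>\<in>configs \<Lambda> (\<lambda>_. 1). exp (- \<beta> * H \<Lambda> \<sigma>))"
  by (intro sum_pos) (auto simp: finite_configs_plus configs_plus)

text \<open>The Peierls argument: the flip is injective and maps configurations of the volume to
  such configurations, so the weights of \<open>C\<close> are at most
  \<open>exp (- \<beta> * \<Delta>)\<close> times distinct terms of the partition function.\<close>

lemma P_le_exp_flip:
  assumes "finite \<Lambda>" "I \<subseteq> \<Lambda>"
    and "\<And>\<sigma>. \<sigma> \<in> configs \<Lambda> (\<lambda>_. 1) \<Longrightarrow> \<sigma> \<in> C \<Longrightarrow> \<Delta> \<le> H \<Lambda> \<sigma> - H \<Lambda> (flip I \<sigma>)"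
  shows "P \<Lambda> C \<le> exp (- \<beta> * \<Delta>)"
proof -
  let ?X = "configs \<Lambda> (\<lambda>_. 1)"
  let ?w = "\<lambda>\<sigma>. exp (- \<beta> * H \<Lambda> \<sigma>)"
  have inj: "inj_on (flip I) (?X \<inter> C)" by (metis flip_flip inj_onI)
  have "(\<Sum>\<sigma>\<in>?X \<inter> C. ?w \<sigma>) \<le> (\<Sum>\<sigma>\<in>?X \<inter> C. exp (- \<beta> * \<Delta>) * ?w (flip I \<sigma>))"
  proof (rule sum_mono)
    fix \<sigma> assume "\<sigma> \<in> ?X \<inter> C"
    then have "\<beta> * \<Delta> \<le> \<beta> * (H \<Lambda> \<sigma> - H \<Lambda> (flip I \<sigma>))"
      using assms(3) \<beta>_pos by (intro mult_left_mono) auto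
    then have "- \<beta> * H \<Lambda> \<sigma> \<le> - \<beta> * \<Delta> + - \<beta> * H \<Lambda> (flip I \<sigma>)"
      unfolding right_diff_distrib by linarith
    then show "?w \<sigma> \<le> exp (- \<beta> * \<Delta>) * ?w (flip I \<sigma>)"
      unfolding exp_add[symmetric] by (rule exp_mono)
  qed
  also have "\<dots> = exp (- \<beta> * \<Delta>) * (\<Sum>\<sigma>\<in>flip I ` (?X \<inter> C). ?w \<sigma>)"
    by (simp add: sum.reindex[OF inj] sum_distrib_left)
  also have "\<dots> \<le> exp (- \<beta> * \<Delta>) * (\<Sum>\<sigma>\<in>?X. ?w \<sigma>)"
    using assms finite_configs_plus flip_configs by (intro mult_left_mono sum_mono2) auto
  finally show ?thesis
    using partition_pos[OF assms(1)] by (simp add: gibbs_prob_def field_simps)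
qed

lemma P_nonneg: "0 \<le> P \<Lambda> A"
  by (auto simp: gibbs_prob_def intro!: divide_nonneg_nonneg sum_nonneg)

lemma P_Un_disjoint:
  assumes "finite \<Lambda>" "A \<inter> B = {}"
  shows "P \<Lambda> (A \<union> B) = P \<Lambda> A + P \<Lambda> B"
proof -
  have "configs \<Lambda> (\<lambda>_. 1) \<inter> (A \<union> B) = (configs \<Lambda> (\<lambda>_. 1) \<inter> A) \<union> (configs \<Lambda> (\<lambda>_. 1) \<inter> B)" by auto
  moreover have "(\<Sum>\<sigma>\<in>(configs \<Lambda> (\<lambda>_. 1) \<inter> A) \<union> (configs \<Lambda> (\<lambda>_. 1) \<inter> B). f \<sigma>)
     = (\<Sum>\<sigma>\<in>configs \<Lambda> (\<lambda>_. 1) \<inter> A. f \<sigma>) + (\<Sum>\<sigma>\<in>configs \<Lambda> (\<lambda>_. 1) \<inter> B. f \<sigma>)" for f :: "(int \<Rightarrow> real) \<Rightarrow> real"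
    using assms finite_configs_plus[OF assms(1)] by (intro sum.union_disjoint) auto
  ultimately show ?thesis by (simp only: gibbs_prob_def add_divide_distrib)
qed

lemma P_mono:
  assumes "finite \<Lambda>" "configs \<Lambda> (\<lambda>_. 1) \<inter> A \<subseteq> B"
  shows "P \<Lambda> A \<le> P \<Lambda> B"
  unfolding gibbs_prob_def using assms partition_pos[OF assms(1)] finite_configs_plus[OF assms(1)]
  by (intro divide_right_mono sum_mono2) auto

lemma P_cong: "configs \<Lambda> (\<lambda>_. 1) \<inter> A = configs \<Lambda> (\<lambda>_. 1) \<inter> B \<Longrightarrow> P \<Lambda> A = P \<Lambda> B"
  by (simp only: gibbs_prob_def)

lemma P_UNIV: "finite \<Lambda> \<Longrightarrow> P \<Lambda> UNIV = 1"
  unfolding gibbs_prob_def using partition_pos[of \<Lambda>] by simp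

lemma P_subadditive:
  assumes "finite \<Lambda>" "finite T"
  shows "P \<Lambda> (\<Union>t\<in>T. A t) \<le> (\<Sum>t\<in>T. P \<Lambda> (A t))"
  using assms(2)
proof (induction T rule: finite_induct)
  case empty
  then show ?case by (simp add: gibbs_prob_def)
next
  case (insert t T)
  have "P \<Lambda> (\<Union>t\<in>insert t T. A t) = P \<Lambda> (A t \<union> ((\<Union>t\<in>T. A t) - A t))"
    by (intro arg_cong[where f = "P \<Lambda>"]) auto
  also have "\<dots> = P \<Lambda> (A t) + P \<Lambda> ((\<Union>t\<in>T. A t) - A t)"
    by (rule P_Un_disjoint) (use assms in auto)
  also have "P \<Lambda> ((\<Union>t\<in>T. A t) - A t) \<le> P \<Lambda> (\<Union>t\<in>T. A t)"
    by (rule P_mono) (use assms in auto)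
  finally show ?case using insert by simp
qed

text \<open>Added sites with plus spins act exactly as the boundary did before, so the energies
  differ by a constant that does not depend on \<open>S\<close>. Hence the measure of the smaller
  volume is the larger one conditioned on plus spins in the difference.\<close>

lemma H_enlarge:
  assumes "finite \<Lambda>'" "\<Lambda> \<subseteq> \<Lambda>'" "S \<subseteq> \<Lambda>"
  shows "H \<Lambda>' (minus_on S) = H \<Lambda> (minus_on S) - \<theta> * (\<Sum>i\<in>\<Lambda>' - \<Lambda>. h i)"
proof -
  define R where "R = \<Lambda>' - \<Lambda>"
  have fin: "finite \<Lambda>" "finite R" and dis: "\<Lambda> \<inter> R = {}" and un: "\<Lambda>' = \<Lambda> \<union> R"
    using assms by (auto simp: R_def intro: finite_subset)
  let ?\<sigma> = "minus_on S"
  have R1: "?\<sigma> i = 1" if "i \<in> R" for i using that dis assms by (auto simp: minus_on_def)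
  have 1: "(1/2) * (\<Sum>i\<in>\<Lambda>'. \<Sum>j\<in>\<Lambda>'. J i j * (1 - ?\<sigma> i * ?\<sigma> j))
     = (1/2) * (\<Sum>i\<in>\<Lambda>. \<Sum>j\<in>\<Lambda>. J i j * (1 - ?\<sigma> i * ?\<sigma> j)) + (1/2) * (\<Sum>i\<in>R. \<Sum>j\<in>R. J i j * (1 - ?\<sigma> i * ?\<sigma> j))
       + (\<Sum>i\<in>\<Lambda>. \<Sum>j\<in>R. J i j * (1 - ?\<sigma> i * ?\<sigma> j))"
    unfolding un by (rule H_pair_split) (fact fin dis pair_commute)+
  have 2: "(\<Sum>i\<in>\<Lambda>'. f i) = (\<Sum>i\<in>\<Lambda>. f i) + (\<Sum>i\<in>R. f i)" for f :: "int \<Rightarrow> real"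
    unfolding un using fin dis by (simp add: sum.union_disjoint)
  have 3: "(\<Sum>i\<in>\<Lambda>. boundary_J \<Lambda> i * (1 - ?\<sigma> i)) = (\<Sum>i\<in>\<Lambda>. \<Sum>j\<in>R. J i j * (1 - ?\<sigma> i * ?\<sigma> j))
      + (\<Sum>i\<in>\<Lambda>. boundary_J \<Lambda>' i * (1 - ?\<sigma> i))"
    unfolding sum.distrib[symmetric]
  proof (intro sum.cong refl)
    fix i assume "i \<in> \<Lambda>"
    have "boundary_J \<Lambda> i = (\<Sum>j\<in>R. J i j) + boundary_J \<Lambda>' i"
      using boundary_J_split[of R \<Lambda> i] fin dis un by (auto simp: Int_commute)
    moreover have "(\<Sum>j\<in>R. J i j * (1 - ?\<sigma> i * ?\<sigma> j)) = (\<Sum>j\<in>R. J i j) * (1 - ?\<sigma> i)"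
      by (simp add: R1 sum_distrib_right)
    ultimately show "boundary_J \<Lambda> i * (1 - ?\<sigma> i) = (\<Sum>j\<in>R. J i j * (1 - ?\<sigma> i * ?\<sigma> j)) + boundary_J \<Lambda>' i * (1 - ?\<sigma> i)"
      by (simp add: algebra_simps)
  qed
  have 4: "(\<Sum>i\<in>R. \<Sum>j\<in>R. J i j * (1 - ?\<sigma> i * ?\<sigma> j)) = 0" "(\<Sum>i\<in>R. boundary_J \<Lambda>' i * (1 - ?\<sigma> i)) = 0"
    "(\<Sum>i\<in>R. h i * ?\<sigma> i) = (\<Sum>i\<in>R. h i)"
    by (auto simp: R1)
  show ?thesis unfolding H_eq R_def[symmetric] 1 unfolding 2 3 4 by (simp add: algebra_simps)
qed

text \<open>This is the lattice condition behind FKG. The field and boundary terms are linear in the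
  spins and give equality; each pair term gives the inequality, because the couplings are
  ferromagnetic.\<close>

lemma H_submodular:
  "H \<Lambda> (minus_on (A \<union> B)) + H \<Lambda> (minus_on (A \<inter> B)) \<le> H \<Lambda> (minus_on A) + H \<Lambda> (minus_on B)"
proof -
  let ?a = "minus_on A" let ?b = "minus_on B" let ?u = "minus_on (A \<union> B)" let ?n = "minus_on (A \<inter> B)"
  have lin: "?u i + ?n i = ?a i + ?b i" for i by (auto simp: minus_on_def)
  have quad: "(1 - ?u i * ?u j) + (1 - ?n i * ?n j) \<le> (1 - ?a i * ?a j) + (1 - ?b i * ?b j)" for i j
    by (auto simp: minus_on_def)
  have 1: "(\<Sum>i\<in>\<Lambda>. \<Sum>j\<in>\<Lambda>. J i j * (1 - ?u i * ?u j)) + (\<Sum>i\<in>\<Lambda>. \<Sum>j\<in>\<Lambda>. J i j * (1 - ?n i * ?n j))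
    \<le> (\<Sum>i\<in>\<Lambda>. \<Sum>j\<in>\<Lambda>. J i j * (1 - ?a i * ?a j)) + (\<Sum>i\<in>\<Lambda>. \<Sum>j\<in>\<Lambda>. J i j * (1 - ?b i * ?b j))"
    unfolding sum.distrib[symmetric] distrib_left[symmetric]
    by (intro sum_mono mult_left_mono quad J_nonneg)
  have 2: "(\<Sum>i\<in>\<Lambda>. h i * ?u i) + (\<Sum>i\<in>\<Lambda>. h i * ?n i) = (\<Sum>i\<in>\<Lambda>. h i * ?a i) + (\<Sum>i\<in>\<Lambda>. h i * ?b i)"
    unfolding sum.distrib[symmetric] distrib_left[symmetric] lin ..
  have 3: "(\<Sum>i\<in>\<Lambda>. boundary_J \<Lambda> i * (1 - ?u i)) + (\<Sum>i\<in>\<Lambda>. boundary_J \<Lambda> i * (1 - ?n i))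
      = (\<Sum>i\<in>\<Lambda>. boundary_J \<Lambda> i * (1 - ?a i)) + (\<Sum>i\<in>\<Lambda>. boundary_J \<Lambda> i * (1 - ?b i))"
    unfolding sum.distrib[symmetric] distrib_left[symmetric]
    by (intro sum.cong refl arg_cong2[where f = "(*)"]) (use lin in \<open>smt (verit)\<close>)
  have "\<theta> * (\<Sum>i\<in>\<Lambda>. h i * ?u i) + \<theta> * (\<Sum>i\<in>\<Lambda>. h i * ?n i) = \<theta> * (\<Sum>i\<in>\<Lambda>. h i * ?a i) + \<theta> * (\<Sum>i\<in>\<Lambda>. h i * ?b i)"
    using 2 by (simp flip: distrib_left)
  then show ?thesis unfolding H_eq using 1 3 by linarith
qed

text \<open>Passing from a volume to a smaller one is conditioning on plus spins in the difference, an
  increasing event, so the FKG inequality makes plus probabilities decrease with the volume.\<close>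

lemma P_all_plus_antimono:
  assumes fin: "finite \<Lambda>'" and sub: "\<Lambda> \<subseteq> \<Lambda>'"
  shows "P \<Lambda>' {\<sigma>. \<forall>i\<in>B. \<sigma> i = 1} \<le> P \<Lambda> {\<sigma>. \<forall>i\<in>B. \<sigma> i = 1}"
proof -
  let ?D = "\<Lambda>' - \<Lambda>"
  define w where "w S = exp (- \<beta> * H \<Lambda>' (minus_on S))" for S
  \<comment> \<open>The constant by which the weights of the two volumes differ; it cancels between
    numerator and partition function.\<close>
  define c where "c = exp (\<beta> * \<theta> * (\<Sum>i\<in>\<Lambda>' - \<Lambda>. h i))"
  have finL: "finite \<Lambda>" using fin sub by (rule finite_subset[rotated])
  have wpos: "0 < w S" for S by (simp add: w_def)
  have ev: "{S. S \<subseteq> L \<and> minus_on S \<in> {\<sigma>. \<forall>i\<in>B. \<sigma> i = 1}} = {S. S \<subseteq> L \<and> S \<inter> B = {}}" for L B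
    by (auto simp: minus_on_def split: if_splits)
  have w\<Lambda>: "exp (- \<beta> * H \<Lambda> (minus_on S)) = w S / c" if "S \<subseteq> \<Lambda>" for S
  proof -
    have "- \<beta> * H \<Lambda>' (minus_on S) = - \<beta> * H \<Lambda> (minus_on S) + \<beta> * \<theta> * (\<Sum>i\<in>\<Lambda>' - \<Lambda>. h i)"
      unfolding H_enlarge[OF fin sub that] by (simp add: algebra_simps)
    then show ?thesis unfolding w_def c_def by (simp only: exp_add) simp
  qed
  have P\<Lambda>: "P \<Lambda> {\<sigma>. \<forall>i\<in>B. \<sigma> i = 1} = (\<Sum>S\<in>{S. S \<subseteq> \<Lambda> \<and> S \<inter> B = {}}. w S) / (\<Sum>S\<in>Pow \<Lambda>. w S)"
  proof -
    have "P \<Lambda> {\<sigma>. \<forall>i\<in>B. \<sigma> i = 1}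
      = (\<Sum>S\<in>{S. S \<subseteq> \<Lambda> \<and> S \<inter> B = {}}. exp (- \<beta> * H \<Lambda> (minus_on S))) / (\<Sum>S\<in>Pow \<Lambda>. exp (- \<beta> * H \<Lambda> (minus_on S)))"
      unfolding gibbs_prob_def sum_configs_plus sum_configs_plus_all ev ..
    also have "\<dots> = ((\<Sum>S\<in>{S. S \<subseteq> \<Lambda> \<and> S \<inter> B = {}}. w S) / c) / ((\<Sum>S\<in>Pow \<Lambda>. w S) / c)"
      unfolding sum_divide_distrib using w\<Lambda>
      by (intro arg_cong2[where f = "(/)"] sum.cong refl) auto
    also have "\<dots> = (\<Sum>S\<in>{S. S \<subseteq> \<Lambda> \<and> S \<inter> B = {}}. w S) / (\<Sum>S\<in>Pow \<Lambda>. w S)"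
      by (simp add: c_def)
    finally show ?thesis .
  qed
  have P\<Lambda>': "P \<Lambda>' {\<sigma>. \<forall>i\<in>B. \<sigma> i = 1} = (\<Sum>S\<in>{S. S \<subseteq> \<Lambda>' \<and> S \<inter> B = {}}. w S) / (\<Sum>S\<in>Pow \<Lambda>'. w S)"
    unfolding gibbs_prob_def sum_configs_plus sum_configs_plus_all ev w_def ..
  have ind: "(\<Sum>S\<in>Pow \<Lambda>'. w S * of_bool (S \<inter> X = {})) = (\<Sum>S\<in>{S. S \<subseteq> \<Lambda>' \<and> S \<inter> X = {}}. w S)" for X
    using fin by (intro sum.mono_neutral_cong_right) auto
  \<comment> \<open>If X avoids B and Y avoids the added sites, then the intersection avoids both.
    So the two restrictions are collected on the function of the intersection, and the one of the
    union carries none.\<close>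
  have "(\<Sum>S\<in>Pow \<Lambda>'. w S * of_bool (S \<inter> B = {})) * (\<Sum>S\<in>Pow \<Lambda>'. w S * of_bool (S \<inter> ?D = {}))
     \<le> (\<Sum>S\<in>Pow \<Lambda>'. w S) * (\<Sum>S\<in>Pow \<Lambda>'. w S * of_bool (S \<inter> (B \<union> ?D) = {}))"
  proof (rule four_functions[OF fin])
    fix X Y
    have "w X * w Y \<le> w (X \<union> Y) * w (X \<inter> Y)"
      using mult_left_mono[OF H_submodular[of \<Lambda>' X Y], of \<beta>] \<beta>_pos
      by (simp add: w_def algebra_simps flip: exp_add)
    moreover have "0 \<le> w (X \<union> Y) * w (X \<inter> Y)" using wpos by (simp add: less_imp_le)
    ultimately show "w X * of_bool (X \<inter> B = {}) * (w Y * of_bool (Y \<inter> ?D = {}))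
      \<le> w (X \<union> Y) * (w (X \<inter> Y) * of_bool (X \<inter> Y \<inter> (B \<union> ?D) = {}))"
      by (auto simp: of_bool_def)
  qed (use wpos in \<open>auto simp: less_imp_le\<close>)
  moreover have "{S. S \<subseteq> \<Lambda>' \<and> S \<inter> ?D = {}} = Pow \<Lambda>" "{S. S \<subseteq> \<Lambda>' \<and> S \<inter> (B \<union> ?D) = {}} = {S. S \<subseteq> \<Lambda> \<and> S \<inter> B = {}}"
    using sub by auto
  ultimately have fkg: "(\<Sum>S\<in>{S. S \<subseteq> \<Lambda>' \<and> S \<inter> B = {}}. w S) * (\<Sum>S\<in>Pow \<Lambda>. w S)
      \<le> (\<Sum>S\<in>Pow \<Lambda>'. w S) * (\<Sum>S\<in>{S. S \<subseteq> \<Lambda> \<and> S \<inter> B = {}}. w S)"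
    unfolding ind by simp
  have "0 < (\<Sum>S\<in>Pow \<Lambda>. w S)" "0 < (\<Sum>S\<in>Pow \<Lambda>'. w S)"
    using wpos fin finL by (auto intro!: sum_pos)
  then show ?thesis unfolding P\<Lambda> P\<Lambda>' using fkg by (simp add: field_simps)
qed

text \<open>Without minus sites the probability decreases with the volume and is bounded below by 0.
  A minus site \<open>t\<close> is traded for the difference of two cylinders, one with
  \<open>t\<close> free and one with \<open>t\<close> plus; \<open>S\<close> is arbitrary in the
  induction because \<open>t\<close> moves into it.\<close>

lemma convergent_P_cylinder:
  assumes "finite T" "finite S"
  shows "convergent (\<lambda>n. P {- int n..int n} {\<sigma>. (\<forall>i\<in>S. \<sigma> i = 1) \<and> (\<forall>i\<in>T. \<sigma> i = -1)})"
  using assms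
proof (induction T arbitrary: S rule: finite_induct)
  case empty
  have "decseq (\<lambda>n. P {- int n..int n} {\<sigma>. \<forall>i\<in>S. \<sigma> i = 1})"
    unfolding decseq_def by (auto intro!: P_all_plus_antimono)
  moreover have "\<forall>n. 0 \<le> P {- int n..int n} {\<sigma>. \<forall>i\<in>S. \<sigma> i = 1}" by (simp add: P_nonneg)
  ultimately have "convergent (\<lambda>n. P {- int n..int n} {\<sigma>. \<forall>i\<in>S. \<sigma> i = 1})"
    using decseq_convergent[of "\<lambda>n. P {- int n..int n} {\<sigma>. \<forall>i\<in>S. \<sigma> i = 1}" 0]
    by (blast intro: convergentI)
  then show ?case by simp
next
  case (insert t T)
  let ?C = "\<lambda>S T. {\<sigma>::int \<Rightarrow> real. (\<forall>i\<in>S. \<sigma> i = 1) \<and> (\<forall>i\<in>T. \<sigma> i = -1)}"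
  have ev: "\<forall>\<^sub>F n in sequentially. P {- int n..int n} (?C S (insert t T))
     = P {- int n..int n} (?C S T) - P {- int n..int n} (?C (insert t S) T)"
    using eventually_ge_at_top[of "nat \<bar>t\<bar>"]
  proof eventually_elim
    case (elim n)
    let ?\<Lambda> = "{- int n..int n}"
    have t: "t \<in> ?\<Lambda>" using elim by auto
    have "P ?\<Lambda> (?C S T) = P ?\<Lambda> (?C S (insert t T) \<union> ?C (insert t S) T)"
    proof (rule P_cong)
      have "\<sigma> t = 1 \<or> \<sigma> t = -1" if "\<sigma> \<in> configs ?\<Lambda> (\<lambda>_. 1)" for \<sigma>
        using that t by (auto simp: configs_def)
      then show "configs ?\<Lambda> (\<lambda>_. 1) \<inter> ?C S T = configs ?\<Lambda> (\<lambda>_. 1) \<inter> (?C S (insert t T) \<union> ?C (insert t S) T)"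
        by blast
    qed
    also have "\<dots> = P ?\<Lambda> (?C S (insert t T)) + P ?\<Lambda> (?C (insert t S) T)"
    proof (rule P_Un_disjoint)
      show "?C S (insert t T) \<inter> ?C (insert t S) T = {}"
      proof (rule equals0I)
        fix \<sigma> assume "\<sigma> \<in> ?C S (insert t T) \<inter> ?C (insert t S) T"
        then have "\<sigma> t = -1" "\<sigma> t = 1" by blast+
        then show False by simp
      qed
    qed simp
    finally show ?case by simp
  qed
  moreover have "convergent (\<lambda>n. P {- int n..int n} (?C S T) - P {- int n..int n} (?C (insert t S) T))"
    using insert by (intro convergent_diff) blast+
  ultimately show ?case by (subst convergent_cong[OF ev])
qed

text \<open>In every volume containing \<open>W\<close> the event is a disjoint union of finitely
  many cylinders, one for each admissible set of minus spins in \<open>W\<close>.\<close>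

lemma convergent_P_local:
  assumes W: "finite W" and loc: "\<And>\<sigma> \<tau>. (\<And>i. i \<in> W \<Longrightarrow> \<sigma> i = \<tau> i) \<Longrightarrow> \<sigma> \<in> A \<Longrightarrow> \<tau> \<in> A"
  shows "convergent (\<lambda>n. P {- int n..int n} A)"
proof -
  let ?C = "\<lambda>T. {\<sigma>::int \<Rightarrow> real. (\<forall>i\<in>W - T. \<sigma> i = 1) \<and> (\<forall>i\<in>T. \<sigma> i = -1)}"
  let ?F = "{T \<in> Pow W. minus_on T \<in> A}"
  obtain N where N: "W \<subseteq> {- int N..int N}"
  proof -
    define s where "s = (\<Sum>j\<in>W. \<bar>j\<bar>)"
    have "\<bar>i\<bar> \<le> s" if "i \<in> W" for i
      unfolding s_def using that W by (intro member_le_sum) auto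
    then have "W \<subseteq> {- int (nat s)..int (nat s)}" by force
    then show thesis by (rule that)
  qed
  have ev: "\<forall>\<^sub>F n in sequentially. P {- int n..int n} A = (\<Sum>T\<in>?F. P {- int n..int n} (?C T))"
    using eventually_ge_at_top[of N]
  proof eventually_elim
    case (elim n)
    let ?\<Lambda> = "{- int n..int n}"
    have W\<Lambda>: "W \<subseteq> ?\<Lambda>" using N elim by force
    have "P ?\<Lambda> A = P ?\<Lambda> (\<Union>T\<in>?F. ?C T)"
    proof (intro order_antisym P_mono)
      show "configs ?\<Lambda> (\<lambda>_. 1) \<inter> A \<subseteq> (\<Union>T\<in>?F. ?C T)"
      proof
        fix \<sigma> assume s: "\<sigma> \<in> configs ?\<Lambda> (\<lambda>_. 1) \<inter> A"
        let ?T = "{i\<in>W. \<sigma> i = -1}"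
        have v: "\<sigma> i = 1 \<or> \<sigma> i = -1" if "i \<in> W" for i
          using s that W\<Lambda> by (auto simp: configs_def)
        have "\<sigma> i = minus_on ?T i" if "i \<in> W" for i
          using v[OF that] that by (auto simp: minus_on_def)
        moreover have "\<sigma> \<in> A" using s by blast
        ultimately have "minus_on ?T \<in> A" by (rule loc)
        moreover have "\<sigma> \<in> ?C ?T" using v by blast
        moreover have "?T \<in> Pow W" by blast
        ultimately show "\<sigma> \<in> (\<Union>T\<in>?F. ?C T)" by blast
      qed
      show "configs ?\<Lambda> (\<lambda>_. 1) \<inter> (\<Union>T\<in>?F. ?C T) \<subseteq> A"
      proof
        fix \<sigma> assume "\<sigma> \<in> configs ?\<Lambda> (\<lambda>_. 1) \<inter> (\<Union>T\<in>?F. ?C T)"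
        then obtain T where T: "T \<subseteq> W" "minus_on T \<in> A" "\<sigma> \<in> ?C T" by blast
        have "minus_on T i = \<sigma> i" if "i \<in> W" for i
        proof (cases "i \<in> T")
          case True
          then have "\<sigma> i = -1" using T(3) by blast
          then show ?thesis using True by (simp add: minus_on_def)
        next
          case False
          then have "\<sigma> i = 1" using T(3) that by blast
          then show ?thesis using False by (simp add: minus_on_def)
        qed
        then show "\<sigma> \<in> A" using T(2) by (rule loc)
      qed
    qed auto
    also have "\<dots> = (\<Sum>T\<in>?F. P ?\<Lambda> (?C T))"
    proof -
      have "G \<subseteq> ?F \<Longrightarrow> P ?\<Lambda> (\<Union>T\<in>G. ?C T) = (\<Sum>T\<in>G. P ?\<Lambda> (?C T))" if "finite G" for G
        using that
      proof (induction G rule: finite_induct)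
        case empty show ?case by (simp add: gibbs_prob_def)
      next
        case (insert T G)
        have "?C T \<inter> ?C T' = {}" if "T' \<in> G" for T'
        proof -
          have "T \<noteq> T'" "T \<subseteq> W" "T' \<subseteq> W" using insert that by auto
          then obtain i where i: "i \<in> W" "i \<in> T \<and> i \<notin> T' \<or> i \<notin> T \<and> i \<in> T'" by blast
          have False if "\<sigma> \<in> ?C T" "\<sigma> \<in> ?C T'" for \<sigma>
          proof -
            have "\<sigma> i = 1" "\<sigma> i = -1" using that i by blast+
            then show False by simp
          qed
          then show ?thesis by blast
        qed
        then have "?C T \<inter> (\<Union>T\<in>G. ?C T) = {}" by blast
        then have "P ?\<Lambda> (?C T \<union> (\<Union>T\<in>G. ?C T)) = P ?\<Lambda> (?C T) + P ?\<Lambda> (\<Union>T\<in>G. ?C T)"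
          by (intro P_Un_disjoint) auto
        then show ?case using insert by simp
      qed
      then show ?thesis using W by simp
    qed
    finally show ?case .
  qed
  moreover have "convergent (\<lambda>n. \<Sum>T\<in>?F. P {- int n..int n} (?C T))"
  proof (rule convergent_sum)
    fix T assume "T \<in> ?F"
    then have "finite T" "finite (W - T)" using W finite_subset by auto
    then show "convergent (\<lambda>n. P {- int n..int n} (?C T))" by (rule convergent_P_cylinder)
  qed
  ultimately show ?thesis by (subst convergent_cong[OF ev])
qed

end

section \<open>Energy of flipping an interval\<close>

lemma powr_diff_bounds:
  fixes x \<alpha> :: real
  assumes "0 < \<alpha>" "\<alpha> < 1" "0 < x"
  shows "(x + 1) powr (\<alpha> - 1) \<le> ((x + 1) powr \<alpha> - x powr \<alpha>) / \<alpha>"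
    and "((x + 1) powr \<alpha> - x powr \<alpha>) / \<alpha> \<le> x powr (\<alpha> - 1)"
proof -
  have "\<exists>z. x < z \<and> z < x + 1 \<and> (x + 1) powr \<alpha> - x powr \<alpha> = (x + 1 - x) * (\<alpha> * z powr (\<alpha> - 1))"
    using assms by (intro MVT2[of x "x + 1" "\<lambda>t. t powr \<alpha>" "\<lambda>t. \<alpha> * t powr (\<alpha> - 1)"])
      (auto intro!: derivative_eq_intros)
  then obtain z where z: "x < z" "z < x + 1" "((x + 1) powr \<alpha> - x powr \<alpha>) / \<alpha> = z powr (\<alpha> - 1)"
    using assms by auto
  show "(x + 1) powr (\<alpha> - 1) \<le> ((x + 1) powr \<alpha> - x powr \<alpha>) / \<alpha>"
    unfolding z(3) using z assms by (intro powr_mono2') auto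
  show "((x + 1) powr \<alpha> - x powr \<alpha>) / \<alpha> \<le> x powr (\<alpha> - 1)"
    unfolding z(3) using z assms by (intro powr_mono2') auto
qed

lemma powr_diff_upper:
  fixes x \<alpha> :: real
  assumes "\<alpha> < 1" "0 < x"
  shows "(x powr (\<alpha> - 1) - (x + 1) powr (\<alpha> - 1)) / (1 - \<alpha>) \<le> x powr (\<alpha> - 2)"
proof -
  have "\<exists>z. x < z \<and> z < x + 1 \<and>
      (x + 1) powr (\<alpha> - 1) - x powr (\<alpha> - 1) = (x + 1 - x) * ((\<alpha> - 1) * z powr (\<alpha> - 1 - 1))"
    using assms by (intro MVT2[of x "x + 1" "\<lambda>t. t powr (\<alpha> - 1)" "\<lambda>t. (\<alpha> - 1) * t powr (\<alpha> - 1 - 1)"])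
      (auto intro!: derivative_eq_intros)
  then obtain z where z: "x < z" "(x + 1) powr (\<alpha> - 1) - x powr (\<alpha> - 1) = (\<alpha> - 1) * z powr (\<alpha> - 2)"
    by auto
  have "(x powr (\<alpha> - 1) - (x + 1) powr (\<alpha> - 1)) / (1 - \<alpha>) = z powr (\<alpha> - 2)"
    using z(2) assms by (simp add: field_simps)
  also have "\<dots> \<le> x powr (\<alpha> - 2)" using z assms by (intro powr_mono2') auto
  finally show ?thesis .
qed

lemma sum_powr_ge:
  assumes "0 < \<alpha>" "\<alpha> < 1"
  shows "(real l powr \<alpha> - 1) / \<alpha> \<le> (\<Sum>k<l. real (k + 1) powr (\<alpha> - 1))"
proof -
  have "((real l + 1) powr \<alpha> - 1) / \<alpha> \<le> (\<Sum>k<l. real (k + 1) powr (\<alpha> - 1))"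
  proof (induction l)
    case (Suc l)
    then show ?case
      using powr_diff_bounds(2)[OF assms, of "real l + 1"] by (simp add: diff_divide_distrib add_ac)
  qed simp
  moreover have "(real l powr \<alpha> - 1) / \<alpha> \<le> ((real l + 1) powr \<alpha> - 1) / \<alpha>"
    using assms by (intro divide_right_mono diff_right_mono powr_mono2) auto
  ultimately show ?thesis by linarith
qed

lemma sum_powr_le:
  assumes "0 < \<alpha>" "\<alpha> < 1"
  shows "(\<Sum>k<l. real (m + k + 1) powr (\<alpha> - 1)) \<le> (real (m + l) powr \<alpha> - real m powr \<alpha>) / \<alpha>"
proof (induction l)
  case (Suc l)
  have "real (m + l + 1) powr (\<alpha> - 1) \<le> (real (m + l + 1) powr \<alpha> - real (m + l) powr \<alpha>) / \<alpha>"
  \<comment> \<open>The mean value bound needs a positive left end point; at 0 the claim reads 1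
    \<le> 1/\<alpha>.\<close>
  proof (cases "m + l = 0")
    case True
    then show ?thesis using assms by (simp add: field_simps)
  next
    case False
    then have "0 < real (m + l)" by (simp only: of_nat_0_less_iff)
    from powr_diff_bounds(1)[OF assms this] show ?thesis by (simp add: add_ac)
  qed
  then show ?case using Suc by (simp add: diff_divide_distrib add_ac)
qed simp

text \<open>Positivity means 2^\<alpha> < 3/2, and 2^\<alpha> \<le> sqrt 2 below 1/2.\<close>

lemma zeta_pos: "\<alpha> < 1/2 \<Longrightarrow> 0 < zeta \<alpha>"
proof -
  assume "\<alpha> < 1/2"
  then have "2 powr \<alpha> \<le> 2 powr (1/2)" by (intro powr_mono) auto
  also have "\<dots> = sqrt 2" by (simp add: powr_half_sqrt)
  also have "\<dots> < 3/2" by (rule real_less_lsqrt) (auto simp: power2_eq_square)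
  finally show ?thesis by (simp add: zeta_def)
qed

lemma sum_interval_int:
  fixes f :: "int \<Rightarrow> real"
  shows "(\<Sum>i\<in>{a..<a + int l}. f i) = (\<Sum>k<l. f (a + int k))"
  by (rule sum.reindex_bij_witness[of _ "\<lambda>k. a + int k" "\<lambda>i. nat (i - a)"]) auto

section \<open>Couplings of an interval to its neighbours and to the rest of the chain\<close>

context ising_chain
begin

text \<open>The integral of t^(\<alpha>-2) from m to infinity. For m > 0 it bounds the coupling of a
  site to all sites on one side at distance greater than m; at m = 0 it is 0 by the convention for
  \<open>powr\<close> and bounds nothing.\<close>

definition tail :: "nat \<Rightarrow> real" where
  "tail m = real m powr (\<alpha> - 1) / (1 - \<alpha>)"

text \<open>A lower bound for a quarter of the interaction energy gained by flipping an interval of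
  length l between two intervals of length l of opposite spin. With p = J1 - 1 + (first sum) and q =
  (second sum), each neighbour couples with at least p - q and all farther sites together with at
  most 2 q, so the difference is at least 2 (p - 2 q); flipping doubles it.\<close>

definition run_gain :: "nat \<Rightarrow> real" where
  "run_gain l = J1 - 1 + (\<Sum>k<l. tail (k + 1)) - 2 * (\<Sum>k<l. tail (l + k))"

lemma tail_nonneg: "0 \<le> tail m"
  using \<alpha>_less by (simp add: tail_def)

lemma tail_antimono: "0 < m \<Longrightarrow> m \<le> n \<Longrightarrow> tail n \<le> tail m"
  unfolding tail_def using \<alpha>_less by (intro divide_right_mono powr_mono2') auto

lemma sum_Jint_row_ge:
  assumes "0 < u"
  shows "tail u - tail (u + l) \<le> (\<Sum>r<l. Jint J1 \<alpha> (u + r))"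
proof (induction l)
  case (Suc l)
  have "real (u + l) powr (\<alpha> - 2) \<le> Jint J1 \<alpha> (u + l)"
    using J1_ge assms by (cases "u + l = 1") (auto simp: Jint_def simp flip: of_nat_add)
  moreover have "tail (u + l) - tail (u + Suc l) \<le> real (u + l) powr (\<alpha> - 2)"
    using powr_diff_upper[of \<alpha> "real (u + l)"] \<alpha>_less assms
    by (simp add: tail_def diff_divide_distrib add_ac)
  ultimately show ?case using Suc by simp
qed simp

text \<open>The site at distance u + 1 from the right-hand interval sees the distances u + 1, ..., u
  + l, which contribute at least \<open>tail (u + 1) - tail (u + 1 + l)\<close>. The row u = 0
  begins with \<open>J1\<close> where the power would give 1; this is the term J1 - 1.\<close>

lemma near_ge:
  assumes "0 < l"
  shows "J1 - 1 + (\<Sum>k<l. tail (k + 1)) - (\<Sum>k<l. tail (l + k))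
    \<le> (\<Sum>i\<in>{a..<a + int l}. \<Sum>j\<in>{a + int l..<a + int l + int l}. J i j)"
proof -
  obtain l' where l': "l = Suc l'" using assms by (cases l) auto
  have first: "J1 - 1 + (tail 1 - tail (1 + l)) \<le> (\<Sum>r<l. Jint J1 \<alpha> (1 + r))"
  proof -
    have "tail 2 - tail (2 + l') \<le> (\<Sum>r<l'. Jint J1 \<alpha> (2 + r))"
      by (rule sum_Jint_row_ge) simp
    moreover have "(\<Sum>r<l. Jint J1 \<alpha> (1 + r)) = J1 + (\<Sum>r<l'. Jint J1 \<alpha> (2 + r))"
      unfolding l' sum.lessThan_Suc_shift by (simp add: Jint_def)
    moreover have "tail 1 - tail 2 \<le> 1"
      using powr_diff_upper[of \<alpha> 1] \<alpha>_less by (simp add: tail_def diff_divide_distrib)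
    ultimately show ?thesis by (simp add: l')
  qed
  have "(\<Sum>k<l. tail (l + k + 1)) \<le> (\<Sum>k<l. tail (l + k))"
    using assms by (intro sum_mono tail_antimono) auto
  then have "J1 - 1 + (\<Sum>k<l. tail (k + 1)) - (\<Sum>k<l. tail (l + k))
     \<le> J1 - 1 + (\<Sum>u<l. tail (u + 1) - tail (u + 1 + l))"
    by (simp add: sum_subtractf add_ac)
  also have "\<dots> \<le> (\<Sum>u<l. \<Sum>r<l. Jint J1 \<alpha> (u + 1 + r))"
  proof -
    have "(\<Sum>u<l'. tail (Suc u + 1) - tail (Suc u + 1 + l)) \<le> (\<Sum>u<l'. \<Sum>r<l. Jint J1 \<alpha> (Suc u + 1 + r))"
      by (intro sum_mono sum_Jint_row_ge) simp
    then show ?thesis using first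
      by (subst (1 3) l', subst (1 2) sum.lessThan_Suc_shift) (simp add: l')
  qed
  \<comment> \<open>Rows were numbered from the right end of the interval; from here on they are
    numbered from its left end \<open>a\<close>.\<close>
  also have "\<dots> = (\<Sum>k<l. \<Sum>r<l. Jint J1 \<alpha> (l - Suc k + 1 + r))"
    by (rule sum.nat_diff_reindex[symmetric])
  also have "\<dots> = (\<Sum>k<l. \<Sum>r<l. J (a + int k) (a + int l + int r))"
    by (intro sum.cong refl arg_cong[where f = "Jint J1 \<alpha>"]) auto
  also have "\<dots> = (\<Sum>i\<in>{a..<a + int l}. \<Sum>j\<in>{a + int l..<a + int l + int l}. J i j)"
    by (simp only: sum_interval_int)
  finally show ?thesis .
qed

lemma near_ge_left:
  assumes "0 < l"
  shows "J1 - 1 + (\<Sum>k<l. tail (k + 1)) - (\<Sum>k<l. tail (l + k))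
    \<le> (\<Sum>i\<in>{a..<a + int l}. \<Sum>j\<in>{a - int l..<a}. J i j)"
proof -
  have "(\<Sum>i\<in>{a..<a + int l}. \<Sum>j\<in>{a - int l..<a}. J i j)
      = (\<Sum>j\<in>{a - int l..<a}. \<Sum>i\<in>{a..<a + int l}. J j i)"
    by (subst sum.swap) (simp only: J_commute)
  then show ?thesis using near_ge[OF assms, of "a - int l"] by simp
qed

lemma boundary_J_le:
  assumes "UNIV - \<Lambda> \<subseteq> {..l} \<union> {r..}" "l < r"
    and "\<And>F. finite F \<Longrightarrow> F \<subseteq> {..l} \<Longrightarrow> (\<Sum>j\<in>F. J i j) \<le> x"
    and "\<And>F. finite F \<Longrightarrow> F \<subseteq> {r..} \<Longrightarrow> (\<Sum>j\<in>F. J i j) \<le> y"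
  shows "boundary_J \<Lambda> i \<le> x + y"
  unfolding boundary_J_def
proof (rule infsum_le_finite_sums[OF J_summable])
  fix F :: "int set" assume F: "finite F" "F \<subseteq> UNIV - \<Lambda>"
  have "(\<Sum>j\<in>F. J i j) = (\<Sum>j\<in>F \<inter> {..l} \<union> F \<inter> {r..}. J i j)"
    using F assms(1) by (intro sum.cong) auto
  also have "\<dots> = (\<Sum>j\<in>F \<inter> {..l}. J i j) + (\<Sum>j\<in>F \<inter> {r..}. J i j)"
    using F assms(2) by (intro sum.union_disjoint) auto
  also have "\<dots> \<le> x + y" using F assms by (intro add_mono) auto
  finally show "(\<Sum>j\<in>F. J i j) \<le> x + y" .
qed

lemma sum_J_right_le_tail:
  assumes "0 < m" "finite F" "F \<subseteq> {i + int m + 1..}"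
  shows "(\<Sum>j\<in>F. J i j) \<le> tail m"
  unfolding tail_def using sum_Jint_right_tail[of \<alpha> m F i J1] assms \<alpha>_less by simp

lemma sum_J_left_le_tail:
  assumes "0 < m" "finite F" "F \<subseteq> {..i - int m - 1}"
  shows "(\<Sum>j\<in>F. J i j) \<le> tail m"
  unfolding tail_def using sum_Jint_left_tail[of \<alpha> m F i J1] assms \<alpha>_less by simp

text \<open>Sites left of the window are farther than l + k from a + k, sites right of it farther
  than l + (l - 1 - k); reflection of the index makes the two resulting sums equal.\<close>

lemma far_le:
  assumes "0 < l"
  shows "(\<Sum>i\<in>{a..<a + int l}. boundary_J {a - int l..<a + int l + int l} i) \<le> 2 * (\<Sum>k<l. tail (l + k))"
proof -
  have "boundary_J {a - int l..<a + int l + int l} (a + int k) \<le> tail (l + k) + tail (l + (l - Suc k))"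
    if "k < l" for k
  proof (rule boundary_J_le[of _ "a - int l - 1" "a + int l + int l"])
    fix F :: "int set" assume F: "finite F"
    show "(\<Sum>j\<in>F. J (a + int k) j) \<le> tail (l + k)" if "F \<subseteq> {..a - int l - 1}"
      by (rule sum_J_left_le_tail) (use F that assms in auto)
    show "(\<Sum>j\<in>F. J (a + int k) j) \<le> tail (l + (l - Suc k))" if "F \<subseteq> {a + int l + int l..}"
      by (rule sum_J_right_le_tail) (use F that assms \<open>k < l\<close> in \<open>auto simp: of_nat_diff\<close>)
  qed (use assms in auto)
  then have "(\<Sum>k<l. boundary_J {a - int l..<a + int l + int l} (a + int k))
     \<le> (\<Sum>k<l. tail (l + k) + tail (l + (l - Suc k)))" by (intro sum_mono) auto
  also have "\<dots> = (\<Sum>k<l. tail (l + k)) + (\<Sum>k<l. tail (l + (l - Suc k)))" by (rule sum.distrib)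
  also have "(\<Sum>k<l. tail (l + (l - Suc k))) = (\<Sum>k<l. tail (l + k))"
    by (rule sum.nat_diff_reindex)
  finally show ?thesis by (simp add: sum_interval_int)
qed

lemma surface_le:
  assumes "0 < l"
  shows "(\<Sum>i\<in>{a..<a + int l}. boundary_J {a..<a + int l} i) \<le> 2 * (J1 + tail 1 + (\<Sum>k<l. tail (k + 1)))"
proof -
  \<comment> \<open>The one-sided coupling beyond distance v. As \<open>tail 0\<close> is 0, the
    case v = 0 splits off the nearest neighbour.\<close>
  define q where "q v = (if v = 0 then J1 + tail 1 else tail v)" for v :: nat
  have q_right: "(\<Sum>j\<in>F. J i j) \<le> q v" if "finite F" "F \<subseteq> {i + int v + 1..}" for F i v
  proof (cases "v = 0")
    case True
    have "(\<Sum>j\<in>F. J i j) \<le> (\<Sum>j\<in>insert (i + 1) (F \<inter> {i + int 1 + 1..}). J i j)"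
      using that True by (intro sum_mono2) (auto simp: J_nonneg)
    also have "\<dots> = J i (i + 1) + (\<Sum>j\<in>F \<inter> {i + int 1 + 1..}. J i j)"
      using that by (subst sum.insert) auto
    also have "\<dots> \<le> J1 + tail 1"
      using that by (intro add_mono J_le sum_J_right_le_tail) auto
    finally show ?thesis using True by (simp add: q_def)
  next
    case False
    then show ?thesis using that sum_J_right_le_tail by (simp add: q_def)
  qed
  have q_left: "(\<Sum>j\<in>F. J i j) \<le> q v" if "finite F" "F \<subseteq> {..i - int v - 1}" for F i v
  proof -
    have "(\<Sum>j\<in>F. J i j) = (\<Sum>j\<in>uminus ` F. J (- i) j)"
      by (subst sum.reindex) (auto simp: abs_minus_commute add.commute intro!: sum.cong arg_cong[where f = nat]
        arg_cong[where f = "Jint J1 \<alpha>"])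
    also have "\<dots> \<le> q v" by (rule q_right) (use that in auto)
    finally show ?thesis .
  qed
  have "boundary_J {a..<a + int l} (a + int k) \<le> q k + q (l - Suc k)" if "k < l" for k
  proof (rule boundary_J_le[of _ "a - 1" "a + int l"])
    fix F :: "int set" assume F: "finite F"
    show "(\<Sum>j\<in>F. J (a + int k) j) \<le> q k" if "F \<subseteq> {..a - 1}"
      by (rule q_left) (use F that in auto)
    show "(\<Sum>j\<in>F. J (a + int k) j) \<le> q (l - Suc k)" if "F \<subseteq> {a + int l..}"
      by (rule q_right) (use F that \<open>k < l\<close> in \<open>auto simp: of_nat_diff\<close>)
  qed (use assms in auto)
  then have "(\<Sum>k<l. boundary_J {a..<a + int l} (a + int k)) \<le> (\<Sum>k<l. q k + q (l - Suc k))"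
    by (intro sum_mono) auto
  also have "\<dots> = (\<Sum>k<l. q k) + (\<Sum>k<l. q (l - Suc k))" by (rule sum.distrib)
  also have "(\<Sum>k<l. q (l - Suc k)) = (\<Sum>k<l. q k)" by (rule sum.nat_diff_reindex)
  also have "(\<Sum>k<l. q k) \<le> J1 + tail 1 + (\<Sum>k<l. tail (k + 1))"
  proof -
    obtain l' where l': "l = Suc l'" using assms by (cases l) auto
    have "(\<Sum>k<l. q k) = J1 + tail 1 + (\<Sum>k<l'. tail (k + 1))"
      unfolding l' sum.lessThan_Suc_shift by (simp add: q_def)
    also have "(\<Sum>k<l'. tail (k + 1)) \<le> (\<Sum>k<l. tail (k + 1))"
      unfolding l' using tail_nonneg by simp
    finally show ?thesis by simp
  qed
  finally show ?thesis by (simp add: sum_interval_int)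
qed

text \<open>The sites outside \<open>I\<close> and \<open>N\<close> are unknown; the worst case is
  that all of them agree with \<open>s\<close>. Together with the exterior they then cost
  \<open>boundary_J (I \<union> N)\<close>, a bound that no longer depends on the volume.\<close>

lemma H_flip_ge:
  assumes \<Lambda>: "finite \<Lambda>" "I \<subseteq> \<Lambda>" "N \<subseteq> \<Lambda>" "I \<inter> N = {}"
    and \<sigma>: "\<sigma> \<in> configs \<Lambda> (\<lambda>_. 1)"
    and s: "\<And>i. i \<in> I \<Longrightarrow> \<sigma> i = s" "\<And>j. j \<in> N \<Longrightarrow> \<sigma> j = - s"
  shows "2 * (\<Sum>i\<in>I. (\<Sum>j\<in>N. J i j) - boundary_J (I \<union> N) i) - 2 * \<theta> * (s * (\<Sum>i\<in>I. h i))
     \<le> H \<Lambda> \<sigma> - H \<Lambda> (flip I \<sigma>)"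
proof -
  have fin: "finite I" "finite N" using \<Lambda> by (auto intro: finite_subset)
  have "\<sigma> i * ((\<Sum>j\<in>\<Lambda> - I. J i j * \<sigma> j) + boundary_J \<Lambda> i) \<le> boundary_J (I \<union> N) i - (\<Sum>j\<in>N. J i j)"
    if i: "i \<in> I" for i
  proof -
    have pm: "\<sigma> k = 1 \<or> \<sigma> k = -1" if "k \<in> \<Lambda>" for k using that \<sigma> by (auto simp: configs_def)
    have si: "\<sigma> i = s" "s = 1 \<or> s = -1" using s(1)[OF i] pm[of i] i \<Lambda> by auto
    define R where "R = \<Lambda> - (I \<union> N)"
    have R: "finite R" "R \<inter> (I \<union> N) = {}" "I \<union> N \<union> R = \<Lambda>" using \<Lambda> by (auto simp: R_def)
    have "\<Lambda> - I = N \<union> R" "N \<inter> R = {}" using \<Lambda> by (auto simp: R_def)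
    then have "(\<Sum>j\<in>\<Lambda> - I. J i j * \<sigma> j) = (\<Sum>j\<in>N. J i j * \<sigma> j) + (\<Sum>j\<in>R. J i j * \<sigma> j)"
      using fin R(1) by (simp add: sum.union_disjoint)
    moreover have "(\<Sum>j\<in>N. J i j * \<sigma> j) = - (s * (\<Sum>j\<in>N. J i j))"
      by (simp add: s(2) sum_distrib_left mult.commute flip: sum_negf)
    ultimately have "\<sigma> i * ((\<Sum>j\<in>\<Lambda> - I. J i j * \<sigma> j) + boundary_J \<Lambda> i)
       = - (s * s) * (\<Sum>j\<in>N. J i j) + (\<Sum>j\<in>R. J i j * (s * \<sigma> j)) + s * boundary_J \<Lambda> i"
    proof -
      assume *: "(\<Sum>j\<in>\<Lambda> - I. J i j * \<sigma> j) = (\<Sum>j\<in>N. J i j * \<sigma> j) + (\<Sum>j\<in>R. J i j * \<sigma> j)"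
        "(\<Sum>j\<in>N. J i j * \<sigma> j) = - (s * (\<Sum>j\<in>N. J i j))"
      have "(\<Sum>j\<in>R. J i j * (s * \<sigma> j)) = s * (\<Sum>j\<in>R. J i j * \<sigma> j)"
        by (simp add: sum_distrib_left mult.left_commute)
      then show ?thesis unfolding si(1) * by (simp only: distrib_left) simp
    qed
    also have "s * s = 1" using si by auto
    also have "(\<Sum>j\<in>R. J i j * (s * \<sigma> j)) \<le> (\<Sum>j\<in>R. J i j * 1)"
    proof (intro sum_mono mult_left_mono J_nonneg)
      fix j assume "j \<in> R"
      then show "s * \<sigma> j \<le> 1" using pm[of j] si by (auto simp: R_def)
    qed
    also have "s * boundary_J \<Lambda> i \<le> 1 * boundary_J \<Lambda> i"
      using si by (intro mult_right_mono) (auto simp: boundary_J_def J_nonneg intro!: infsum_nonneg)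
    also have "- 1 * (\<Sum>j\<in>N. J i j) + (\<Sum>j\<in>R. J i j * 1) + 1 * boundary_J \<Lambda> i = boundary_J (I \<union> N) i - (\<Sum>j\<in>N. J i j)"
      using boundary_J_split[OF R(1,2), of i] R(3) by simp
    finally show ?thesis by simp
  qed
  then have "(\<Sum>i\<in>I. \<sigma> i * ((\<Sum>j\<in>\<Lambda> - I. J i j * \<sigma> j) + boundary_J \<Lambda> i))
     \<le> (\<Sum>i\<in>I. boundary_J (I \<union> N) i - (\<Sum>j\<in>N. J i j))" by (rule sum_mono)
  moreover have "(\<Sum>i\<in>I. h i * \<sigma> i) = s * (\<Sum>i\<in>I. h i)"
    by (simp add: s(1) sum_distrib_left mult.commute)
  ultimately show ?thesis unfolding H_flip[OF \<Lambda>(1,2)] by (simp add: sum_subtractf)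
qed

text \<open>The interaction gains at least \<open>4 * run_gain l\<close>, and the field may take
  back half of that.\<close>

lemma H_flip_short:
  assumes "finite \<Lambda>" "{a - int l..<a + int l + int l} \<subseteq> \<Lambda>" "0 < l"
    and "\<sigma> \<in> configs \<Lambda> (\<lambda>_. 1)" and "s = 1 \<or> s = -1"
    and "\<And>i. i \<in> {a..<a + int l} \<Longrightarrow> \<sigma> i = s"
    and "\<And>j. j \<in> {a - int l..<a} \<union> {a + int l..<a + int l + int l} \<Longrightarrow> \<sigma> j = - s"
    and "\<bar>\<theta> * (\<Sum>i\<in>{a..<a + int l}. h i)\<bar> \<le> run_gain l"
  shows "2 * run_gain l \<le> H \<Lambda> \<sigma> - H \<Lambda> (flip {a..<a + int l} \<sigma>)"
proof -
  let ?I = "{a..<a + int l}" let ?N = "{a - int l..<a} \<union> {a + int l..<a + int l + int l}"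
  have un: "?I \<union> ?N = {a - int l..<a + int l + int l}" using assms by auto
  have 1: "2 * (\<Sum>i\<in>?I. (\<Sum>j\<in>?N. J i j) - boundary_J (?I \<union> ?N) i) - 2 * \<theta> * (s * (\<Sum>i\<in>?I. h i))
     \<le> H \<Lambda> \<sigma> - H \<Lambda> (flip ?I \<sigma>)"
    by (rule H_flip_ge) (use assms un in auto)
  have 2: "(\<Sum>i\<in>?I. (\<Sum>j\<in>?N. J i j) - boundary_J (?I \<union> ?N) i)
    = (\<Sum>i\<in>?I. \<Sum>j\<in>{a - int l..<a}. J i j) + (\<Sum>i\<in>?I. \<Sum>j\<in>{a + int l..<a + int l + int l}. J i j)
      - (\<Sum>i\<in>?I. boundary_J {a - int l..<a + int l + int l} i)"
  proof -
    have "(\<Sum>j\<in>?N. J i j) = (\<Sum>j\<in>{a - int l..<a}. J i j) + (\<Sum>j\<in>{a + int l..<a + int l + int l}. J i j)" for i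
      by (rule sum.union_disjoint) auto
    then show ?thesis unfolding un by (simp add: sum.distrib sum_subtractf)
  qed
  have 3: "2 * \<theta> * (s * (\<Sum>i\<in>?I. h i)) \<le> 2 * \<bar>\<theta> * (\<Sum>i\<in>?I. h i)\<bar>" using assms(5) by auto
  have arith: "2 * g \<le> d"
    if "2 * x - t \<le> d" "x = u + v - w" "t \<le> 2 * e" "p - q \<le> u" "p - q \<le> v" "w \<le> 2 * q" "e \<le> g" "g = p - 2 * q"
    for d e g p q t u v w x :: real
    using that by linarith
  show ?thesis
    by (rule arith[OF 1 2 3 near_ge_left[OF assms(3)] near_ge[OF assms(3)] far_le[OF assms(3)] assms(8) run_gain_def])
qed

text \<open>Here \<open>N\<close> is empty: all surface couplings are counted as lost, and only a
  field sum directed against \<open>s\<close> can make the flip profitable.\<close>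

lemma H_flip_long:
  assumes "finite \<Lambda>" "{a..<a + int l} \<subseteq> \<Lambda>" "0 < l"
    and "\<sigma> \<in> configs \<Lambda> (\<lambda>_. 1)" and "\<And>i. i \<in> {a..<a + int l} \<Longrightarrow> \<sigma> i = s"
  shows "- 2 * \<theta> * (s * (\<Sum>i\<in>{a..<a + int l}. h i)) - 4 * (J1 + tail 1 + (\<Sum>k<l. tail (k + 1)))
     \<le> H \<Lambda> \<sigma> - H \<Lambda> (flip {a..<a + int l} \<sigma>)"
proof -
  let ?I = "{a..<a + int l}"
  have "2 * (\<Sum>i\<in>?I. (\<Sum>j\<in>{}. J i j) - boundary_J (?I \<union> {}) i) - 2 * \<theta> * (s * (\<Sum>i\<in>?I. h i))
     \<le> H \<Lambda> \<sigma> - H \<Lambda> (flip ?I \<sigma>)"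
    by (rule H_flip_ge) (use assms in auto)
  then show ?thesis using surface_le[OF assms(3), of a] by (simp add: sum_negf)
qed

text \<open>Up to constants and the common factor 1/(1-\<alpha>), the near sum is
  l^\<alpha>/\<alpha> and the far sum (2^\<alpha> - 1) l^\<alpha>/\<alpha>. Near minus twice far is
  therefore zeta l^\<alpha>/\<alpha>, which is the origin of \<open>zeta\<close>; the lower bound on
  \<open>J1\<close> absorbs the constants.\<close>

lemma run_gain_ge_powr:
  assumes "0 < \<alpha>" "0 < l" "2 + (1 / \<alpha> + 2) / (1 - \<alpha>) \<le> J1"
  shows "1 + zeta \<alpha> * real l powr \<alpha> \<le> run_gain l"
proof -
  let ?x = "real l powr \<alpha>"
  have z: "0 \<le> zeta \<alpha>" using zeta_pos[OF \<alpha>_less] by simp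
  \<comment> \<open>The integral comparison is for arguments shifted by 1; the first term, at most
    1, is split off.\<close>
  have "(\<Sum>k<l. real (l + k) powr (\<alpha> - 1)) \<le> 1 + (\<Sum>k<l. real (l + k + 1) powr (\<alpha> - 1))"
  proof -
    obtain l' where l': "l = Suc l'" using assms by (cases l) auto
    have "(\<Sum>k<l. real (l + k) powr (\<alpha> - 1)) = real l powr (\<alpha> - 1) + (\<Sum>k<l'. real (l + k + 1) powr (\<alpha> - 1))"
      by (subst (2) l', subst sum.lessThan_Suc_shift) simp
    also have "real l powr (\<alpha> - 1) \<le> real 1 powr (\<alpha> - 1)"
      using assms \<alpha>_less by (intro powr_mono2') auto
    also have "(\<Sum>k<l'. real (l + k + 1) powr (\<alpha> - 1)) \<le> (\<Sum>k<l. real (l + k + 1) powr (\<alpha> - 1))"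
      by (intro sum_mono2) (auto simp: l')
    finally show ?thesis by simp
  qed
  also have "(\<Sum>k<l. real (l + k + 1) powr (\<alpha> - 1)) \<le> (real (l + l) powr \<alpha> - ?x) / \<alpha>"
    by (rule sum_powr_le) (use assms \<alpha>_less in auto)
  also have "real (l + l) powr \<alpha> = 2 powr \<alpha> * ?x" by (simp add: powr_mult flip: mult_2)
  finally have up: "(\<Sum>k<l. real (l + k) powr (\<alpha> - 1)) \<le> 1 + (2 powr \<alpha> * ?x - ?x) / \<alpha>" by simp
  have lo: "(?x - 1) / \<alpha> \<le> (\<Sum>k<l. real (k + 1) powr (\<alpha> - 1))"
    by (rule sum_powr_ge) (use assms \<alpha>_less in auto)
  have "zeta \<alpha> * ?x / \<alpha> - (1 / \<alpha> + 2) = (?x - 1) / \<alpha> - 2 * (1 + (2 powr \<alpha> * ?x - ?x) / \<alpha>)"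
    using assms by (simp add: zeta_def field_simps)
  also have "\<dots> \<le> (\<Sum>k<l. real (k + 1) powr (\<alpha> - 1)) - 2 * (\<Sum>k<l. real (l + k) powr (\<alpha> - 1))"
    by (intro diff_mono mult_left_mono up lo) simp
  finally have "(zeta \<alpha> * ?x / \<alpha> - (1 / \<alpha> + 2)) / (1 - \<alpha>)
     \<le> ((\<Sum>k<l. real (k + 1) powr (\<alpha> - 1)) - 2 * (\<Sum>k<l. real (l + k) powr (\<alpha> - 1))) / (1 - \<alpha>)"
    using \<alpha>_less by (intro divide_right_mono) auto
  also have "\<dots> = (\<Sum>k<l. tail (k + 1)) - 2 * (\<Sum>k<l. tail (l + k))"
    unfolding tail_def by (simp add: diff_divide_distrib flip: sum_divide_distrib)
  finally have "(zeta \<alpha> * ?x / \<alpha>) / (1 - \<alpha>) + 1 \<le> run_gain l"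
    unfolding run_gain_def using assms(3) by (simp add: diff_divide_distrib)
  \<comment> \<open>The factor 1/(\<alpha> (1-\<alpha>)) is at least 1 and is given away.\<close>
  moreover have "zeta \<alpha> * ?x \<le> (zeta \<alpha> * ?x / \<alpha>) / (1 - \<alpha>)"
  proof -
    have "zeta \<alpha> * ?x * (\<alpha> * (1 - \<alpha>)) \<le> zeta \<alpha> * ?x * 1"
      using z assms(1) \<alpha>_less by (intro mult_left_mono mult_le_one) auto
    then show ?thesis using assms(1) \<alpha>_less by (simp add: field_simps)
  qed
  ultimately show ?thesis by linarith
qed

text \<open>For \<alpha> = 0 one has \<open>tail m\<close> = 1/m: the near sum is a harmonic number,
  while the far sum consists of l terms of size at most 1/l.\<close>

lemma run_gain_ge_ln:
  assumes "\<alpha> = 0" "0 < l" "4 \<le> J1"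
  shows "1 + ln (real l) \<le> run_gain l"
proof -
  have t: "tail m = 1 / real m" for m
    unfolding tail_def unfolding assms(1) by (cases "m = 0") (simp_all add: powr_minus divide_inverse)
  have "ln (real l) \<le> ln (real l + 1)" using assms by simp
  also have "\<dots> \<le> harm l" by (rule ln_le_harm)
  also have "\<dots> = (\<Sum>k<l. tail (k + 1))"
    unfolding harm_def t
    by (rule sum.reindex_bij_witness[of _ "\<lambda>k. k + 1" "\<lambda>k. k - 1"]) (auto simp: inverse_eq_divide)
  finally have 1: "ln (real l) \<le> (\<Sum>k<l. tail (k + 1))" .
  have "(\<Sum>k<l. tail (l + k)) \<le> (\<Sum>k<l. tail l)"
    using assms by (intro sum_mono tail_antimono) auto
  also have "\<dots> = 1" unfolding t using assms(2) by simp
  finally show ?thesis unfolding run_gain_def using 1 assms by simp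
qed

lemma sum_tail_le_powr:
  assumes "0 < \<alpha>"
  shows "(\<Sum>k<l. tail (k + 1)) \<le> real l powr \<alpha> / \<alpha> / (1 - \<alpha>)"
proof -
  have "(\<Sum>k<l. real (0 + k + 1) powr (\<alpha> - 1)) \<le> (real (0 + l) powr \<alpha> - real 0 powr \<alpha>) / \<alpha>"
    by (rule sum_powr_le) (use assms \<alpha>_less in auto)
  then have "(\<Sum>k<l. real (k + 1) powr (\<alpha> - 1)) \<le> real l powr \<alpha> / \<alpha>" by simp
  from divide_right_mono[OF this, of "1 - \<alpha>"] show ?thesis
    unfolding tail_def sum_divide_distrib[symmetric] using \<alpha>_less by simp
qed

lemma sum_tail_le_ln:
  assumes "\<alpha> = 0" "0 < l"
  shows "(\<Sum>k<l. tail (k + 1)) \<le> 1 + ln (real l)"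
proof -
  have t: "tail m = 1 / real m" for m
    unfolding tail_def unfolding assms(1) by (cases "m = 0") (simp_all add: powr_minus divide_inverse)
  have "(\<Sum>k<l. tail (k + 1)) = harm l"
    unfolding harm_def t
    by (rule sum.reindex_bij_witness[of _ "\<lambda>k. k - 1" "\<lambda>k. k + 1"]) (auto simp: inverse_eq_divide)
  also have "\<dots> \<le> ln (real l) + 1"
    using euler_mascheroni_sequence_decreasing[of 1 l] assms(2) by (simp add: harm_expand)
  finally show ?thesis by simp
qed

end

section \<open>Runs\<close>

text \<open>Runs by position and length instead of index: the event then visibly depends on finitely
  many spins, and the intervals to be flipped can be read off.\<close>

definition is_run :: "(int \<Rightarrow> real) \<Rightarrow> int \<Rightarrow> nat \<Rightarrow> bool" where
  "is_run \<sigma> p l \<longleftrightarrow> 0 < l \<and> (\<forall>i\<in>{p..<p + int l}. \<sigma> i = \<sigma> p) \<and> \<sigma> (p - 1) \<noteq> \<sigma> p \<and> \<sigma> (p + int l) \<noteq> \<sigma> p"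

lemma is_run_pos: "is_run \<sigma> p l \<Longrightarrow> 0 < l"
  by (simp add: is_run_def)

lemma run_index_step: "run_index \<sigma> (x + 1) = run_index \<sigma> x + of_bool (\<sigma> x \<noteq> \<sigma> (x + 1))"
proof (cases "0 \<le> x")
  case True
  let ?A = "{k \<in> {0..<x}. \<sigma> k \<noteq> \<sigma> (k + 1)}"
  have "{k \<in> {0..<x + 1}. \<sigma> k \<noteq> \<sigma> (k + 1)} = (if \<sigma> x \<noteq> \<sigma> (x + 1) then insert x ?A else ?A)"
    using True by (auto simp: zless_add1_eq order_le_less)
  moreover have "x \<notin> ?A" by auto
  moreover have "finite ?A" by (rule finite_subset[of _ "{0..<x}"]) auto
  ultimately have "int (card {k \<in> {0..<x + 1}. \<sigma> k \<noteq> \<sigma> (k + 1)}) = int (card ?A) + of_bool (\<sigma> x \<noteq> \<sigma> (x + 1))"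
    by (simp only: card_insert_disjoint split: if_split) simp
  then show ?thesis using True unfolding run_index_def by simp
next
  case False
  let ?A = "{k \<in> {x + 1..<0}. \<sigma> k \<noteq> \<sigma> (k + 1)}"
  have "{k \<in> {x..<0}. \<sigma> k \<noteq> \<sigma> (k + 1)} = (if \<sigma> x \<noteq> \<sigma> (x + 1) then insert x ?A else ?A)"
    using False by (auto simp: le_less)
  moreover have "x \<notin> ?A" by auto
  moreover have "finite ?A" by (rule finite_subset[of _ "{x + 1..<0}"]) auto
  ultimately have "int (card {k \<in> {x..<0}. \<sigma> k \<noteq> \<sigma> (k + 1)}) = int (card ?A) + of_bool (\<sigma> x \<noteq> \<sigma> (x + 1))"
    by (simp only: card_insert_disjoint split: if_split) simp
  moreover have "run_index \<sigma> (x + 1) = 1 - int (card ?A)"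
  proof (cases "x + 1 = 0")
    case True then show ?thesis by (simp add: run_index_def)
  next
    case F: False then show ?thesis using False by (simp add: run_index_def)
  qed
  ultimately show ?thesis using False by (simp add: run_index_def)
qed

lemma run_index_mono: "x \<le> y \<Longrightarrow> run_index \<sigma> x \<le> run_index \<sigma> y"
proof (induction y rule: int_ge_induct)
  case (step i)
  then show ?case using run_index_step[of \<sigma> i] by simp
qed simp

text \<open>A discrete intermediate value property: \<open>run_index\<close> grows by at most 1 from
  one site to the next.\<close>

lemma run_nonempty_between:
  assumes "x \<in> run \<sigma> a" "y \<in> run \<sigma> b" "a \<le> j" "j \<le> b"
  shows "run \<sigma> j \<noteq> {}"
proof (cases "x \<le> y")
  case False
  then have "b \<le> a" using run_index_mono[of y x \<sigma>] assms by (simp add: run_def)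
  then have "j = a" using assms by simp
  then show ?thesis using assms(1) by auto
next
  case True
  let ?Z = "{z \<in> {x..y}. run_index \<sigma> z \<le> j}"
  have fin: "finite ?Z" by (rule finite_subset[of _ "{x..y}"]) auto
  have "x \<in> ?Z" using True assms by (auto simp: run_def)
  then have Z: "Max ?Z \<in> ?Z" using fin Max_in by blast
  have "run_index \<sigma> (Max ?Z) = j"
  proof (rule ccontr)
    assume "run_index \<sigma> (Max ?Z) \<noteq> j"
    then have lt: "run_index \<sigma> (Max ?Z) < j" using Z by simp
    then have "Max ?Z \<noteq> y" using assms by (auto simp: run_def)
    moreover have "run_index \<sigma> (Max ?Z + 1) \<le> j"
      using lt run_index_step[of \<sigma> "Max ?Z"] by (simp split: if_splits)
    ultimately have "Max ?Z + 1 \<in> ?Z" using Z by auto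
    then have "Max ?Z + 1 \<le> Max ?Z" using fin Max_ge by blast
    then show False by simp
  qed
  then show ?thesis by (auto simp: run_def)
qed

lemma run_eq_interval:
  assumes "is_run \<sigma> p l"
  shows "run \<sigma> (run_index \<sigma> p) = {p..<p + int l}"
proof -
  have l: "0 < l" and const: "\<And>i. i \<in> {p..<p + int l} \<Longrightarrow> \<sigma> i = \<sigma> p"
    and ends: "\<sigma> (p - 1) \<noteq> \<sigma> p" "\<sigma> (p + int l) \<noteq> \<sigma> p"
    using assms unfolding is_run_def by blast+
  have in_run: "k < l \<Longrightarrow> run_index \<sigma> (p + int k) = run_index \<sigma> p" for k
  proof (induction k)
    case (Suc k)
    have "\<sigma> (p + int k) = \<sigma> p" "\<sigma> (p + int k + 1) = \<sigma> p" using Suc.prems by (auto intro!: const)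
    then show ?case using Suc run_index_step[of \<sigma> "p + int k"] by (simp add: add_ac)
  qed simp
  have left: "run_index \<sigma> z < run_index \<sigma> p" if "z < p" for z
  proof -
    have "run_index \<sigma> z \<le> run_index \<sigma> (p - 1)" using that by (intro run_index_mono) auto
    then show ?thesis using run_index_step[of \<sigma> "p - 1"] ends by simp
  qed
  have right: "run_index \<sigma> p < run_index \<sigma> z" if "p + int l \<le> z" for z
  proof -
    have "run_index \<sigma> (p + int l) \<le> run_index \<sigma> z" using that by (intro run_index_mono) auto
    moreover have "\<sigma> (p + int (l - 1)) = \<sigma> p" using l by (intro const) auto
    moreover have "p + int (l - 1) + 1 = p + int l" using l by simp
    ultimately show ?thesis
      using run_index_step[of \<sigma> "p + int (l - 1)"] in_run[of "l - 1"] ends l by auto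
  qed
  show ?thesis
  proof (intro set_eqI iffI)
    fix z assume "z \<in> run \<sigma> (run_index \<sigma> p)"
    then show "z \<in> {p..<p + int l}" using left[of z] right[of z] by (force simp: run_def)
  next
    fix z assume "z \<in> {p..<p + int l}"
    then show "z \<in> run \<sigma> (run_index \<sigma> p)" using in_run[of "nat (z - p)"] by (auto simp: run_def)
  qed
qed

lemma is_run_of_run:
  assumes ne: "run \<sigma> j \<noteq> {}" and fin: "finite (run \<sigma> j)"
  shows "is_run \<sigma> (Min (run \<sigma> j)) (card (run \<sigma> j))"
    and "run \<sigma> j = {Min (run \<sigma> j)..<Min (run \<sigma> j) + int (card (run \<sigma> j))}"
proof -
  define p q n where "p = Min (run \<sigma> j)" and "q = Max (run \<sigma> j)" and "n = card (run \<sigma> j)"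
  have pq: "run_index \<sigma> p = j" "run_index \<sigma> q = j" "p \<le> q"
    using Min_in[OF fin ne] Max_in[OF fin ne] Max_ge[OF fin] by (auto simp: run_def p_def q_def)
  have eq: "run \<sigma> j = {p..q}"
  proof (intro set_eqI iffI)
    fix z assume "z \<in> run \<sigma> j" then show "z \<in> {p..q}" using fin by (simp add: p_def q_def)
  next
    fix z assume "z \<in> {p..q}"
    then have "run_index \<sigma> p \<le> run_index \<sigma> z" "run_index \<sigma> z \<le> run_index \<sigma> q"
      using run_index_mono by auto
    then show "z \<in> run \<sigma> j" using pq by (simp add: run_def)
  qed
  have "n = nat (q - p + 1)" unfolding n_def eq by simp
  then have q: "q + 1 = p + int n" and n: "0 < n" using pq by auto
  have eq': "run \<sigma> j = {p..<p + int n}" unfolding eq q[symmetric] by auto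
  then show "run \<sigma> j = {Min (run \<sigma> j)..<Min (run \<sigma> j) + int (card (run \<sigma> j))}"
    by (simp only: p_def n_def)
  have same: "\<sigma> z = \<sigma> (z + 1)" if "z \<in> run \<sigma> j" "z + 1 \<in> run \<sigma> j" for z
    using that run_index_step[of \<sigma> z] by (auto simp: run_def split: if_splits)
  have const: "p + int k \<in> run \<sigma> j \<Longrightarrow> \<sigma> (p + int k) = \<sigma> p" for k
  proof (induction k)
    case (Suc k)
    have "p + int k \<in> run \<sigma> j" "p + int k + 1 \<in> run \<sigma> j"
      using Suc.prems unfolding eq by (auto simp: add_ac)
    then show ?case using Suc.IH same[of "p + int k"] by (simp add: add_ac)
  qed simp
  have "p - 1 \<notin> run \<sigma> j" "q + 1 \<notin> run \<sigma> j" unfolding eq by auto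
  then have "\<sigma> (p - 1) \<noteq> \<sigma> p" "\<sigma> q \<noteq> \<sigma> (q + 1)"
    using pq run_index_step[of \<sigma> "p - 1"] run_index_step[of \<sigma> q]
    by (auto simp: run_def split: if_splits)
  moreover have "\<sigma> q = \<sigma> p"
    using const[of "nat (q - p)"] pq by (simp add: run_def)
  moreover have "\<sigma> i = \<sigma> p" if "i \<in> {p..<p + int n}" for i
    using const[of "nat (i - p)"] that unfolding eq' by simp
  ultimately have "is_run \<sigma> p n" unfolding is_run_def q[symmetric] using n by metis
  then show "is_run \<sigma> (Min (run \<sigma> j)) (card (run \<sigma> j))" by (simp only: p_def n_def)
qed

text \<open>An index between the extreme ones belongs to a nonempty run, and monotonicity of
  \<open>run_index\<close> places that run between two runs inside the interval, hence inside it as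
  well.\<close>

lemma runs_window_iff:
  "(\<forall>j\<in>runs_window \<sigma> {a..b}. Q (card (run \<sigma> j)))
     \<longleftrightarrow> (\<forall>p l. a \<le> p \<longrightarrow> p + int l \<le> b + 1 \<longrightarrow> is_run \<sigma> p l \<longrightarrow> Q l)"
proof -
  let ?V = "{a..b}"
  have fin: "finite (runs_inside \<sigma> ?V)"
  proof (rule finite_subset)
    show "runs_inside \<sigma> ?V \<subseteq> run_index \<sigma> ` ?V" by (auto simp: runs_inside_def run_def)
  qed simp
  show ?thesis
  proof (intro iffI ballI allI impI)
    fix p l assume A: "\<forall>j\<in>runs_window \<sigma> ?V. Q (card (run \<sigma> j))"
      and pl: "a \<le> p" "p + int l \<le> b + 1" "is_run \<sigma> p l"
    have "run_index \<sigma> p \<in> runs_inside \<sigma> ?V"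
      using pl(1,2) is_run_pos[OF pl(3)] run_eq_interval[OF pl(3)] by (auto simp: runs_inside_def)
    then have "run_index \<sigma> p \<in> runs_window \<sigma> ?V" using fin by (auto simp: runs_window_def)
    then show "Q l" using A run_eq_interval[OF pl(3)] by force
  next
    fix j assume A: "\<forall>p l. a \<le> p \<longrightarrow> p + int l \<le> b + 1 \<longrightarrow> is_run \<sigma> p l \<longrightarrow> Q l"
      and "j \<in> runs_window \<sigma> ?V"
    then have ne: "runs_inside \<sigma> ?V \<noteq> {}" and j: "Min (runs_inside \<sigma> ?V) \<le> j" "j \<le> Max (runs_inside \<sigma> ?V)"
      by (auto simp: runs_window_def)
    let ?a = "Min (runs_inside \<sigma> ?V)" let ?b = "Max (runs_inside \<sigma> ?V)"
    obtain x y where x: "x \<in> run \<sigma> ?a" "run \<sigma> ?a \<subseteq> ?V" and y: "y \<in> run \<sigma> ?b" "run \<sigma> ?b \<subseteq> ?V"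
      using Min_in[OF fin ne] Max_in[OF fin ne] by (auto simp: runs_inside_def)
    have nej: "run \<sigma> j \<noteq> {}" using run_nonempty_between[OF x(1) y(1) j] .
    have sub: "run \<sigma> j \<subseteq> ?V"
    proof
      fix z assume z: "z \<in> run \<sigma> j"
      show "z \<in> ?V"
      proof (cases "j = ?a \<or> j = ?b")
        case True then show ?thesis using x y z by auto
      next
        case False
        then have "\<not> z \<le> x" "\<not> y \<le> z"
          using j z x y run_index_mono[of z x \<sigma>] run_index_mono[of y z \<sigma>] by (auto simp: run_def)
        then show ?thesis using x y by force
      qed
    qed
    then have finj: "finite (run \<sigma> j)" by (rule finite_subset) simp
    note R = is_run_of_run[OF nej finj]
    obtain p n where pn: "is_run \<sigma> p n" "run \<sigma> j = {p..<p + int n}" "n = card (run \<sigma> j)"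
      using R by blast
    have "{p..<p + int n} \<subseteq> {a..b}" "0 < n" using sub pn(2) is_run_pos[OF pn(1)] by auto
    then have "a \<le> p" "p + int n \<le> b + 1"
      using subsetD[of "{p..<p + int n}" "{a..b}" p] subsetD[of "{p..<p + int n}" "{a..b}" "p + int n - 1"] by auto
    then have "Q n" using A pn(1) by blast
    then show "Q (card (run \<sigma> j))" using pn(3) by simp
  qed
qed

text \<open>Walking from a run to a shorter neighbour never turns back and strictly decreases the length,
  so a run that is no longer than its two neighbours is reached within distance \<open>l\<^sup>2\<close>.\<close>

lemma locally_minimal_run:
  assumes pm: "\<And>i. \<sigma> i = 1 \<or> \<sigma> i = -1"
  shows "is_run \<sigma> p l \<Longrightarrow> \<exists>a l'. 0 < l' \<and> l' \<le> l \<and> \<bar>a - p\<bar> \<le> int l * int l \<and>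
     (\<forall>i\<in>{a..<a + int l'}. \<sigma> i = \<sigma> a) \<and>
     (\<forall>j\<in>{a - int l'..<a} \<union> {a + int l'..<a + int l' + int l'}. \<sigma> j = - \<sigma> a)"
proof (induction l arbitrary: p rule: less_induct)
  case (less l)
  have l: "0 < l" and const: "\<And>i. i \<in> {p..<p + int l} \<Longrightarrow> \<sigma> i = \<sigma> p"
    and ends: "\<sigma> (p - 1) \<noteq> \<sigma> p" "\<sigma> (p + int l) \<noteq> \<sigma> p"
    using less.prems unfolding is_run_def by blast+
  have opp: "\<sigma> i = - \<sigma> j \<longleftrightarrow> \<sigma> i \<noteq> \<sigma> j" for i j using pm[of i] pm[of j] by auto
  \<comment> \<open>The step to a neighbour moves the starting point by at most l, and lengths drop
    by at least 1, so the quadratic bound on the distance survives the induction.\<close>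
  have quad: "int k * int k + int l \<le> int l * int l" if "k < l" for k
  proof -
    have "int k * int k \<le> (int l - 1) * (int l - 1)" using that by (intro mult_mono) auto
    also have "\<dots> = int l * int l - 2 * int l + 1" by (simp add: algebra_simps)
    finally show ?thesis using l by linarith
  qed
  have via: ?case if r: "is_run \<sigma> p' k" "k < l" "\<bar>p' - p\<bar> \<le> int l" for p' k
  proof -
    obtain a l' where al: "0 < l'" "l' \<le> k" "\<bar>a - p'\<bar> \<le> int k * int k"
      "\<forall>i\<in>{a..<a + int l'}. \<sigma> i = \<sigma> a"
      "\<forall>j\<in>{a - int l'..<a} \<union> {a + int l'..<a + int l' + int l'}. \<sigma> j = - \<sigma> a"
      using less.IH[OF r(2,1)] by blast
    moreover have "\<bar>a - p\<bar> \<le> int l * int l" using al(3) r(3) quad[OF r(2)] by linarith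
    moreover have "l' \<le> l" using al(2) r(2) by simp
    ultimately show ?thesis by blast
  qed
  consider "\<forall>j\<in>{p - int l..<p} \<union> {p + int l..<p + int l + int l}. \<sigma> j = - \<sigma> p"
    | j where "j \<in> {p + int l..<p + int l + int l}" "\<sigma> j = \<sigma> p"
    | j where "j \<in> {p - int l..<p}" "\<sigma> j = \<sigma> p"
    using opp by blast
  then show ?case
  proof cases
    case 1
    have "\<bar>p - p\<bar> \<le> int l * int l" by simp
    then show ?thesis using l const 1 by blast
  next
    case (2 j)
    \<comment> \<open>The spin of the run recurs within distance l on the right, so the right
      neighbour is a run shorter than l; k is its length.\<close>
    define k where "k = (LEAST k. \<sigma> (p + int l + int k) = \<sigma> p)"
    have ex: "\<sigma> (p + int l + int (nat (j - (p + int l)))) = \<sigma> p" using 2 by simp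
    have k: "\<sigma> (p + int l + int k) = \<sigma> p" unfolding k_def using ex by (rule LeastI)
    have "k \<le> nat (j - (p + int l))" unfolding k_def using ex by (rule Least_le)
    then have kl: "k < l" using 2 by auto
    have less_k: "\<sigma> (p + int l + int k') \<noteq> \<sigma> p" if "k' < k" for k'
      using that not_less_Least unfolding k_def by blast
    have k0: "0 < k" using k ends by (cases k) auto
    have neq: "\<sigma> i = - \<sigma> p" if "i \<in> {p + int l..<p + int l + int k}" for i
    proof -
      have "p + int l + int (nat (i - (p + int l))) = i" "nat (i - (p + int l)) < k" using that by auto
      then have "\<sigma> i \<noteq> \<sigma> p" using less_k by metis
      then show ?thesis using opp by blast
    qed
    have "\<sigma> (p + int l - 1) = \<sigma> p" using l by (intro const) auto
    then have "is_run \<sigma> (p + int l) k"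
      unfolding is_run_def using k k0 neq ends neq[of "p + int l"] by auto
    then show ?thesis using kl by (rule via) simp
  next
    case (3 j)
    \<comment> \<open>Likewise on the left, counting down from p - 1; the left neighbour starts at p
      - k.\<close>
    define k where "k = (LEAST k. \<sigma> (p - 1 - int k) = \<sigma> p)"
    have ex: "\<sigma> (p - 1 - int (nat (p - 1 - j))) = \<sigma> p" using 3 by simp
    have k: "\<sigma> (p - 1 - int k) = \<sigma> p" unfolding k_def using ex by (rule LeastI)
    have "k \<le> nat (p - 1 - j)" unfolding k_def using ex by (rule Least_le)
    then have kl: "k < l" using 3 by auto
    have less_k: "\<sigma> (p - 1 - int k') \<noteq> \<sigma> p" if "k' < k" for k'
      using that not_less_Least unfolding k_def by blast
    have k0: "0 < k" using k ends by (cases k) auto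
    have neq: "\<sigma> i = - \<sigma> p" if "i \<in> {p - int k..<p}" for i
    proof -
      have "p - 1 - int (nat (p - 1 - i)) = i" "nat (p - 1 - i) < k" using that by auto
      then have "\<sigma> i \<noteq> \<sigma> p" using less_k by metis
      then show ?thesis using opp by blast
    qed
    have pk: "\<sigma> (p - int k) = - \<sigma> p" using k0 by (intro neq) auto
    have "\<sigma> (p - int k - 1) = \<sigma> p" using k by (simp add: algebra_simps)
    moreover have "\<sigma> p \<noteq> - \<sigma> p" using pm[of p] by auto
    ultimately have "is_run \<sigma> (p - int k) k"
      unfolding is_run_def using k0 neq pk by auto
    then show ?thesis using kl by (rule via) (use kl in simp)
  qed
qed

section \<open>Sums of the random field\<close>

abbreviation block_sum :: "int \<Rightarrow> nat \<Rightarrow> (int \<Rightarrow> real) \<Rightarrow> real" where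
  "block_sum a l \<omega> \<equiv> \<Sum>i\<in>{a..<a + int l}. \<omega> i"

interpretation field: prob_space field_dist
  unfolding field_dist_def by (intro prob_space_PiM prob_space_measure_pmf)

lemma space_field_dist [simp]: "space field_dist = UNIV"
  by (simp add: field_dist_def space_PiM)

lemma field_prob_UNIV [simp]: "field.prob UNIV = 1"
  using field.prob_space by simp

lemma field_measurable [measurable]: "(\<lambda>\<omega>. \<omega> i) \<in> borel_measurable field_dist"
proof -
  have "(\<lambda>\<omega>. \<omega> i) \<in> measurable field_dist (measure_pmf (pmf_of_set {-1, 1::real}))"
    unfolding field_dist_def by (rule measurable_component_singleton) simp
  moreover have "(\<lambda>x. x) \<in> measurable (measure_pmf (pmf_of_set {-1, 1::real})) borel" by simp
  ultimately show ?thesis by (rule measurable_compose)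
qed

text \<open>Independence of the coordinates of a product measure. The factors carry the discrete
  sigma-algebra; composing with the identity replaces it by the Borel one.\<close>

lemma field_indep: "field.indep_vars (\<lambda>_. borel) (\<lambda>i \<omega>. \<omega> i) A"
proof -
  let ?N = "measure_pmf (pmf_of_set {-1, 1::real})"
  have rv: "(\<lambda>\<omega>. \<omega> i) \<in> measurable field_dist ?N" for i
    unfolding field_dist_def by (rule measurable_component_singleton) simp
  have "distr field_dist (\<Pi>\<^sub>M i\<in>UNIV. ?N) (\<lambda>x. \<lambda>i\<in>UNIV. x i) = field_dist"
    unfolding field_dist_def by (simp add: restrict_UNIV distr_id)
  also have "field_dist = (\<Pi>\<^sub>M i\<in>UNIV. distr field_dist ?N (\<lambda>\<omega>. \<omega> i))"
  proof -
    have "distr field_dist ?N (\<lambda>\<omega>. \<omega> i) = ?N" for i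
      unfolding field_dist_def by (rule distr_PiM_component) (auto intro: prob_space_measure_pmf)
    then show ?thesis by (simp add: field_dist_def)
  qed
  finally have "field.indep_vars (\<lambda>_. ?N) (\<lambda>i \<omega>. \<omega> i) UNIV"
    using rv by (subst field.indep_vars_iff_distr_eq_PiM') auto
  then have "field.indep_vars (\<lambda>_. borel) (\<lambda>i \<omega>. \<omega> i) UNIV"
    by (rule field.indep_vars_compose2) simp
  then show ?thesis by (rule field.indep_vars_subset) simp
qed

lemma field_AE: "AE \<omega> in field_dist. \<omega> i = 1 \<or> \<omega> i = -1"
  unfolding field_dist_def
  by (rule AE_PiM_component) (auto simp: prob_space_measure_pmf AE_measure_pmf_iff)

lemma field_mean: "field.expectation (\<lambda>\<omega>. \<omega> i) = 0"
proof -
  let ?N = "measure_pmf (pmf_of_set {-1, 1::real})"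
  have "field.expectation (\<lambda>\<omega>. \<omega> i) = integral\<^sup>L (distr field_dist ?N (\<lambda>\<omega>. \<omega> i)) (\<lambda>x. x)"
    unfolding field_dist_def by (intro integral_distr[symmetric] measurable_component_singleton) auto
  also have "distr field_dist ?N (\<lambda>\<omega>. \<omega> i) = ?N"
    unfolding field_dist_def by (rule distr_PiM_component) (auto intro: prob_space_measure_pmf)
  also have "integral\<^sup>L ?N (\<lambda>x. x) = 0"
    by (subst integral_pmf_of_set) auto
  finally show ?thesis .
qed

lemma field_abs_sum_le:
  assumes "finite A"
  shows "AE \<omega> in field_dist. \<bar>\<Sum>i\<in>A. \<omega> i\<bar> \<le> card A"
proof -
  have "AE \<omega> in field_dist. \<forall>i\<in>A. \<omega> i = 1 \<or> \<omega> i = -1"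
    using assms field_AE by (rule AE_finite_allI)
  then show ?thesis
  proof eventually_elim
    case (elim \<omega>)
    have "\<bar>\<Sum>i\<in>A. \<omega> i\<bar> \<le> (\<Sum>i\<in>A. \<bar>\<omega> i\<bar>)" by (rule sum_abs)
    also have "\<dots> \<le> (\<Sum>i\<in>A. 1)" using elim by (intro sum_mono) auto
    finally show ?case by simp
  qed
qed

lemma field_sum_power_integrable:
  assumes "finite A"
  shows "integrable field_dist (\<lambda>\<omega>. (\<Sum>i\<in>A. \<omega> i) ^ n)"
proof (rule field.integrable_const_bound)
  show "AE \<omega> in field_dist. norm ((\<Sum>i\<in>A. \<omega> i) ^ n) \<le> card A ^ n"
    using field_abs_sum_le[OF assms]
    by eventually_elim (simp add: power_abs power_mono)
qed measurable

text \<open>When a site is added, odd powers of its spin average out by independence and even powers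
  are 1. For the fourth moment this leaves 1 + 6 n + 3 n^2 \<le> 3 (n + 1)^2.\<close>

lemma field_moments:
  assumes "finite A"
  shows "field.expectation (\<lambda>\<omega>. \<Sum>i\<in>A. \<omega> i) = 0
    \<and> field.expectation (\<lambda>\<omega>. (\<Sum>i\<in>A. \<omega> i) ^ 2) = card A
    \<and> field.expectation (\<lambda>\<omega>. (\<Sum>i\<in>A. \<omega> i) ^ 4) \<le> 3 * (card A)\<^sup>2"
  using assms
proof (induction A rule: finite_induct)
  case empty
  then show ?case by simp
next
  case (insert x A)
  let ?S = "\<lambda>\<omega>. \<Sum>i\<in>A. \<omega> i"
  have ind: "field.indep_var borel (\<lambda>\<omega>. \<omega> x) borel ?S"
    by (rule field.indep_vars_sum) (use insert field_indep in auto)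
  have ix: "integrable field_dist (\<lambda>\<omega>. \<omega> x)"
    using field_sum_power_integrable[of "{x}" 1] by simp
  have iS: "integrable field_dist (\<lambda>\<omega>. ?S \<omega> ^ n)" for n
    by (rule field_sum_power_integrable) (use insert in auto)
  have ind_n: "field.indep_var borel (\<lambda>\<omega>. \<omega> x) borel (\<lambda>\<omega>. ?S \<omega> ^ n)" for n
    using field.indep_var_compose[OF ind, of "\<lambda>x. x" borel "\<lambda>y. y ^ n" borel] by (simp add: comp_def)
  have cross: "field.expectation (\<lambda>\<omega>. \<omega> x * ?S \<omega> ^ n) = 0" "integrable field_dist (\<lambda>\<omega>. \<omega> x * ?S \<omega> ^ n)" for n
    using field.indep_var_lebesgue_integral[OF ind_n ix iS] field.indep_var_integrable[OF ind_n ix iS] field_mean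
    by auto
  have sum_insert: "(\<Sum>i\<in>insert x A. \<omega> i) = \<omega> x + ?S \<omega>" for \<omega> :: "int \<Rightarrow> real" using insert by simp
  have m1: "field.expectation (\<lambda>\<omega>. \<omega> x + ?S \<omega>) = 0"
    using insert.IH field_mean ix iS[of 1] by simp
  have "field.expectation (\<lambda>\<omega>. (\<omega> x + ?S \<omega>) ^ 2) = field.expectation (\<lambda>\<omega>. 1 + 2 * (\<omega> x * ?S \<omega> ^ 1) + ?S \<omega> ^ 2)"
  proof (rule integral_cong_AE)
    show "AE \<omega> in field_dist. (\<omega> x + ?S \<omega>) ^ 2 = 1 + 2 * (\<omega> x * ?S \<omega> ^ 1) + ?S \<omega> ^ 2"
      using field_AE[of x] by eventually_elim (auto simp: power2_eq_square algebra_simps)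
  qed measurable
  also have "\<dots> = 1 + 2 * 0 + card A"
    using cross[of 1] iS[of 2] insert.IH by simp
  finally have m2: "field.expectation (\<lambda>\<omega>. (\<omega> x + ?S \<omega>) ^ 2) = 1 + real (card A)" by simp
  have "field.expectation (\<lambda>\<omega>. (\<omega> x + ?S \<omega>) ^ 4)
    = field.expectation (\<lambda>\<omega>. 1 + 4 * (\<omega> x * ?S \<omega> ^ 1) + 6 * ?S \<omega> ^ 2 + 4 * (\<omega> x * ?S \<omega> ^ 3) + ?S \<omega> ^ 4)"
  proof (rule integral_cong_AE)
    show "AE \<omega> in field_dist. (\<omega> x + ?S \<omega>) ^ 4
        = 1 + 4 * (\<omega> x * ?S \<omega> ^ 1) + 6 * ?S \<omega> ^ 2 + 4 * (\<omega> x * ?S \<omega> ^ 3) + ?S \<omega> ^ 4"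
      using field_AE[of x]
      by eventually_elim (auto simp: power2_eq_square power3_eq_cube power4_eq_xxxx algebra_simps)
  qed measurable
  also have "\<dots> = 1 + 4 * 0 + 6 * card A + 4 * 0 + field.expectation (\<lambda>\<omega>. ?S \<omega> ^ 4)"
    using cross[of 1] cross[of 3] iS[of 2] iS[of 4] insert.IH by simp
  also have "\<dots> \<le> 3 * (1 + real (card A))\<^sup>2"
    using insert.IH by (simp add: power2_eq_square algebra_simps)
  finally have m4: "field.expectation (\<lambda>\<omega>. (\<omega> x + ?S \<omega>) ^ 4) \<le> 3 * (1 + real (card A))\<^sup>2" .
  show ?case unfolding sum_insert using m1 m2 m4 insert by simp
qed

text \<open>The quartic equals \<open>y (y + 2)\<^sup>2 (4 - y) / 12\<close>. It replaces the Paley-Zygmund argument: using the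
  mean as well as the second and fourth moments, it bounds a one-sided probability from below.\<close>

lemma quartic_le_indicator:
  fixes y :: real
  shows "4/3 * y + y ^ 2 - y ^ 4 / 12 \<le> 19/48 + 8 * of_bool (1/4 \<le> y)"
proof (cases "1/4 \<le> y")
  case True
  \<comment> \<open>A sum of squares showing that the quartic never exceeds 27/4 + 8/9, which is
    below 8.\<close>
  have "0 \<le> (y ^ 2 - 9) ^ 2 / 12 + (1/2) * (y - 4/3) ^ 2" by simp
  also have "\<dots> = y ^ 4 / 12 - y ^ 2 - 4/3 * y + 27/4 + 8/9"
    by (simp add: power2_eq_square power4_eq_xxxx field_simps)
  finally show ?thesis using True by simp
next
  case False
  have eq: "4/3 * y + y ^ 2 - y ^ 4 / 12 = y * (y + 2) ^ 2 * (4 - y) / 12"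
    by (simp add: power2_eq_square power4_eq_xxxx field_simps)
  show ?thesis
  proof (cases "y \<le> 0")
    case True
    then have "y * ((y + 2) ^ 2 * (4 - y)) \<le> 0" by (intro mult_nonpos_nonneg) auto
    then have "y * (y + 2) ^ 2 * (4 - y) / 12 \<le> 0" by (simp add: mult.assoc)
    also have "0 \<le> 19/48 + 8 * (of_bool (1/4 \<le> y) :: real)" by simp
    finally show ?thesis unfolding eq .
  next
    case pos: False
    have "y ^ 2 \<le> (1/4) ^ 2" using False pos by (intro power_mono) auto
    then have "y ^ 2 \<le> 1/16" by (simp add: power_divide)
    moreover have "0 \<le> y ^ 4" "y \<le> 1/4" using False by auto
    \<comment> \<open>19/48 is 1/3 + 1/16, the first two terms at y = 1/4.\<close>
    ultimately have "4/3 * y + y ^ 2 - y ^ 4 / 12 \<le> 19/48" by linarith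
    then show ?thesis using False by simp
  qed
qed

lemma field_sum_large_prob:
  assumes "finite A" "A \<noteq> {}" "s = 1 \<or> s = -1"
  shows "1/24 \<le> field.prob {\<omega>. sqrt (card A) / 4 \<le> s * (\<Sum>i\<in>A. \<omega> i)}"
proof -
  let ?n = "real (card A)" let ?S = "\<lambda>\<omega>. \<Sum>i\<in>A. \<omega> i"
  let ?y = "\<lambda>\<omega>. s * ?S \<omega> / sqrt ?n"
  define G where "G = {\<omega>. sqrt ?n / 4 \<le> s * ?S \<omega>}"
  have n: "0 < ?n" using assms by (simp add: card_gt_0_iff)
  have s: "s\<^sup>2 = 1" "s ^ 4 = 1" using assms by auto
  have iS: "integrable field_dist (\<lambda>\<omega>. ?S \<omega> ^ k)" for k
    using assms by (intro field_sum_power_integrable)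
  have G_sets [measurable]: "G \<in> sets field_dist"
  proof -
    have "{\<omega> \<in> space field_dist. sqrt ?n / 4 \<le> s * ?S \<omega>} \<in> sets field_dist" by measurable
    then show ?thesis by (simp add: G_def)
  qed
  have iG: "integrable field_dist (indicat_real G)"
    by (intro integrable_real_indicator G_sets) (simp add: field.emeasure_eq_measure)
  note mom = field_moments[OF assms(1)]
  have sq: "sqrt ?n ^ 4 = ?n ^ 2"
  proof -
    have "sqrt ?n ^ 4 = (sqrt ?n ^ 2) ^ 2" by (simp only: power_mult[symmetric]) simp
    then show ?thesis using n by (simp only: real_sqrt_pow2)
  qed
  have yeq: "4/3 * ?y \<omega> + ?y \<omega> ^ 2 - ?y \<omega> ^ 4 / 12
      = 4 * s / (3 * sqrt ?n) * ?S \<omega> ^ 1 + (1 / ?n) * ?S \<omega> ^ 2 - (1 / (12 * ?n ^ 2)) * ?S \<omega> ^ 4" for \<omega>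
    using n by (simp add: power_divide power_mult_distrib s sq)
  \<comment> \<open>The quartic has mean at least 1 - 3/12 = 3/4, and (3/4 - 19/48)/8 = 17/384
    exceeds 1/24.\<close>
  have "3/4 \<le> 0 + (1 / ?n) * ?n - (1 / (12 * ?n ^ 2)) * (3 * ?n ^ 2)"
    using n by simp
  also have "\<dots> \<le> 4 * s / (3 * sqrt ?n) * field.expectation (\<lambda>\<omega>. ?S \<omega> ^ 1) + (1 / ?n) * field.expectation (\<lambda>\<omega>. ?S \<omega> ^ 2)
      - (1 / (12 * ?n ^ 2)) * field.expectation (\<lambda>\<omega>. ?S \<omega> ^ 4)"
    using mom by (intro diff_mono add_mono mult_left_mono) auto
  also have "\<dots> = field.expectation (\<lambda>\<omega>. 4/3 * ?y \<omega> + ?y \<omega> ^ 2 - ?y \<omega> ^ 4 / 12)"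
    unfolding yeq using iS[of 1] iS[of 2] iS[of 4] by simp
  also have "\<dots> \<le> field.expectation (\<lambda>\<omega>. 19/48 + 8 * indicator G \<omega>)"
  proof (rule integral_mono)
    show "integrable field_dist (\<lambda>\<omega>. 4/3 * ?y \<omega> + ?y \<omega> ^ 2 - ?y \<omega> ^ 4 / 12)"
      unfolding yeq using iS[of 1] iS[of 2] iS[of 4] by simp
    show "integrable field_dist (\<lambda>\<omega>. 19/48 + 8 * indicator G \<omega> :: real)"
      using iG by simp
    fix \<omega> show "4/3 * ?y \<omega> + ?y \<omega> ^ 2 - ?y \<omega> ^ 4 / 12 \<le> 19/48 + 8 * indicator G \<omega>"
      using quartic_le_indicator[of "?y \<omega>"] n by (simp add: indicator_def G_def field_simps)
  qed
  also have "\<dots> = 19/48 + 8 * field.prob G"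
    using iG by simp
  finally show ?thesis unfolding G_def by simp
qed

lemma block_sum_measurable [measurable]: "block_sum a l \<in> borel_measurable field_dist"
  by measurable

lemma block_sum_tail:
  assumes "0 < l" "0 \<le> t"
  shows "field.prob {\<omega>. t \<le> \<bar>block_sum a l \<omega>\<bar>} \<le> 2 * exp (- t\<^sup>2 / (2 * real l))"
proof -
  interpret Hoeffding_ineq field_dist "{a..<a + int l}" "\<lambda>i \<omega>. \<omega> i" "\<lambda>_. -1" "\<lambda>_. 1" 0
  proof unfold_locales
    show "field.indep_vars (\<lambda>_. borel) (\<lambda>i \<omega>. \<omega> i) {a..<a + int l}" by (rule field_indep)
    show "AE \<omega> in field_dist. \<omega> i \<in> {-1..1}" for i
      using field_AE[of i] by eventually_elim auto
    show "(0::real) \<equiv> \<Sum>i\<in>{a..<a + int l}. field.expectation (\<lambda>\<omega>. \<omega> i)"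
      by (simp add: field_mean)
  qed simp
  have "field.prob {x \<in> space field_dist. t \<le> \<bar>(\<Sum>i\<in>{a..<a + int l}. x i) - 0\<bar>}
     \<le> 2 * exp (- 2 * t\<^sup>2 / (\<Sum>i\<in>{a..<a + int l}. (1 - -1)\<^sup>2))"
    by (rule Hoeffding_ineq_abs_ge) (use assms in auto)
  then show ?thesis using assms by (simp add: field_simps)
qed

text \<open>Sums over disjoint blocks are independent, and each misses the threshold with
  probability at most 1 - 1/24 \<le> exp (-1/24).\<close>

lemma no_large_block_prob:
  assumes "0 < L" "0 < K" "s = 1 \<or> s = -1"
  shows "field.prob {\<omega>. \<forall>k<K. s * block_sum (a + int (k * L)) L \<omega> < sqrt L / 4} \<le> exp (- real K / 24)"
proof -
  let ?B = "\<lambda>k. {a + int (k * L)..<a + int (k * L) + int L}"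
  let ?X = "\<lambda>k \<omega>. s * block_sum (a + int (k * L)) L \<omega>"
  have disj: "disjoint_family_on ?B {..<K}"
    unfolding disjoint_family_on_def
  proof (intro ballI impI)
    have *: "?B k \<inter> ?B k' = {}" if "k < k'" for k k'
    proof -
      have "(k + 1) * L \<le> k' * L" using that by (intro mult_right_mono) auto
      then have "k * L + L \<le> k' * L" by simp
      then have "int (k * L) + int L \<le> int (k' * L)" by (simp only: of_nat_le_iff flip: of_nat_add)
      then show ?thesis by auto
    qed
    fix k k' :: nat assume "k \<noteq> k'"
    then show "?B k \<inter> ?B k' = {}" using *[of k k'] *[of k' k] by (cases "k < k'") auto
  qed
  have "field.indep_vars (\<lambda>k. PiM (?B k) (\<lambda>_. borel)) (\<lambda>k \<omega>. restrict (\<lambda>i. \<omega> i) (?B k)) {..<K}"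
    by (rule field.indep_vars_restrict[OF field_indep[of UNIV] _ disj]) simp
  then have "field.indep_vars (\<lambda>_. borel) (\<lambda>k \<omega>. s * (\<Sum>i\<in>?B k. restrict (\<lambda>i. \<omega> i) (?B k) i)) {..<K}"
    by (rule field.indep_vars_compose2[where Y = "\<lambda>k f. s * (\<Sum>i\<in>?B k. f i)"]) measurable
  moreover have "(\<lambda>k \<omega>. s * (\<Sum>i\<in>?B k. restrict (\<lambda>i. \<omega> i) (?B k) i)) = ?X"
    by (intro ext arg_cong[where f = "(*) s"] sum.cong) auto
  ultimately have ind: "field.indep_vars (\<lambda>_. borel) ?X {..<K}" by simp
  have "{\<omega>. \<forall>k<K. ?X k \<omega> < sqrt L / 4} = (\<Inter>k\<in>{..<K}. ?X k -` {..<sqrt L / 4} \<inter> space field_dist)"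
    by auto
  also have "field.prob \<dots> = (\<Prod>k<K. field.prob (?X k -` {..<sqrt L / 4} \<inter> space field_dist))"
    by (rule field.indep_varsD_finite[OF ind]) (use assms in auto)
  also have "\<dots> \<le> (\<Prod>k<K. exp (- 1 / 24))"
  proof (rule prod_mono, intro conjI)
    fix k
    let ?G = "{\<omega>. sqrt L / 4 \<le> ?X k \<omega>}"
    have "{\<omega> \<in> space field_dist. sqrt L / 4 \<le> ?X k \<omega>} \<in> sets field_dist" by measurable
    then have G: "?G \<in> sets field_dist" by simp
    have "1/24 \<le> field.prob ?G"
      using field_sum_large_prob[of "?B k" s] assms by simp
    moreover have "?X k -` {..<sqrt L / 4} \<inter> space field_dist = space field_dist - ?G" by auto
    ultimately have "field.prob (?X k -` {..<sqrt L / 4} \<inter> space field_dist) \<le> 1 + (- 1 / 24)"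
      using field.prob_compl[OF G] by simp
    also have "\<dots> \<le> exp (- 1 / 24)" by (rule exp_ge_add_one_self)
    finally show "field.prob (?X k -` {..<sqrt L / 4} \<inter> space field_dist) \<le> exp (- 1 / 24)" .
  qed simp
  also have "\<dots> = exp (- real K / 24)" by (simp flip: exp_of_nat_mult)
  finally show ?thesis .
qed

text \<open>A union bound over everything the flips will need: moderate sums on all blocks of length
  up to \<open>l1\<close>, for short runs, and for each starting point and sign one large sum among
  \<open>K\<close> consecutive blocks, for long runs.\<close>

lemma exists_good_field:
  fixes t :: "nat \<Rightarrow> real"
  assumes t: "\<And>l. 0 < l \<Longrightarrow> l \<le> l1 \<Longrightarrow> 0 \<le> t l \<and> R \<le> (t l)\<^sup>2 / (2 * real l)"
    and "0 < L" "0 < K"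
  shows "\<exists>E\<in>sets field_dist.
    1 - ((2 * real M + 1) * real l1 * (2 * exp (- R)) + (2 * real m + 1) * 2 * exp (- real K / 24)) \<le> measure field_dist E \<and>
    (\<forall>h\<in>E. (\<forall>a\<in>{- int M..int M}. \<forall>l\<in>{1..l1}. \<bar>block_sum a l h\<bar> \<le> t l) \<and>
       (\<forall>a\<in>{- int m..int m}. \<forall>s\<in>{1, -1}. \<exists>k<K. sqrt L / 4 \<le> s * block_sum (a + int (k * L)) L h))"
proof -
  define B where "B = (\<lambda>(a, l). {\<omega>. t l \<le> \<bar>block_sum a l \<omega>\<bar>})"
  define C where "C = (\<lambda>(a, s). {\<omega>. \<forall>k<K. s * block_sum (a + int (k * L)) L \<omega> < sqrt L / 4})"
  let ?I = "{- int M..int M} \<times> {1..l1}" let ?J = "{- int m..int m} \<times> {1, -1::real}"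
  have B: "B x \<in> sets field_dist" for x
  proof -
    have "{\<omega> \<in> space field_dist. t (snd x) \<le> \<bar>block_sum (fst x) (snd x) \<omega>\<bar>} \<in> sets field_dist" by measurable
    then show ?thesis by (simp add: B_def split_beta)
  qed
  have C: "C x \<in> sets field_dist" for x
  proof -
    have "{\<omega> \<in> space field_dist. \<forall>k<K. snd x * block_sum (fst x + int (k * L)) L \<omega> < sqrt L / 4} \<in> sets field_dist"
      by measurable
    then show ?thesis by (simp add: C_def split_beta)
  qed
  let ?BU = "\<Union>x\<in>?I. B x" let ?CU = "\<Union>x\<in>?J. C x"
  have BU: "?BU \<in> sets field_dist" "?CU \<in> sets field_dist" using B C by (auto intro!: sets.finite_UN)
  have "field.prob ?BU \<le> (\<Sum>x\<in>?I. field.prob (B x))"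
    using B by (intro field.finite_measure_subadditive_finite) auto
  also have "\<dots> \<le> (\<Sum>x\<in>?I. 2 * exp (- R))"
  proof (rule sum_mono)
    fix x assume "x \<in> ?I"
    then obtain a l where x: "x = (a, l)" "0 < l" "l \<le> l1" by auto
    have "field.prob (B x) \<le> 2 * exp (- (t l)\<^sup>2 / (2 * real l))"
      unfolding x B_def using block_sum_tail[OF x(2)] t[OF x(2,3)] by simp
    also have "\<dots> \<le> 2 * exp (- R)" using t[OF x(2,3)] by simp
    finally show "field.prob (B x) \<le> 2 * exp (- R)" .
  qed
  also have "\<dots> = (2 * real M + 1) * real l1 * (2 * exp (- R))" by (simp add: card_cartesian_product)
  finally have pB: "field.prob ?BU \<le> (2 * real M + 1) * real l1 * (2 * exp (- R))" .
  have "field.prob ?CU \<le> (\<Sum>x\<in>?J. field.prob (C x))"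
    using C by (intro field.finite_measure_subadditive_finite) auto
  also have "\<dots> \<le> (\<Sum>x\<in>?J. exp (- real K / 24))"
  proof (rule sum_mono)
    fix x assume "x \<in> ?J"
    then obtain a s where x: "x = (a, s)" "s = 1 \<or> s = -1" by auto
    show "field.prob (C x) \<le> exp (- real K / 24)"
      unfolding x C_def using no_large_block_prob[OF assms(2,3) x(2)] by simp
  qed
  also have "\<dots> = (2 * real m + 1) * 2 * exp (- real K / 24)" by (simp add: card_cartesian_product)
  finally have pC: "field.prob ?CU \<le> (2 * real m + 1) * 2 * exp (- real K / 24)" .
  have "field.prob (?BU \<union> ?CU) \<le> field.prob ?BU + field.prob ?CU"
    by (rule measure_Un_le) (use BU in auto)
  moreover have "field.prob (space field_dist - (?BU \<union> ?CU)) = 1 - field.prob (?BU \<union> ?CU)"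
    by (rule field.prob_compl) (use BU in auto)
  ultimately have 1: "1 - ((2 * real M + 1) * real l1 * (2 * exp (- R)) + (2 * real m + 1) * 2 * exp (- real K / 24))
     \<le> field.prob (space field_dist - (?BU \<union> ?CU))" using pB pC by linarith
  have 2: "space field_dist - (?BU \<union> ?CU) \<in> sets field_dist" by (intro sets.compl_sets sets.Un BU)
  have 3: "(\<forall>a\<in>{- int M..int M}. \<forall>l\<in>{1..l1}. \<bar>block_sum a l h\<bar> \<le> t l) \<and>
       (\<forall>a\<in>{- int m..int m}. \<forall>s\<in>{1, -1}. \<exists>k<K. sqrt L / 4 \<le> s * block_sum (a + int (k * L)) L h)"
    if "h \<in> space field_dist - (?BU \<union> ?CU)" for h
  proof (intro conjI ballI)
    fix a l assume "a \<in> {- int M..int M}" "l \<in> {1..l1}"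
    then have "(a, l) \<in> ?I" by simp
    then have "h \<notin> B (a, l)" using that by blast
    then show "\<bar>block_sum a l h\<bar> \<le> t l" by (simp add: B_def)
  next
    fix a and s :: real assume "a \<in> {- int m..int m}" "s \<in> {1, -1}"
    then have "(a, s) \<in> ?J" by simp
    then have "h \<notin> C (a, s)" using that by blast
    then show "\<exists>k<K. sqrt L / 4 \<le> s * block_sum (a + int (k * L)) L h" by (auto simp: C_def not_less)
  qed
  show ?thesis by (rule bexI[OF _ 2], intro conjI 1 ballI 3)
qed

section \<open>Typical configurations\<close>

context ising_chain
begin

lemma P_Un_le:
  assumes "finite \<Lambda>"
  shows "P \<Lambda> (A \<union> B) \<le> P \<Lambda> A + P \<Lambda> B"
proof -
  have "P \<Lambda> (A \<union> B) = P \<Lambda> (A \<union> (B - A))" by simp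
  also have "\<dots> = P \<Lambda> A + P \<Lambda> (B - A)" by (rule P_Un_disjoint) (use assms in auto)
  also have "P \<Lambda> (B - A) \<le> P \<Lambda> B" by (rule P_mono) (use assms in auto)
  finally show ?thesis by simp
qed

definition typical :: "nat \<Rightarrow> real \<Rightarrow> real \<Rightarrow> (int \<Rightarrow> real) set" where
  "typical m lo hi = {\<sigma>. \<forall>p l. - int m \<le> p \<longrightarrow> p + int l \<le> int m + 1 \<longrightarrow> is_run \<sigma> p l \<longrightarrow> lo \<le> real l \<and> real l \<le> hi}"

lemma convergent_P_typical: "convergent (\<lambda>n. P {- int n..int n} (typical m lo hi))"
proof (rule convergent_P_local)
  fix \<sigma> \<tau> :: "int \<Rightarrow> real"
  \<comment> \<open>One site beyond each end is included because \<open>is_run\<close> inspects the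
    spins just outside the run.\<close>
  assume eq: "\<And>i. i \<in> {- int m - 1..int m + 1} \<Longrightarrow> \<sigma> i = \<tau> i" and \<sigma>: "\<sigma> \<in> typical m lo hi"
  have "is_run \<sigma> p l" if "- int m \<le> p" "p + int l \<le> int m + 1" "is_run \<tau> p l" for p l
  proof -
    have l: "0 < l" using that(3) by (rule is_run_pos)
    have e: "\<sigma> (p - 1) = \<tau> (p - 1)" "\<sigma> p = \<tau> p" "\<sigma> (p + int l) = \<tau> (p + int l)"
      using that(1,2) l by (auto intro!: eq)
    have "\<sigma> i = \<tau> i" if "i \<in> {p..<p + int l}" for i
      using that \<open>- int m \<le> p\<close> \<open>p + int l \<le> int m + 1\<close> by (intro eq) auto
    then show ?thesis using that(3) e unfolding is_run_def by metis
  qed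
  then show "\<tau> \<in> typical m lo hi" using \<sigma> unfolding typical_def by blast
qed simp

text \<open>A short run leads to a pattern \<open>C1\<close>, a block opposed by both adjacent
  blocks, at distance at most l1^2 from the run, whence \<open>M\<close>. A long run contains a
  constant stretch \<open>C2\<close> of K L sites. Each pattern gains energy at least 1 by a single
  flip, so the bound is the number of patterns times \<open>exp (- \<beta>)\<close>.\<close>

lemma P_not_typical_le:
  assumes \<theta>: "0 < \<theta>" and KL: "0 < L"
    and lo: "lo \<le> real l1 + 1" and hi: "real (K * L) \<le> hi"
    and M: "M = m + l1 * l1" and n: "M + 2 * l1 + K * L \<le> n"
    and gain: "\<And>l. 0 < l \<Longrightarrow> l \<le> l1 \<Longrightarrow> 1 \<le> run_gain l \<and> \<theta> * t l \<le> run_gain l"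
    and small: "\<And>a l. a \<in> {- int M..int M} \<Longrightarrow> l \<in> {1..l1} \<Longrightarrow> \<bar>block_sum a l h\<bar> \<le> t l"
    and large: "\<And>a s. a \<in> {- int m..int m} \<Longrightarrow> s \<in> {1, -1} \<Longrightarrow> \<exists>k<K. sqrt L / 4 \<le> s * block_sum (a + int (k * L)) L h"
    and L: "1 + 4 * (J1 + tail 1 + (\<Sum>k<L. tail (k + 1))) \<le> \<theta> * sqrt L / 2"
  shows "P {- int n..int n} (- typical m lo hi)
    \<le> ((2 * real M + 1) * real l1 * 2 + (2 * real m + 1) * 2) * exp (- \<beta>)"
proof -
  let ?\<Lambda> = "{- int n..int n}"
  define C1 where "C1 = (\<lambda>(a, l, s). {\<sigma>::int \<Rightarrow> real. (\<forall>i\<in>{a..<a + int l}. \<sigma> i = s) \<and>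
    (\<forall>j\<in>{a - int l..<a} \<union> {a + int l..<a + int l + int l}. \<sigma> j = - s)})"
  \<comment> \<open>The spin is - s, where s is the sign of the large field sum, so that flipping
    aligns the block with the field.\<close>
  define C2 where "C2 = (\<lambda>(a, s). {\<sigma>::int \<Rightarrow> real. \<forall>i\<in>{a..<a + int (K * L)}. \<sigma> i = - s})"
  let ?I1 = "{- int M..int M} \<times> {1..l1} \<times> {1, -1::real}"
  let ?I2 = "{- int m..int m} \<times> {1, -1::real}"
  have b1: "P ?\<Lambda> (C1 x) \<le> exp (- \<beta>)" if xI: "x \<in> ?I1" for x
  proof -
    obtain a l s where x: "x = (a, l, s)" and a: "a \<in> {- int M..int M}" and l: "l \<in> {1..l1}"
      and s: "s = 1 \<or> s = -1" using xI by auto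
    have l': "0 < l" "l \<le> l1" using l by auto
    have sub: "{a - int l..<a + int l + int l} \<subseteq> ?\<Lambda>"
    proof -
      have "int M + 2 * int l1 \<le> int n" using n by linarith
      then show ?thesis using a l' by auto
    qed
    have "P ?\<Lambda> (C1 x) \<le> exp (- \<beta> * (2 * run_gain l))"
    proof (rule P_le_exp_flip[where I = "{a..<a + int l}"])
      show "{a..<a + int l} \<subseteq> ?\<Lambda>" using sub by (rule subset_trans[rotated]) auto
      fix \<sigma> assume \<sigma>: "\<sigma> \<in> configs ?\<Lambda> (\<lambda>_. 1)" "\<sigma> \<in> C1 x"
      have "\<bar>\<theta> * block_sum a l h\<bar> = \<theta> * \<bar>block_sum a l h\<bar>" using \<theta> by (simp add: abs_mult)
      also have "\<dots> \<le> \<theta> * t l" using small[OF a l] \<theta> by (intro mult_left_mono) auto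
      also have "\<dots> \<le> run_gain l" using gain[OF l'] by simp
      finally have g: "\<bar>\<theta> * block_sum a l h\<bar> \<le> run_gain l" .
      show "2 * run_gain l \<le> H ?\<Lambda> \<sigma> - H ?\<Lambda> (flip {a..<a + int l} \<sigma>)"
        by (rule H_flip_short[OF _ sub l'(1) \<sigma>(1) s _ _ g]) (use \<sigma>(2) in \<open>simp_all only: C1_def x split mem_Collect_eq, blast+\<close>)
    qed simp
    also have "\<dots> \<le> exp (- \<beta>)" using gain[OF l'] \<beta>_pos by simp
    finally show ?thesis .
  qed
  have b2: "P ?\<Lambda> (C2 x) \<le> exp (- \<beta>)" if xI: "x \<in> ?I2" for x
  proof -
    obtain a s where x: "x = (a, s)" and a: "a \<in> {- int m..int m}" and s: "s \<in> {1, -1}" using xI by auto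
    obtain k where k: "k < K" "sqrt L / 4 \<le> s * block_sum (a + int (k * L)) L h" using large[OF a s] by blast
    let ?I = "{a + int (k * L)..<a + int (k * L) + int L}"
    have "(k + 1) * L \<le> K * L" using k by (intro mult_right_mono) auto
    then have "k * L + L \<le> K * L" by simp
    then have kL: "int (k * L) + int L \<le> int (K * L)" by (simp only: of_nat_le_iff flip: of_nat_add)
    have subK: "?I \<subseteq> {a..<a + int (K * L)}" using kL by auto
    have "m + K * L \<le> n" using n M by linarith
    then have "int m + int (K * L) \<le> int n" by (simp only: of_nat_le_iff flip: of_nat_add)
    moreover have "0 \<le> int (k * L)" by (rule of_nat_0_le_iff)
    ultimately have "- int n \<le> a + int (k * L)" "a + int (k * L) + int L \<le> int n"
      using kL a unfolding atLeastAtMost_iff by linarith+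
    then have sub: "?I \<subseteq> ?\<Lambda>" by auto
    have "P ?\<Lambda> (C2 x) \<le> exp (- \<beta> * 1)"
    proof (rule P_le_exp_flip[OF _ sub])
      fix \<sigma> assume \<sigma>: "\<sigma> \<in> configs ?\<Lambda> (\<lambda>_. 1)" "\<sigma> \<in> C2 x"
      have "- 2 * \<theta> * (- s * block_sum (a + int (k * L)) L h) - 4 * (J1 + tail 1 + (\<Sum>k<L. tail (k + 1)))
         \<le> H ?\<Lambda> \<sigma> - H ?\<Lambda> (flip ?I \<sigma>)"
      proof (rule H_flip_long[OF _ sub KL \<sigma>(1)])
        fix i assume "i \<in> ?I"
        then show "\<sigma> i = - s" using \<sigma>(2) subK unfolding C2_def x split mem_Collect_eq by blast
      qed simp
      moreover have "\<theta> * sqrt L / 2 \<le> - 2 * \<theta> * (- s * block_sum (a + int (k * L)) L h)"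
        using mult_left_mono[OF k(2), of "2 * \<theta>"] \<theta> by simp
      ultimately show "1 \<le> H ?\<Lambda> \<sigma> - H ?\<Lambda> (flip ?I \<sigma>)" using L by linarith
    qed simp
    then show ?thesis by simp
  qed
  have cover: "configs ?\<Lambda> (\<lambda>_. 1) \<inter> - typical m lo hi \<subseteq> (\<Union>x\<in>?I1. C1 x) \<union> (\<Union>x\<in>?I2. C2 x)"
  proof
    fix \<sigma> assume "\<sigma> \<in> configs ?\<Lambda> (\<lambda>_. 1) \<inter> - typical m lo hi"
    then have conf: "\<sigma> \<in> configs ?\<Lambda> (\<lambda>_. 1)" and "\<sigma> \<notin> typical m lo hi" by auto
    then obtain p l where pl: "- int m \<le> p" "p + int l \<le> int m + 1" "is_run \<sigma> p l"
      and bad: "\<not> (lo \<le> real l \<and> real l \<le> hi)" unfolding typical_def by blast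
    have pm: "\<sigma> i = 1 \<or> \<sigma> i = -1" for i using conf by (cases "i \<in> ?\<Lambda>") (auto simp: configs_def)
    have lpos: "0 < l" using pl(3) by (rule is_run_pos)
    have p: "p \<in> {- int m..int m}" using pl(1,2) lpos by auto
    show "\<sigma> \<in> (\<Union>x\<in>?I1. C1 x) \<union> (\<Union>x\<in>?I2. C2 x)"
    proof (cases "lo \<le> real l")
      case False
      \<comment> \<open>Lengths are integers: l < lo \<le> l1 + 1 already gives l \<le> l1.\<close>
      then have "l \<le> l1" using lo by linarith
      obtain a l' where al: "0 < l'" "l' \<le> l" "\<bar>a - p\<bar> \<le> int l * int l"
        and const: "\<forall>i\<in>{a..<a + int l'}. \<sigma> i = \<sigma> a"
          "\<forall>j\<in>{a - int l'..<a} \<union> {a + int l'..<a + int l' + int l'}. \<sigma> j = - \<sigma> a"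
        using locally_minimal_run[OF pm pl(3)] by blast
      have "int l * int l \<le> int l1 * int l1" using \<open>l \<le> l1\<close> by (intro mult_mono) auto
      then have "a \<in> {- int M..int M}" using al(3) p unfolding M by auto
      moreover have "\<sigma> a \<in> {1, -1}" using pm[of a] by auto
      moreover have "l' \<in> {1..l1}" using al(1,2) \<open>l \<le> l1\<close> by auto
      ultimately have "(a, l', \<sigma> a) \<in> ?I1" by blast
      moreover have "\<sigma> \<in> C1 (a, l', \<sigma> a)" unfolding C1_def split mem_Collect_eq using const by blast
      ultimately show ?thesis by blast
    next
      case True
      then have "real (K * L) < real l" using bad hi by linarith
      then have "int (K * L) < int l" by (simp only: of_nat_less_iff)
      then have "{p..<p + int (K * L)} \<subseteq> {p..<p + int l}" by auto
      then have "\<forall>i\<in>{p..<p + int (K * L)}. \<sigma> i = - (- \<sigma> p)" using pl(3) unfolding is_run_def minus_minus by blast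
      then have "\<sigma> \<in> C2 (p, - \<sigma> p)" unfolding C2_def split mem_Collect_eq .
      moreover have "- \<sigma> p \<in> {1, -1}" using pm[of p] by auto
      ultimately show ?thesis using p by blast
    qed
  qed
  have "P ?\<Lambda> (- typical m lo hi) \<le> P ?\<Lambda> ((\<Union>x\<in>?I1. C1 x) \<union> (\<Union>x\<in>?I2. C2 x))"
    by (rule P_mono[OF _ cover]) simp
  also have "\<dots> \<le> P ?\<Lambda> (\<Union>x\<in>?I1. C1 x) + P ?\<Lambda> (\<Union>x\<in>?I2. C2 x)" by (rule P_Un_le) simp
  also have "P ?\<Lambda> (\<Union>x\<in>?I1. C1 x) \<le> (\<Sum>x\<in>?I1. P ?\<Lambda> (C1 x))" by (rule P_subadditive) auto
  also have "\<dots> \<le> (\<Sum>x\<in>?I1. exp (- \<beta>))" by (rule sum_mono) (rule b1)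
  also have "\<dots> = (2 * real M + 1) * real l1 * 2 * exp (- \<beta>)" by (simp add: card_cartesian_product)
  also have "P ?\<Lambda> (\<Union>x\<in>?I2. C2 x) \<le> (\<Sum>x\<in>?I2. P ?\<Lambda> (C2 x))" by (rule P_subadditive) auto
  also have "\<dots> \<le> (\<Sum>x\<in>?I2. exp (- \<beta>))" by (rule sum_mono) (rule b2)
  also have "\<dots> = (2 * real m + 1) * 2 * exp (- \<beta>)" by (simp add: card_cartesian_product)
  finally show ?thesis by (simp add: distrib_right)
qed

text \<open>The \<open>lim\<close> in \<open>gibbs_mu\<close> is unspecified for a divergent
  sequence; convergence on local events is what transfers the finite-volume bounds to it.\<close>

lemma gibbs_mu_typical_ge:
  assumes "\<And>n. N \<le> n \<Longrightarrow> P {- int n..int n} (- typical m lo hi) \<le> \<epsilon>"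
  shows "1 - \<epsilon> \<le> gibbs_mu J1 \<alpha> \<theta> \<beta> h (typical m lo hi)"
proof -
  have "1 - \<epsilon> \<le> P {- int n..int n} (typical m lo hi)" if "N \<le> n" for n
  proof -
    have "P {- int n..int n} (typical m lo hi \<union> - typical m lo hi)
        = P {- int n..int n} (typical m lo hi) + P {- int n..int n} (- typical m lo hi)"
      by (rule P_Un_disjoint) auto
    moreover have "typical m lo hi \<union> - typical m lo hi = UNIV" by blast
    ultimately show ?thesis using assms[OF that] P_UNIV[of "{- int n..int n}"] by simp
  qed
  moreover have "(\<lambda>n. P {- int n..int n} (typical m lo hi)) \<longlonglongrightarrow> lim (\<lambda>n. P {- int n..int n} (typical m lo hi))"
    using convergent_P_typical by (simp add: convergent_LIMSEQ_iff)
  ultimately show ?thesis unfolding gibbs_mu_def by (intro LIMSEQ_le_const) auto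
qed

end

text \<open>One exponent \<open>R\<close> controls the Hoeffding bounds, the search among
  \<open>K\<close> blocks and, through R \<le> \<beta>, the Gibbs measure. \<open>\<phi>\<close>
  stands for an explicit lower bound on the interaction gain, so that \<phi> l / \<theta> is the
  field sum that can be tolerated.\<close>

theorem typical_runs:
  fixes J1 \<alpha> \<theta> \<beta> R \<epsilon> lo hi :: real and m l1 L K :: nat and \<phi> :: "nat \<Rightarrow> real"
  assumes chain: "1 \<le> J1" "0 \<le> \<alpha>" "\<alpha> < 1/2" "0 < \<beta>" and \<theta>: "0 < \<theta>" and LK: "0 < L" "0 < K"
    and lo: "lo \<le> real l1 + 1" and hi: "real (K * L) \<le> hi"
    and \<phi>: "\<And>l. 0 < l \<Longrightarrow> l \<le> l1 \<Longrightarrow>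
      1 \<le> \<phi> l \<and> \<phi> l \<le> ising_chain.run_gain J1 \<alpha> l \<and> R \<le> (\<phi> l / \<theta>)\<^sup>2 / (2 * real l)"
    and L: "1 + 4 * (J1 + ising_chain.tail \<alpha> 1 + (\<Sum>k<L. ising_chain.tail \<alpha> (k + 1))) \<le> \<theta> * sqrt L / 2"
    and R: "R \<le> real K / 24" "R \<le> \<beta>"
    and \<epsilon>: "((2 * real (m + l1 * l1) + 1) * real l1 * 2 + (2 * real m + 1) * 2) * exp (- R) \<le> \<epsilon>"
  shows "\<exists>E\<in>sets field_dist. 1 - \<epsilon> \<le> measure field_dist E \<and>
    (\<forall>h\<in>E. 1 - \<epsilon> \<le> gibbs_mu J1 \<alpha> \<theta> \<beta> h
       {\<sigma>. \<forall>j\<in>runs_window \<sigma> {- int m..int m}. lo \<le> real (card (run \<sigma> j)) \<and> real (card (run \<sigma> j)) \<le> hi})"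
proof -
  define M where "M = m + l1 * l1"
  have t: "0 \<le> \<phi> l / \<theta> \<and> R \<le> (\<phi> l / \<theta>)\<^sup>2 / (2 * real l)" if "0 < l" "l \<le> l1" for l
    using \<phi>[OF that] \<theta> by auto
  obtain E where E1: "E \<in> sets field_dist"
    and E2: "1 - ((2 * real M + 1) * real l1 * (2 * exp (- R)) + (2 * real m + 1) * 2 * exp (- real K / 24)) \<le> measure field_dist E \<and>
      (\<forall>h\<in>E. (\<forall>a\<in>{- int M..int M}. \<forall>l\<in>{1..l1}. \<bar>block_sum a l h\<bar> \<le> \<phi> l / \<theta>) \<and>
       (\<forall>a\<in>{- int m..int m}. \<forall>s\<in>{1, -1}. \<exists>k<K. sqrt L / 4 \<le> s * block_sum (a + int (k * L)) L h))"
    by (rule bexE[OF exists_good_field[OF t LK]])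
  note good = bspec[OF conjunct2[OF E2]]
  have "(2 * real m + 1) * 2 * exp (- real K / 24) \<le> (2 * real m + 1) * 2 * exp (- R)"
    using R by (intro mult_left_mono) auto
  then have "(2 * real M + 1) * real l1 * (2 * exp (- R)) + (2 * real m + 1) * 2 * exp (- real K / 24) \<le> \<epsilon>"
    using \<epsilon> unfolding M_def[symmetric] by (simp add: distrib_right mult.assoc)
  then have PE: "1 - \<epsilon> \<le> measure field_dist E" using conjunct1[OF E2] by linarith
  have mu: "1 - \<epsilon> \<le> gibbs_mu J1 \<alpha> \<theta> \<beta> h
       {\<sigma>. \<forall>j\<in>runs_window \<sigma> {- int m..int m}. lo \<le> real (card (run \<sigma> j)) \<and> real (card (run \<sigma> j)) \<le> hi}"
    if "h \<in> E" for h
  proof -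
    \<comment> \<open>\<open>run_gain\<close> and \<open>tail\<close> do not depend on the field, so
      the hypotheses stated before h is drawn apply in this instance.\<close>
    interpret ising_chain J1 \<alpha> \<theta> \<beta> h by unfold_locales (use chain in auto)
    have gain: "1 \<le> run_gain l \<and> \<theta> * (\<phi> l / \<theta>) \<le> run_gain l" if "0 < l" "l \<le> l1" for l
      using \<phi>[OF that] \<theta> by auto
    have "1 - ((2 * real M + 1) * real l1 * 2 + (2 * real m + 1) * 2) * exp (- \<beta>)
       \<le> gibbs_mu J1 \<alpha> \<theta> \<beta> h (typical m lo hi)"
      by (rule gibbs_mu_typical_ge, rule P_not_typical_le[OF \<theta> LK(1) lo hi M_def _ gain])
        (use good[OF that] L in blast)+
    moreover have "((2 * real M + 1) * real l1 * 2 + (2 * real m + 1) * 2) * exp (- \<beta>)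
       \<le> ((2 * real M + 1) * real l1 * 2 + (2 * real m + 1) * 2) * exp (- R)"
      using R by (intro mult_left_mono) auto
    moreover have "typical m lo hi
       = {\<sigma>. \<forall>j\<in>runs_window \<sigma> {- int m..int m}. lo \<le> real (card (run \<sigma> j)) \<and> real (card (run \<sigma> j)) \<le> hi}"
      unfolding typical_def by (intro Collect_cong) (rule runs_window_iff[symmetric])
    ultimately show ?thesis using \<epsilon> unfolding M_def[symmetric] by simp
  qed
  show ?thesis by (rule bexI[OF _ E1], intro conjI PE ballI mu)
qed

section \<open>Choice of the length scales\<close>

lemma union_bound_count:
  fixes m l G y :: real
  assumes "0 \<le> m" "0 \<le> l" "m \<le> G * y" "l \<le> y" "1 \<le> G" "1 \<le> y"
  shows "(2 * (m + l * l) + 1) * l * 2 + (2 * m + 1) * 2 \<le> 16 * G * y ^ 3"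
proof -
  have y2: "1 \<le> y * y" using mult_mono[of 1 y 1 y] assms by simp
  have Gy: "1 \<le> G * y" using mult_mono[of 1 G 1 y] assms by simp
  have "(2 * (m + l * l) + 1) * l * 2 + (2 * m + 1) * 2
     \<le> (2 * (G * y + y * y) + 1) * y * 2 + (2 * (G * y) + 1) * 2"
    using assms Gy by (intro add_mono mult_mono) auto
  also have "\<dots> = 4 * (G * y * y) + 4 * (y * (y * y)) + 2 * y + 4 * (G * y) + 2" by (simp add: algebra_simps)
  \<comment> \<open>Every monomial is at most G y^3, and the coefficients 4, 4, 2, 4, 2 add up to
    16.\<close>
  also have "\<dots> \<le> 16 * (G * y * (y * y))"
  proof -
    have "G * y * y \<le> G * y * (y * y)" using assms Gy by (intro mult_left_mono) (auto simp: mult_le_cancel_left1)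
    moreover have "y * (y * y) \<le> G * y * (y * y)" using assms y2 by (intro mult_right_mono) (auto simp: mult_le_cancel_right1)
    moreover have "G * y \<le> G * y * (y * y)" using Gy y2 mult_left_mono[of 1 "y * y" "G * y"] by simp
    moreover have "y \<le> G * y" using assms by (simp add: mult_le_cancel_right1)
    ultimately show ?thesis using Gy by linarith
  qed
  also have "\<dots> = 16 * G * y ^ 3" by (simp add: power3_eq_cube)
  finally show ?thesis .
qed

text \<open>Of the exponent r, one g pays for the factor e^g in the size of the interval, one g is
  the probability aimed at, and 3 ln y pays for the powers of the length scale.\<close>

lemma count_exp_le:
  fixes m l1 :: nat and y g r :: real
  assumes "real m \<le> exp g * y" "real l1 \<le> y" "0 \<le> g" "1 \<le> y" "ln 16 + 2 * g + 3 * ln y \<le> r"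
  shows "((2 * real (m + l1 * l1) + 1) * real l1 * 2 + (2 * real m + 1) * 2) * exp (- r) \<le> exp (- g)"
proof -
  have "(2 * real (m + l1 * l1) + 1) * real l1 * 2 + (2 * real m + 1) * 2 \<le> 16 * exp g * y ^ 3"
    using union_bound_count[of "real m" "real l1" "exp g" y] assms by simp
  also have "\<dots> = exp (ln 16 + g + 3 * ln y)"
  proof -
    have "exp (3 * ln y) = y ^ 3" using assms exp_of_nat_mult[of 3 "ln y"] by simp
    then show ?thesis by (simp add: exp_add)
  qed
  finally have "((2 * real (m + l1 * l1) + 1) * real l1 * 2 + (2 * real m + 1) * 2) * exp (- r)
     \<le> exp (ln 16 + g + 3 * ln y) * exp (- r)" by (intro mult_right_mono) auto
  also have "\<dots> \<le> exp (- g)" using assms(5) by (simp flip: exp_add)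
  finally show ?thesis .
qed

lemma centered_interval_eq:
  assumes "0 \<le> D"
  shows "centered_interval D = {- int (nat \<lfloor>D / 2\<rfloor>)..int (nat \<lfloor>D / 2\<rfloor>)}"
proof -
  have "2 * \<bar>real_of_int i\<bar> \<le> D \<longleftrightarrow> \<bar>i\<bar> \<le> \<lfloor>D / 2\<rfloor>" for i
    by (simp add: le_floor_iff) linarith
  moreover have "int (nat \<lfloor>D / 2\<rfloor>) = \<lfloor>D / 2\<rfloor>" using assms by simp
  moreover have "{i. \<bar>i\<bar> \<le> f} = {- f..f}" for f :: int by auto
  ultimately show ?thesis by (simp only: centered_interval_def)
qed

text \<open>Everything is written in x = ln (1/\<theta>). \<open>M0\<close> solves M0^(1/2-\<alpha>)
  = 2 (4/(\<alpha>(1-\<alpha>)) + 1), so that on a block of length about M0 y the field gain exceeds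
  four times the power part of the surface bound by a further L^\<alpha>, which takes care of the
  constants. The lower scale solves lo^(1-2\<alpha>) = e^(2x) / (x^2 ln x), which leaves a Hoeffding
  exponent of at least zeta^2 x^2 ln x / 2.\<close>

lemma typical_runs_power:
  fixes \<alpha> J1 x \<beta> :: real
  defines "\<kappa> \<equiv> 2 / (1 - 2 * \<alpha>)" and "M0 \<equiv> (2 * (4 / (\<alpha> * (1 - \<alpha>)) + 1)) powr (2 / (1 - 2 * \<alpha>))"
    and "g \<equiv> x * ln x"
  assumes \<alpha>: "0 < \<alpha>" "\<alpha> < 1/2" and J1: "2 + (1 / \<alpha> + 2) / (1 - \<alpha>) \<le> J1" and \<beta>: "0 < \<beta>" "3 * g \<le> \<beta>"
    and x: "1 \<le> x" "1 \<le> ln x" "3 * \<kappa> + ln 16 \<le> ln x" "6 \<le> (zeta \<alpha>)\<^sup>2 * x" "0 < zeta \<alpha>"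
      "1 + 4 * (J1 + 1 / (1 - \<alpha>)) \<le> exp (\<kappa> * \<alpha> * x)"
  shows "\<exists>E\<in>sets field_dist. 1 - exp (- g) \<le> measure field_dist E \<and>
    (\<forall>h\<in>E. 1 - exp (- g) \<le> gibbs_mu J1 \<alpha> (exp (- x)) \<beta> h
       {\<sigma>. \<forall>j\<in>runs_window \<sigma> {- int (nat \<lfloor>exp g * exp (\<kappa> * x) / 2\<rfloor>)..int (nat \<lfloor>exp g * exp (\<kappa> * x) / 2\<rfloor>)}.
          x powr (- \<kappa>) * ln x powr (- \<kappa> / 2) * exp (\<kappa> * x) \<le> real (card (run \<sigma> j)) \<and>
          real (card (run \<sigma> j)) \<le> 146 * M0 * x * ln x * exp (\<kappa> * x)})"
proof -
  define y where "y = exp (\<kappa> * x)"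
  define lo where "lo = x powr (- \<kappa>) * ln x powr (- \<kappa> / 2) * y"
  define l1 where "l1 = nat \<lfloor>lo\<rfloor>"
  define L where "L = nat \<lceil>M0 * y\<rceil>"
  \<comment> \<open>72 = 24 * 3, so that K/24 reaches the exponent 3 g.\<close>
  define K where "K = nat \<lceil>72 * g\<rceil>"
  define \<phi> where "\<phi> l = 1 + zeta \<alpha> * real l powr \<alpha>" for l :: nat
  have \<kappa>: "0 < \<kappa>" "\<kappa> * (1 - 2 * \<alpha>) = 2" "\<kappa> * (1/2 - \<alpha>) = 1"
    using \<alpha> by (auto simp: \<kappa>_def field_simps)
  have Q: "1 \<le> 2 * (4 / (\<alpha> * (1 - \<alpha>)) + 1)" using \<alpha> by simp
  then have M0: "1 \<le> M0" unfolding M0_def using \<kappa>(1) by (intro ge_one_powr_ge_zero) (auto simp: \<kappa>_def)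
  have y1: "1 \<le> y" unfolding y_def using \<kappa> x by simp
  have g1: "1 \<le> g" unfolding g_def using mult_mono[of 1 x 1 "ln x"] x by simp
  have M0y: "1 \<le> M0 * y" using mult_mono[of 1 M0 1 y] M0 y1 by simp
  have lo_nonneg: "0 \<le> lo" unfolding lo_def using y1 by simp
  have lo_le: "lo \<le> y"
  proof -
    have "b powr a \<le> 1" if "1 \<le> b" "a \<le> 0" for a b :: real
      using powr_mono[of a 0 b] that by simp
    then have "x powr (- \<kappa>) \<le> 1" "ln x powr (- \<kappa> / 2) \<le> 1" using x(1,2) \<kappa>(1) by simp_all
    then have "x powr (- \<kappa>) * ln x powr (- \<kappa> / 2) \<le> 1" by (intro mult_le_one) auto
    then show ?thesis unfolding lo_def using y1 mult_right_mono[of "x powr (- \<kappa>) * ln x powr (- \<kappa> / 2)" 1 y] by simp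
  qed
  have l1: "real l1 \<le> lo" "lo \<le> real l1 + 1" unfolding l1_def using lo_nonneg by linarith+
  have L: "M0 * y \<le> real L" "real L \<le> 2 * M0 * y" "0 < L"
    unfolding L_def using M0y by linarith+
  have K: "72 * g \<le> real K" "real K \<le> 73 * g" "0 < K"
    unfolding K_def using g1 by linarith+
  interpret c: ising_chain J1 \<alpha> "exp (- x)" \<beta> "\<lambda>_. 0"
  proof
    have "0 \<le> (1 / \<alpha> + 2) / (1 - \<alpha>)" using \<alpha> by simp
    then show "1 \<le> J1" using J1 by linarith
  qed (use \<alpha> \<beta> in auto)
  show ?thesis
    unfolding y_def[symmetric] lo_def[symmetric]
  proof (rule typical_runs[where R = "3 * g" and L = L and K = K and ?l1.0 = l1 and \<phi> = \<phi>])
    show "1 \<le> J1" by (rule c.J1_ge)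
    show "real (K * L) \<le> 146 * M0 * x * ln x * y"
    proof -
      have "real (K * L) \<le> (73 * g) * (2 * M0 * y)"
        unfolding of_nat_mult using K L g1 by (intro mult_mono) auto
      then show ?thesis by (simp add: g_def mult_ac)
    qed
    show "3 * g \<le> real K / 24" using K by simp
    show "((2 * real (nat \<lfloor>exp g * y / 2\<rfloor> + l1 * l1) + 1) * real l1 * 2 + (2 * real (nat \<lfloor>exp g * y / 2\<rfloor>) + 1) * 2) * exp (- (3 * g)) \<le> exp (- g)"
    proof (rule count_exp_le[where y = y])
      have "0 \<le> exp g * y" using y1 by simp
      then show "real (nat \<lfloor>exp g * y / 2\<rfloor>) \<le> exp g * y" by linarith
      \<comment> \<open>The third g in R absorbs y^3 = exp (3 \<kappa> x) and the constant
        16.\<close>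
      have "x * (3 * \<kappa> + ln 16) \<le> x * ln x" using x by (intro mult_left_mono) auto
      moreover have "1 * ln 16 \<le> x * ln (16::real)" using x by (intro mult_right_mono) auto
      moreover have "x * (3 * \<kappa> + ln 16) = 3 * (\<kappa> * x) + x * ln 16" by (simp only: distrib_left mult_ac)
      moreover have "ln y = \<kappa> * x" by (simp add: y_def)
      ultimately show "ln 16 + 2 * g + 3 * ln y \<le> 3 * g" unfolding g_def by linarith
    qed (use l1 lo_le g1 y1 in auto)
    show "1 + 4 * (J1 + c.tail 1 + (\<Sum>k<L. c.tail (k + 1))) \<le> exp (- x) * sqrt (real L) / 2"
    proof -
      have t1: "c.tail 1 = 1 / (1 - \<alpha>)" by (simp add: c.tail_def)
      have "exp (\<kappa> * \<alpha> * x) = y powr \<alpha>" by (simp add: y_def powr_def)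
      also have "\<dots> \<le> real L powr \<alpha>"
      proof (rule powr_mono2)
        have "1 * y \<le> M0 * y" using M0 y1 by (intro mult_right_mono) auto
        then show "y \<le> real L" using L(1) by linarith
      qed (use \<alpha> y1 in auto)
      finally have La: "exp (\<kappa> * \<alpha> * x) \<le> real L powr \<alpha>" .
      have "2 * (4 / (\<alpha> * (1 - \<alpha>)) + 1) * exp x = (M0 * y) powr (1/2 - \<alpha>)"
      proof -
        have "M0 powr (1/2 - \<alpha>) = 2 * (4 / (\<alpha> * (1 - \<alpha>)) + 1)"
          unfolding M0_def \<kappa>_def[symmetric] powr_powr \<kappa>(3) using Q by simp
        moreover have "y powr (1/2 - \<alpha>) = exp x"
        proof -
          have "y powr (1/2 - \<alpha>) = exp (\<kappa> * (1/2 - \<alpha>) * x)" by (simp add: y_def powr_def mult_ac)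
          then show ?thesis unfolding \<kappa>(3) by simp
        qed
        ultimately show ?thesis using M0 y1 by (simp add: powr_mult)
      qed
      also have "\<dots> \<le> real L powr (1/2 - \<alpha>)" using L M0y \<alpha> by (intro powr_mono2) auto
      finally have "2 * (4 / (\<alpha> * (1 - \<alpha>)) + 1) * exp x * real L powr \<alpha> \<le> real L powr (1/2 - \<alpha>) * real L powr \<alpha>"
        by (intro mult_right_mono) auto
      also have "\<dots> = sqrt (real L)" by (simp add: powr_half_sqrt flip: powr_add)
      finally have "exp (- x) * (2 * (4 / (\<alpha> * (1 - \<alpha>)) + 1) * exp x * real L powr \<alpha>) \<le> exp (- x) * sqrt (real L)"
        by (intro mult_left_mono) auto
      moreover have "exp (- x) * (2 * q * exp x * r) = 2 * (q * r)" for q r :: real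
        by (simp add: exp_minus)
      ultimately have 1: "2 * ((4 / (\<alpha> * (1 - \<alpha>)) + 1) * real L powr \<alpha>) \<le> exp (- x) * sqrt (real L)"
        by (simp only:)
      have 2: "(\<Sum>k<L. c.tail (k + 1)) \<le> real L powr \<alpha> / \<alpha> / (1 - \<alpha>)" using \<alpha>(1) by (rule c.sum_tail_le_powr)
      have 3: "(4 / (\<alpha> * (1 - \<alpha>)) + 1) * real L powr \<alpha> = 4 * (real L powr \<alpha> / \<alpha> / (1 - \<alpha>)) + real L powr \<alpha>"
        by (simp add: distrib_right)
      have "1 + 4 * (J1 + r + u) \<le> e / 2" if "2 * w \<le> e" "u \<le> v" "w = 4 * v + l" "q \<le> l" "1 + 4 * (J1 + r) \<le> q"
        for e l q r u v w :: real
        using that by argo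
      from this[OF 1 2 3 La x(6)] show ?thesis unfolding t1 .
    qed
    fix l :: nat assume l: "0 < l" "l \<le> l1"
    have "3 * g \<le> (\<phi> l / exp (- x))\<^sup>2 / (2 * real l)"
    proof -
      have "real l powr (1 - 2 * \<alpha>) \<le> lo powr (1 - 2 * \<alpha>)"
        using l l1 \<alpha> by (intro powr_mono2) auto
      also have "\<dots> = exp (2 * x) / (x\<^sup>2 * ln x)"
      proof -
        have "lo powr (1 - 2 * \<alpha>) = x powr (- (\<kappa> * (1 - 2 * \<alpha>))) * ln x powr (- (\<kappa> * (1 - 2 * \<alpha>)) / 2) * y powr (1 - 2 * \<alpha>)"
          unfolding lo_def using y1 by (simp add: powr_mult powr_powr)
        also have "y powr (1 - 2 * \<alpha>) = exp (\<kappa> * (1 - 2 * \<alpha>) * x)" by (simp add: y_def powr_def mult_ac)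
        finally show ?thesis unfolding \<kappa>(2) using x by (simp add: powr_minus divide_simps)
      qed
      finally have "real l powr (1 - 2 * \<alpha>) \<le> exp (2 * x) / (x\<^sup>2 * ln x)" .
      moreover have "0 < x\<^sup>2 * ln x"
      proof (rule mult_pos_pos)
        show "0 < x\<^sup>2" using x(1) by simp
        show "0 < ln x" using x(2) by linarith
      qed
      ultimately have A: "real l powr (1 - 2 * \<alpha>) * (x\<^sup>2 * ln x) \<le> exp (2 * x)"
        by (simp only: pos_le_divide_eq)
      \<comment> \<open>The squared interaction gain supplies l^(2\<alpha>); the remaining factor
        l^(1-2\<alpha>) of l is the one bounded through the choice of \<open>lo\<close>.\<close>
      have lsplit: "real l powr \<alpha> * real l powr \<alpha> * real l powr (1 - 2 * \<alpha>) = real l"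
        using l by (simp flip: powr_add)
      have "3 * g * 2 * real l \<le> (zeta \<alpha>)\<^sup>2 * x * (x * ln x) * real l"
        using x(4) g1 by (intro mult_right_mono) (auto simp: g_def intro!: mult_right_mono)
      also have "\<dots> = (zeta \<alpha>)\<^sup>2 * (real l powr \<alpha>)\<^sup>2 * (real l powr (1 - 2 * \<alpha>) * (x\<^sup>2 * ln x))"
        by (subst lsplit[symmetric]) (simp add: power2_eq_square mult_ac)
      also have "\<dots> \<le> (zeta \<alpha>)\<^sup>2 * (real l powr \<alpha>)\<^sup>2 * exp (2 * x)"
        using A by (intro mult_left_mono) auto
      also have "\<dots> = (zeta \<alpha> * real l powr \<alpha> * exp x)\<^sup>2"
        by (simp add: power_mult_distrib exp_double)
      also have "\<dots> \<le> (\<phi> l * exp x)\<^sup>2"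
        unfolding \<phi>_def using x(5) by (intro power_mono mult_right_mono) auto
      finally show ?thesis using l by (simp add: exp_minus field_simps)
    qed
    moreover have "1 \<le> \<phi> l" unfolding \<phi>_def using x(5) by simp
    moreover have "\<phi> l \<le> c.run_gain l" unfolding \<phi>_def using \<alpha>(1) l(1) J1 by (rule c.run_gain_ge_powr)
    ultimately show "1 \<le> \<phi> l \<and> \<phi> l \<le> c.run_gain l \<and> 3 * g \<le> (\<phi> l / exp (- x))\<^sup>2 / (2 * real l)" by blast
  qed (use \<alpha> \<beta> L K l1 in auto)
qed

text \<open>The surface bound is now about 4 * 2x and has to stay below \<theta> sqrt L / 2; the
  factor 400 x^2 in \<open>L\<close> makes the latter at least 10 x. With \<open>K\<close> about 240
  x for the exponent 10 x, the product K L carries x^3, and 241 * 800 = 192800.\<close>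

lemma typical_runs_log:
  fixes J1 x \<beta> :: real
  defines "g \<equiv> x + ln x"
  assumes J1: "4 \<le> J1" and \<beta>: "0 < \<beta>" "10 * x \<le> \<beta>"
    and x: "20 \<le> x" "20 * x \<le> exp x" "ln 16 + 2 * g + 6 * x \<le> 10 * x"
      "1 + 4 * (J1 + 2 + ln 800 + 2 * ln x + 2 * x) \<le> 10 * x"
  shows "\<exists>E\<in>sets field_dist. 1 - exp (- g) \<le> measure field_dist E \<and>
    (\<forall>h\<in>E. 1 - exp (- g) \<le> gibbs_mu J1 0 (exp (- x)) \<beta> h
       {\<sigma>. \<forall>j\<in>runs_window \<sigma> {- int (nat \<lfloor>exp g * exp (2 * x) / 2\<rfloor>)..int (nat \<lfloor>exp g * exp (2 * x) / 2\<rfloor>)}.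
          exp (2 * x) \<le> real (card (run \<sigma> j)) \<and> real (card (run \<sigma> j)) \<le> 192800 * x ^ 3 * exp (2 * x)})"
proof -
  define y where "y = exp (2 * x)"
  define l1 where "l1 = nat \<lfloor>y\<rfloor>"
  define L where "L = nat \<lceil>400 * x\<^sup>2 * y\<rceil>"
  define K where "K = nat \<lceil>240 * x\<rceil>"
  define \<phi> where "\<phi> l = 1 + ln (real l)" for l :: nat
  have y1: "1 \<le> y" unfolding y_def using x by simp
  have g1: "0 \<le> g" unfolding g_def using x by simp
  have x2: "1 \<le> x\<^sup>2" using x by simp
  have x2y: "1 \<le> x\<^sup>2 * y" using mult_mono[of 1 "x\<^sup>2" 1 y] x2 y1 by simp
  have l1: "real l1 \<le> y" "y \<le> real l1 + 1" unfolding l1_def using y1 by linarith+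
  have L: "400 * x\<^sup>2 * y \<le> real L" "real L \<le> 800 * x\<^sup>2 * y" "0 < L"
    unfolding L_def using x2y by linarith+
  have K: "240 * x \<le> real K" "real K \<le> 241 * x" "0 < K"
    unfolding K_def using x by linarith+
  interpret c: ising_chain J1 0 "exp (- x)" \<beta> "\<lambda>_. 0"
    by unfold_locales (use J1 \<beta> in auto)
  show ?thesis
    unfolding y_def[symmetric]
  proof (rule typical_runs[where R = "10 * x" and L = L and K = K and ?l1.0 = l1 and \<phi> = \<phi>])
    show "1 \<le> J1" by (rule c.J1_ge)
    show "real (K * L) \<le> 192800 * x ^ 3 * y"
    proof -
      have "real (K * L) \<le> (241 * x) * (800 * x\<^sup>2 * y)"
        unfolding of_nat_mult using K L x by (intro mult_mono) auto
      then show ?thesis by (simp add: power2_eq_square power3_eq_cube mult_ac)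
    qed
    show "10 * x \<le> real K / 24" using K by simp
    show "((2 * real (nat \<lfloor>exp g * y / 2\<rfloor> + l1 * l1) + 1) * real l1 * 2 + (2 * real (nat \<lfloor>exp g * y / 2\<rfloor>) + 1) * 2) * exp (- (10 * x)) \<le> exp (- g)"
    proof (rule count_exp_le[where y = y])
      have "0 \<le> exp g * y" using y1 by simp
      then show "real (nat \<lfloor>exp g * y / 2\<rfloor>) \<le> exp g * y" by linarith
      show "ln 16 + 2 * g + 3 * ln y \<le> 10 * x" using x by (simp add: y_def)
    qed (use l1 g1 y1 in auto)
    show "1 + 4 * (J1 + c.tail 1 + (\<Sum>k<L. c.tail (k + 1))) \<le> exp (- x) * sqrt (real L) / 2"
    proof -
      have t1: "c.tail 1 = 1" by (simp add: c.tail_def)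
      have "20 * x * exp x = sqrt (400 * x\<^sup>2 * y)"
        using x by (intro real_sqrt_unique[symmetric]) (auto simp: y_def power_mult_distrib exp_double)
      also have "\<dots> \<le> sqrt (real L)" using L by simp
      finally have "exp (- x) * (20 * x * exp x) \<le> exp (- x) * sqrt (real L)" by (intro mult_left_mono) auto
      then have 1: "20 * x \<le> exp (- x) * sqrt (real L)" by (simp add: exp_minus field_simps)
      have 2: "(\<Sum>k<L. c.tail (k + 1)) \<le> 1 + ln (real L)" using L(3) by (intro c.sum_tail_le_ln) auto
      have 3: "ln (real L) \<le> ln 800 + 2 * ln x + 2 * x"
      proof -
        have "0 < real L" using L(3) by simp
        then have "ln (real L) \<le> ln (800 * x\<^sup>2 * y)"
          using L(2) by (subst ln_le_cancel_iff) linarith+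
        also have "\<dots> = ln 800 + 2 * ln x + 2 * x"
          using x by (simp add: y_def ln_mult ln_realpow)
        finally show ?thesis .
      qed
      have "1 + 4 * (J1 + 1 + u) \<le> e / 2" if "20 * x \<le> e" "u \<le> 1 + v" "v \<le> ln 800 + 2 * ln x + 2 * x" for e u v
        using that x(4) by argo
      from this[OF 1 2 3] show ?thesis unfolding t1 .
    qed
    fix l :: nat assume l: "0 < l" "l \<le> l1"
    have "10 * x \<le> (\<phi> l / exp (- x))\<^sup>2 / (2 * real l)"
    proof -
      have lnl: "0 \<le> ln (real l)" using l by simp
      have "20 * x * real l \<le> (\<phi> l)\<^sup>2 * y"
      \<comment> \<open>Up to length exp x the Hoeffding exponent is large because l is short;
        beyond it, because the logarithmic gain is at least x and x^2 \<ge> 20 x.\<close>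
      proof (cases "real l \<le> exp x")
        case True
        have "20 * x * real l \<le> exp x * exp x" using True x by (intro mult_mono) auto
        also have "\<dots> = 1\<^sup>2 * y" by (simp add: y_def flip: exp_add)
        also have "\<dots> \<le> (\<phi> l)\<^sup>2 * y" unfolding \<phi>_def using lnl y1 by (intro mult_right_mono power_mono) auto
        finally show ?thesis .
      next
        case False
        then have "x \<le> ln (real l)" using l by (simp add: ln_ge_iff)
        then have "x\<^sup>2 \<le> (\<phi> l)\<^sup>2" unfolding \<phi>_def using x by (intro power_mono) auto
        moreover have "20 * x \<le> x\<^sup>2" using x by (simp add: power2_eq_square)
        ultimately show ?thesis using l l1 x by (intro mult_mono) auto
      qed
      also have "(\<phi> l)\<^sup>2 * y = (\<phi> l * exp x)\<^sup>2" by (simp add: y_def power_mult_distrib exp_double)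
      finally show ?thesis using l by (simp add: exp_minus field_simps)
    qed
    moreover have "1 \<le> \<phi> l" unfolding \<phi>_def using l by simp
    moreover have "\<phi> l \<le> c.run_gain l" unfolding \<phi>_def using l(1) J1 by (intro c.run_gain_ge_ln) auto
    ultimately show "1 \<le> \<phi> l \<and> \<phi> l \<le> c.run_gain l \<and> 10 * x \<le> (\<phi> l / exp (- x))\<^sup>2 / (2 * real l)" by blast
  qed (use \<beta> L K l1 in auto)
qed

text \<open>Smallness of \<theta> = exp (- x) is expressed through large x. The last conjunct turns
  the assumed lower bound on \<beta> into \<beta> \<ge> 3 g.\<close>

lemma eventually_power_regime:
  fixes \<alpha> J1 :: real
  defines "\<kappa> \<equiv> 2 / (1 - 2 * \<alpha>)"
  assumes \<alpha>: "0 < \<alpha>" "\<alpha> < 1/2"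
  shows "\<forall>\<^sub>F x in at_top. 1 \<le> x \<and> 1 \<le> ln x \<and> 3 * \<kappa> + ln 16 \<le> ln x \<and> 6 \<le> (zeta \<alpha>)\<^sup>2 * x \<and>
    1 + 4 * (J1 + 1 / (1 - \<alpha>)) \<le> exp (\<kappa> * \<alpha> * x) \<and> 3 * (x * ln x) \<le> zeta \<alpha> / (2 ^ 8 * (exp (- x))\<^sup>2)"
proof -
  define z a where "z = zeta \<alpha>" and "a = \<kappa> * \<alpha>"
  have z: "0 < z" unfolding z_def using \<alpha> by (intro zeta_pos)
  have a: "0 < a" unfolding a_def \<kappa>_def using \<alpha> by simp
  have "\<forall>\<^sub>F x::real in at_top. 1 \<le> x" by real_asymp
  moreover have "\<forall>\<^sub>F x::real in at_top. 1 \<le> ln x" by real_asymp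
  moreover have "\<forall>\<^sub>F x::real in at_top. 3 * \<kappa> + ln 16 \<le> ln x" by real_asymp
  moreover have "\<forall>\<^sub>F x::real in at_top. 6 \<le> z\<^sup>2 * x" using z by real_asymp
  moreover have "\<forall>\<^sub>F x::real in at_top. 1 + 4 * (J1 + 1 / (1 - \<alpha>)) \<le> exp (a * x)" using a by real_asymp
  moreover have "\<forall>\<^sub>F x::real in at_top. 3 * (x * ln x) \<le> z / (2 ^ 8 * (exp (- x))\<^sup>2)" using z by real_asymp
  ultimately show ?thesis unfolding z_def a_def by eventually_elim blast
qed

lemma eventually_log_regime:
  "\<forall>\<^sub>F x::real in at_top. 20 \<le> x \<and> 20 * x \<le> exp x \<and> ln 16 + 2 * (x + ln x) + 6 * x \<le> 10 * x \<and>
    1 + 4 * (J1 + 2 + ln 800 + 2 * ln x + 2 * x) \<le> 10 * x \<and> 10 * x \<le> 1 / (2 ^ 8 * (exp (- x))\<^sup>2)"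
proof -
  have "\<forall>\<^sub>F x::real in at_top. 20 \<le> x" by real_asymp
  moreover have "\<forall>\<^sub>F x::real in at_top. 20 * x \<le> exp x" by real_asymp
  moreover have "\<forall>\<^sub>F x::real in at_top. ln 16 + 2 * (x + ln x) + 6 * x \<le> 10 * x" by real_asymp
  moreover have "\<forall>\<^sub>F x::real in at_top. 1 + 4 * (J1 + 2 + ln 800 + 2 * ln x + 2 * x) \<le> 10 * x" by real_asymp
  moreover have "\<forall>\<^sub>F x::real in at_top. 10 * x \<le> 1 / (2 ^ 8 * (exp (- x))\<^sup>2)" by real_asymp
  ultimately show ?thesis by eventually_elim blast
qed
theorem theorem2p1:
  fixes \<alpha> :: real
  assumes "0 \<le> \<alpha>" and "\<alpha> < 1/2"
  shows "\<exists>J0. \<forall>J1 \<ge> J0. \<exists>\<theta>0 > 0. \<exists>\<beta>0 c0 c1 c2. c0 > 0 \<and> c1 > 0 \<and> c2 > 0 \<and>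
    (\<forall>\<theta> \<beta>. 0 < \<theta> \<longrightarrow> \<theta> \<le> \<theta>0 \<longrightarrow> \<beta> > \<beta>0 \<longrightarrow> \<beta> \<ge> zeta \<alpha> / (2^8 * \<theta>^2) \<longrightarrow>
      (0 < \<alpha> \<longrightarrow>
        (let g = ln (1/\<theta>) * ln (ln (1/\<theta>));
             V = centered_interval (c0 * exp g * (1/\<theta>) powr (2 / (1 - 2*\<alpha>)));
             A = {\<sigma>. \<forall>j\<in>runs_window \<sigma> V.
                    c1 * ln (1/\<theta>) powr (-2 / (1 - 2*\<alpha>)) * ln (ln (1/\<theta>)) powr (-1 / (1 - 2*\<alpha>))
                      \<le> \<theta> powr (2 / (1 - 2*\<alpha>)) * real (card (run \<sigma> j)) \<and>
                    \<theta> powr (2 / (1 - 2*\<alpha>)) * real (card (run \<sigma> j))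
                      \<le> c2 * ln (1/\<theta>) * ln (ln (1/\<theta>))}
         in \<exists>E\<in>sets field_dist. measure field_dist E \<ge> 1 - exp (- g) \<and>
              (\<forall>h\<in>E. gibbs_mu J1 \<alpha> \<theta> \<beta> h A \<ge> 1 - exp (- g)))) \<and>
      (\<alpha> = 0 \<longrightarrow>
        (let g = ln (ln (1/\<theta>) / \<theta>);
             V = centered_interval (c0 * exp g * \<theta> powr (-2));
             A = {\<sigma>. \<forall>j\<in>runs_window \<sigma> V.
                    c1 \<le> \<theta>^2 * real (card (run \<sigma> j)) \<and>
                    \<theta>^2 * real (card (run \<sigma> j)) \<le> c2 * (ln (1/\<theta>))^3}
         in \<exists>E\<in>sets field_dist. measure field_dist E \<ge> 1 - exp (- g) \<and>
              (\<forall>h\<in>E. gibbs_mu J1 \<alpha> \<theta> \<beta> h A \<ge> 1 - exp (- g)))))"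
  (is "\<exists>J0. \<forall>J1 \<ge> J0. \<exists>\<theta>0 > 0. \<exists>\<beta>0 c0 c1 c2. c0 > 0 \<and> c1 > 0 \<and> c2 > 0 \<and>
    (\<forall>\<theta> \<beta>. 0 < \<theta> \<longrightarrow> \<theta> \<le> \<theta>0 \<longrightarrow> \<beta> > \<beta>0 \<longrightarrow> \<beta> \<ge> zeta \<alpha> / (2^8 * \<theta>^2) \<longrightarrow>
      (0 < \<alpha> \<longrightarrow> ?power J1 \<theta> \<beta> c0 c1 c2) \<and> (\<alpha> = 0 \<longrightarrow> ?log J1 \<theta> \<beta> c0 c1 c2))")
\<comment> \<open>At \<alpha> = 0 the convention 1/0 = 0 makes the second entry equal to 4 as well,
  so one threshold serves both regimes.\<close>
proof (rule exI[of _ "max 4 (2 + (1 / \<alpha> + 2) / (1 - \<alpha>))"], intro allI impI)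
  fix J1 :: real assume J1: "max 4 (2 + (1 / \<alpha> + 2) / (1 - \<alpha>)) \<le> J1"
  have x_eq: "exp (- ln (1/\<theta>)) = \<theta>" "(1/\<theta>) powr r = exp (r * ln (1/\<theta>))" "\<theta> powr r = 1 / exp (r * ln (1/\<theta>))"
    if "0 < \<theta>" for \<theta> r :: real
    using that by (auto simp: ln_div powr_def exp_minus inverse_eq_divide)
  have x_ge: "X \<le> ln (1/\<theta>)" if "0 < \<theta>" "\<theta> \<le> exp (- X)" for \<theta> X :: real
  proof -
    have "ln \<theta> \<le> - X" using that by (metis exp_gt_zero ln_exp ln_le_cancel_iff)
    then show ?thesis using that by (simp add: ln_div)
  qed
  show "\<exists>\<theta>0 > 0. \<exists>\<beta>0 c0 c1 c2. c0 > 0 \<and> c1 > 0 \<and> c2 > 0 \<and>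
    (\<forall>\<theta> \<beta>. 0 < \<theta> \<longrightarrow> \<theta> \<le> \<theta>0 \<longrightarrow> \<beta> > \<beta>0 \<longrightarrow> \<beta> \<ge> zeta \<alpha> / (2^8 * \<theta>^2) \<longrightarrow>
      (0 < \<alpha> \<longrightarrow> ?power J1 \<theta> \<beta> c0 c1 c2) \<and> (\<alpha> = 0 \<longrightarrow> ?log J1 \<theta> \<beta> c0 c1 c2))"
  proof (cases "\<alpha> = 0")
    case False
    then have \<alpha>: "0 < \<alpha>" using assms by simp
    define \<kappa> where "\<kappa> = 2 / (1 - 2 * \<alpha>)"
    define M0 where "M0 = (2 * (4 / (\<alpha> * (1 - \<alpha>)) + 1)) powr (2 / (1 - 2 * \<alpha>))"
    have exps: "-2 / (1 - 2*\<alpha>) = - \<kappa>" "-1 / (1 - 2*\<alpha>) = - \<kappa> / 2"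
      using assms(2) by (simp_all add: \<kappa>_def field_simps)
    obtain X where X: "\<And>x. X \<le> x \<Longrightarrow> 1 \<le> x \<and> 1 \<le> ln x \<and> 3 * \<kappa> + ln 16 \<le> ln x \<and> 6 \<le> (zeta \<alpha>)\<^sup>2 * x \<and>
      1 + 4 * (J1 + 1 / (1 - \<alpha>)) \<le> exp (\<kappa> * \<alpha> * x) \<and> 3 * (x * ln x) \<le> zeta \<alpha> / (2 ^ 8 * (exp (- x))\<^sup>2)"
      using eventually_power_regime[OF \<alpha> assms(2), of J1] unfolding eventually_at_top_linorder \<kappa>_def by blast
    have main: "?power J1 \<theta> \<beta> 1 1 (146 * M0)"
      if \<theta>: "0 < \<theta>" "\<theta> \<le> exp (- X)" and \<beta>: "0 < \<beta>" "zeta \<alpha> / (2^8 * \<theta>^2) \<le> \<beta>" for \<theta> \<beta>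
    proof -
      define x where "x = ln (1/\<theta>)"
      have e: "exp (- x) = \<theta>" "(1/\<theta>) powr \<kappa> = exp (\<kappa> * x)" "\<theta> powr \<kappa> = 1 / exp (\<kappa> * x)"
        using x_eq[OF \<theta>(1)] by (auto simp: x_def)
      note x = X[OF x_ge[OF \<theta>], folded x_def]
      have "3 * (x * ln x) \<le> \<beta>" using x \<beta>(2) unfolding e(1) by linarith
      note T = typical_runs_power[OF \<alpha> assms(2) _ \<beta>(1) this, folded \<kappa>_def M0_def, of J1]
      have V: "centered_interval (1 * exp (x * ln x) * (1/\<theta>) powr \<kappa>)
          = {- int (nat \<lfloor>exp (x * ln x) * exp (\<kappa> * x) / 2\<rfloor>)..int (nat \<lfloor>exp (x * ln x) * exp (\<kappa> * x) / 2\<rfloor>)}"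
        unfolding e mult_1 by (rule centered_interval_eq) simp
      \<comment> \<open>The statement scales lengths by \<theta> powr \<kappa> = 1 / exp (\<kappa>
        x); clearing this factor gives the bounds of \<open>typical_runs_power\<close>.\<close>
      have lo: "1 * x powr (- \<kappa>) * ln x powr (- \<kappa> / 2) \<le> \<theta> powr \<kappa> * n \<longleftrightarrow>
          x powr (- \<kappa>) * ln x powr (- \<kappa> / 2) * exp (\<kappa> * x) \<le> n" for n :: real
        unfolding e by (simp add: field_simps)
      have hi: "\<theta> powr \<kappa> * n \<le> 146 * M0 * x * ln x \<longleftrightarrow> n \<le> 146 * M0 * x * ln x * exp (\<kappa> * x)" for n :: real
        unfolding e by (simp add: field_simps)
      show ?thesis
        unfolding Let_def exps x_def[symmetric] \<kappa>_def[symmetric] V lo hi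
        using T x J1 zeta_pos[OF assms(2)] unfolding e(1) by simp
    qed
    have "0 < 2 * (4 / (\<alpha> * (1 - \<alpha>)) + 1)" using \<alpha> assms by (intro mult_pos_pos add_pos_pos divide_pos_pos) auto
    then have "0 < M0" unfolding M0_def powr_gt_zero by linarith
    then have pos: "0 < 146 * M0" by simp
    have all: "\<forall>\<theta> \<beta>. 0 < \<theta> \<longrightarrow> \<theta> \<le> exp (- X) \<longrightarrow> \<beta> > 0 \<longrightarrow> \<beta> \<ge> zeta \<alpha> / (2^8 * \<theta>^2) \<longrightarrow>
      (0 < \<alpha> \<longrightarrow> ?power J1 \<theta> \<beta> 1 1 (146 * M0)) \<and> (\<alpha> = 0 \<longrightarrow> ?log J1 \<theta> \<beta> 1 1 (146 * M0))"
    proof (intro allI impI conjI)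
      fix \<theta> \<beta> assume a: "0 < \<theta>" "\<theta> \<le> exp (- X)" "\<beta> > 0" "\<beta> \<ge> zeta \<alpha> / (2^8 * \<theta>^2)"
      show "?power J1 \<theta> \<beta> 1 1 (146 * M0)" by (rule main[OF a])
      assume "\<alpha> = 0"
      with False show "?log J1 \<theta> \<beta> 1 1 (146 * M0)" by (rule notE)
    qed
    show ?thesis
      by (rule exI[of _ "exp (- X)"], rule conjI[OF exp_gt_zero], rule exI[of _ 0], rule exI[of _ 1],
          rule exI[of _ 1], rule exI[of _ "146 * M0"], intro conjI zero_less_one pos all)
  next
    case True
    obtain X where X: "\<And>x. X \<le> x \<Longrightarrow> 20 \<le> x \<and> 20 * x \<le> exp x \<and> ln 16 + 2 * (x + ln x) + 6 * x \<le> 10 * x \<and>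
      1 + 4 * (J1 + 2 + ln 800 + 2 * ln x + 2 * x) \<le> 10 * x \<and> 10 * x \<le> 1 / (2 ^ 8 * (exp (- x))\<^sup>2)"
      using eventually_log_regime[of J1] unfolding eventually_at_top_linorder by blast
    have z: "zeta \<alpha> = 1" using True by (simp add: zeta_def)
    have main: "?log J1 \<theta> \<beta> 1 1 192800"
      if \<theta>: "0 < \<theta>" "\<theta> \<le> exp (- X)" and \<beta>: "0 < \<beta>" "zeta \<alpha> / (2^8 * \<theta>^2) \<le> \<beta>" for \<theta> \<beta>
    proof -
      define x where "x = ln (1/\<theta>)"
      have e: "exp (- x) = \<theta>" "\<theta> powr (-2) = exp (2 * x)" "\<theta>^2 = 1 / exp (2 * x)"
      proof -
        show "exp (- x) = \<theta>" using x_eq(1)[OF \<theta>(1)] by (simp add: x_def)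
        show "\<theta> powr (-2) = exp (2 * x)" using x_eq(3)[OF \<theta>(1), of "-2"] by (simp add: x_def exp_minus inverse_eq_divide)
        show "\<theta>^2 = 1 / exp (2 * x)" using x_eq(3)[OF \<theta>(1), of 2] \<theta>(1) by (simp add: x_def powr_numeral)
      qed
      note x = X[OF x_ge[OF \<theta>], folded x_def]
      have "10 * x \<le> \<beta>" using x \<beta>(2) unfolding e(1) z by linarith
      note T = typical_runs_log[OF _ \<beta>(1) this, of J1]
      have g: "ln (x / \<theta>) = x + ln x"
      proof -
        have "ln (x / exp (- x)) = x + ln x" using x by (simp add: ln_div)
        then show ?thesis unfolding e(1) .
      qed
      have V: "centered_interval (1 * exp (x + ln x) * \<theta> powr (-2))
          = {- int (nat \<lfloor>exp (x + ln x) * exp (2 * x) / 2\<rfloor>)..int (nat \<lfloor>exp (x + ln x) * exp (2 * x) / 2\<rfloor>)}"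
        unfolding e mult_1 by (rule centered_interval_eq) simp
      have lo: "1 \<le> \<theta>^2 * n \<longleftrightarrow> exp (2 * x) \<le> n" for n :: real
        unfolding e by (simp add: field_simps)
      have hi: "\<theta>^2 * n \<le> 192800 * x ^ 3 \<longleftrightarrow> n \<le> 192800 * x ^ 3 * exp (2 * x)" for n :: real
        unfolding e by (simp add: field_simps)
      show ?thesis
        unfolding Let_def x_def[symmetric] g V lo hi
        using T x J1 unfolding e(1) True by simp
    qed
    have pos: "0 < (192800::real)" by simp
    have all: "\<forall>\<theta> \<beta>. 0 < \<theta> \<longrightarrow> \<theta> \<le> exp (- X) \<longrightarrow> \<beta> > 0 \<longrightarrow> \<beta> \<ge> zeta \<alpha> / (2^8 * \<theta>^2) \<longrightarrow>
      (0 < \<alpha> \<longrightarrow> ?power J1 \<theta> \<beta> 1 1 (192800)) \<and> (\<alpha> = 0 \<longrightarrow> ?log J1 \<theta> \<beta> 1 1 (192800))"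
    proof (intro allI impI conjI)
      fix \<theta> \<beta> assume a: "0 < \<theta>" "\<theta> \<le> exp (- X)" "\<beta> > 0" "\<beta> \<ge> zeta \<alpha> / (2^8 * \<theta>^2)"
      show "?log J1 \<theta> \<beta> 1 1 192800" by (rule main[OF a])
      assume "0 < \<alpha>"
      then have "\<alpha> \<noteq> 0" by simp
      then show "?power J1 \<theta> \<beta> 1 1 192800" using True by (rule notE)
    qed
    show ?thesis
      by (rule exI[of _ "exp (- X)"], rule conjI[OF exp_gt_zero], rule exI[of _ 0], rule exI[of _ 1],
          rule exI[of _ 1], rule exI[of _ "192800"], intro conjI zero_less_one pos all)
  qed
qed

end
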